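(* Let $k$ be an algebraically closed field and let $Q$ be a quiver without oriented cycles. Let $M=(M_1,\ldots,M_r)$ be a sequence of indecomposable finite-dimensional $k$-representations of $Q$ such that (1) $\mathrm{End}_Q(M_j)=k$ for all $j\geq 2$; (2) $\mathrm{Hom}_Q(M_i,M_j)=\mathrm{Ext}_Q(M_i,M_j)=0$ for all $i<j$; (3) $\mathrm{Hom}_Q(M_j,M_i)=0$ for all $i<j$ with $i,j\neq 1$. Let $F_M:\mathrm{Rep}(Q(M))\to\mathrm{Rep}(Q)$ be the functor defined in the context. Let $X$ be a representation of $Q(M)$ such that $\dim X_{m_1}=1$ and such that the natural isomorphism $\Theta^1_X$ (defined in the context) induces an isomorphism $$\bigoplus_{i=2}^r\mathrm{Ext}_Q(M_i^{\dim X_{m_i}},M_1)\cong\mathrm{Ext}_Q(F_MX_2,M_1),$$ where $X_2$ is the restriction of $X$ to the full subquiver $Q(M)\setminus\{m_1\}$. Then $F_MX$ is indecomposable whenever $X$ is indecomposable.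
   Context: Notation. $Q_0$ and $Q_1$ denote the vertices and arrows of $Q$. $\mathrm{Rep}(Q)$ is the category of finite-dimensional $k$-representations of $Q$. For representations $X,Y$ of $Q$ let $$d_{X,Y}:\bigoplus_{q\in Q_0}\mathrm{Hom}_k(X_q,Y_q)\to\bigoplus_{\rho:q\to q'\in Q_1}\mathrm{Hom}_k(X_q,Y_{q'}),\quad (f_q)_q\mapsto (Y_\rho f_q-f_{q'}X_\rho)_{\rho:q\to q'}.$$ Then $\ker d_{X,Y}=\mathrm{Hom}_Q(X,Y)$ and $\mathrm{coker}\, d_{X,Y}=\mathrm{Ext}_Q(X,Y)$. The quiver $Q(M)$. The quiver $Q(M)$ has vertices $m_1,\ldots,m_r$, it has $n_{ij}:=\dim_k\mathrm{Ext}_Q(M_i,M_j)$ arrows from $m_i$ to $m_j$ if $i\neq j$, and it has no loops. For each pair $i\neq j$ fix a set $\{\chi^{ij}_1,\ldots,\chi^{ij}_{n_{ij}}\}\subseteq\bigoplus_{\rho:q\to q'\in Q_1}\mathrm{Hom}_k((M_i)_q,(M_j)_{q'})$ whose residue classes form a basis of $\mathrm{Ext}_Q(M_i,M_j)$; the arrows of $Q(M)$ from $m_i$ to $m_j$ are also denoted by $\chi^{ij}_1,\ldots,\chi^{ij}_{n_{ij}}$. The functor $F_M$. For a representation $X$ of $Q(M)$ put $\tilde X_{i,q}:=(M_i)_q\otimes_kX_{m_i}$. Define $F_MX$ by $(F_MX)_q=\bigoplus_{i=1}^r\tilde X_{i,q}$ for $q\in Q_0$ and, for $\rho:q\to q'$,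 by the linear map $(F_MX)_\rho:\bigoplus_{i}\tilde X_{i,q}\to\bigoplus_i\tilde X_{i,q'}$ whose block components are $$((F_MX)_\rho)_{i,i}=(M_i)_\rho\otimes_k\mathrm{id}_{X_{m_i}}:\tilde X_{i,q}\to\tilde X_{i,q'},\qquad ((F_MX)_\rho)_{i,j}=\sum_{l=1}^{n_{ji}}(\chi^{ji}_l)_\rho\otimes_kX_{\chi^{ji}_l}:\tilde X_{j,q}\to\tilde X_{i,q'}\ (i\neq j).$$ For a morphism $f=(f_{m_i})_i:X\to X'$ define $F_Mf$ by $((F_Mf)_q)_{i,i}=\mathrm{id}_{(M_i)_q}\otimes_kf_{m_i}$ and $((F_Mf)_q)_{i,j}=0$ for $i\neq j$. The representation $X_2$ is regarded as a representation of $Q(M)$ with zero space at $m_1$, so $(F_MX_2)_q=\bigoplus_{i=2}^r\tilde X_{i,q}$. The isomorphism $\Theta^1_X$. It is the natural isomorphism $$\Theta^1_X:\bigoplus_{i=2}^r\bigoplus_{l=1}^{n_{i1}}\mathrm{Hom}_k(X_{m_i},X_{m_1})\to\bigoplus_{i=2}^r\mathrm{Ext}_Q(M_i^{\dim X_{m_i}},M_1^{\dim X_{m_1}})$$ sending $(\phi^i_l)_{i,l}$ to the tuple, indexed by $i$, of classes of $\big(\sum_{l=1}^{n_{i1}}(\chi^{i1}_l)_\rho\otimes_k\phi^i_l\big)_{\rho\in Q_1}$, where $M_i^{\dim X_{m_i}}$ is identified with the representation with spaces $(M_i)_q\otimes_kX_{m_i}$ and maps $(M_i)_\rho\otimes_k\mathrm{id}_{X_{m_i}}$.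 When $\dim X_{m_1}=1$, so that $M_1^{\dim X_{m_1}}=M_1$, that $\Theta^1_X$ "induces an isomorphism $\bigoplus_{i=2}^r\mathrm{Ext}_Q(M_i^{\dim X_{m_i}},M_1)\cong\mathrm{Ext}_Q(F_MX_2,M_1)$" means that the linear map sending the image under $\Theta^1_X$ of $(\phi^i_l)_{i,l}$ to the class in $\mathrm{Ext}_Q(F_MX_2,M_1)$ of the element of $\bigoplus_{\rho:q\to q'}\mathrm{Hom}_k((F_MX_2)_q,(M_1)_{q'})$ with components $\sum_{l=1}^{n_{i1}}(\chi^{i1}_l)_\rho\otimes_k\phi^i_l$ on the summands $\tilde X_{i,q}$ ($i\geq2$) is an isomorphism. *)

theory Defs
  imports
    "HOL-Computational_Algebra.Polynomial"
    "HOL-Library.Function_Algebras"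
    "HOL-Library.FuncSet"
    "Graph_Theory.Arc_Walk"
begin

section \<open>Linear maps between subspaces\<close>

text \<open>
  Vector spaces over the field 'k are subspaces V of an ambient type with a scalar multiplication s
  (a \<open>vector_space\<close>).  The elements of Hom_k(V, W) are functions on the ambient type; in order that
  two linear maps agree iff they are equal, they are extended by 0 outside V.  With this convention
  Hom_k(V, W) is a vector space under pointwise operations.
\<close>

definition hom_space ::
  "('k \<Rightarrow> 'v \<Rightarrow> 'v) \<Rightarrow> ('k \<Rightarrow> 'w \<Rightarrow> 'w) \<Rightarrow> 'v set \<Rightarrow> 'w set \<Rightarrow> ('v::ab_group_add \<Rightarrow> 'w::ab_group_add) set" where
  "hom_space s t V W = {f.
     (\<forall>x\<in>V. f x \<in> W) \<and>
     (\<forall>x\<in>V. \<forall>y\<in>V. f (x + y) = f x + f y) \<and>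
     (\<forall>c. \<forall>x\<in>V. f (s c x) = t c (f x)) \<and>
     (\<forall>x. x \<notin> V \<longrightarrow> f x = 0)}"

definition fin_dim_subspace :: "('k::field \<Rightarrow> 'v \<Rightarrow> 'v) \<Rightarrow> 'v::ab_group_add set \<Rightarrow> bool" where
  "fin_dim_subspace s V \<longleftrightarrow> (\<exists>B. finite B \<and> module.span s B = V)"

section \<open>Tensor products\<close>

text \<open>
  For ambient spaces 'v and 'w, the tensor product over 'k embeds canonically into the linear dual
  of the space of bilinear forms 'v \<times> 'w \<rightarrow> 'k, with v \<otimes> w acting as evaluation at (v, w);
  over a field this is injective, because bilinear forms separate the elements of a tensor product.
  For the same reason V \<otimes> W, for subspaces V and W, is the span of the v \<otimes> w with
  v in V and w in W.  (Functions that are not bilinear forms are sent to 0.)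
\<close>

definition bilinear_form ::
  "('k::field \<Rightarrow> 'v::ab_group_add \<Rightarrow> 'v) \<Rightarrow> ('k \<Rightarrow> 'w::ab_group_add \<Rightarrow> 'w) \<Rightarrow> ('v \<Rightarrow> 'w \<Rightarrow> 'k) \<Rightarrow> bool" where
  "bilinear_form s t \<beta> \<longleftrightarrow>
     (\<forall>w. Vector_Spaces.linear s (*) (\<lambda>v. \<beta> v w)) \<and> (\<forall>v. Vector_Spaces.linear t (*) (\<beta> v))"

type_synonym ('k, 'v, 'w) tensor = "('v \<Rightarrow> 'w \<Rightarrow> 'k) \<Rightarrow> 'k"

definition tensor_scale :: "'k::field \<Rightarrow> ('k, 'v, 'w) tensor \<Rightarrow> ('k, 'v, 'w) tensor" where
  "tensor_scale c t = (\<lambda>\<beta>. c * t \<beta>)"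

definition pure_tensor ::
  "('k::field \<Rightarrow> 'v::ab_group_add \<Rightarrow> 'v) \<Rightarrow> ('k \<Rightarrow> 'w::ab_group_add \<Rightarrow> 'w) \<Rightarrow> 'v \<Rightarrow> 'w \<Rightarrow> ('k, 'v, 'w) tensor" where
  "pure_tensor s t v w = (\<lambda>\<beta>. if bilinear_form s t \<beta> then \<beta> v w else 0)"

definition tensor_space ::
  "('k::field \<Rightarrow> 'v::ab_group_add \<Rightarrow> 'v) \<Rightarrow> ('k \<Rightarrow> 'w::ab_group_add \<Rightarrow> 'w) \<Rightarrow> 'v set \<Rightarrow> 'w set
     \<Rightarrow> ('k, 'v, 'w) tensor set" where
  "tensor_space s t V W = module.span tensor_scale {pure_tensor s t v w | v w. v \<in> V \<and> w \<in> W}"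

text \<open>
  f \<otimes> g for linear maps f on V and g on W with values in spaces with scalar multiplications
  s' and t': the unique linear map on V \<otimes> W sending v \<otimes> w to f v \<otimes> g w.
\<close>

definition tensor_map ::
  "('k::field \<Rightarrow> 'v::ab_group_add \<Rightarrow> 'v) \<Rightarrow> ('k \<Rightarrow> 'w::ab_group_add \<Rightarrow> 'w)
     \<Rightarrow> ('k \<Rightarrow> 'v'::ab_group_add \<Rightarrow> 'v') \<Rightarrow> ('k \<Rightarrow> 'w'::ab_group_add \<Rightarrow> 'w')
     \<Rightarrow> 'v set \<Rightarrow> 'w set \<Rightarrow> ('v \<Rightarrow> 'v') \<Rightarrow> ('w \<Rightarrow> 'w') \<Rightarrow> ('k, 'v, 'w) tensor \<Rightarrow> ('k, 'v', 'w') tensor" where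
  "tensor_map s t s' t' V W f g = (THE h.
     h \<in> hom_space tensor_scale tensor_scale (tensor_space s t V W) UNIV \<and>
     (\<forall>v\<in>V. \<forall>w\<in>W. h (pure_tensor s t v w) = pure_tensor s' t' (f v) (g w)))"

section \<open>Representations of quivers\<close>

text \<open>
  A quiver is a (multi-)digraph; \<open>spc X q\<close> is the space X_q and \<open>rmap X \<rho>\<close> the map X_\<rho>.
  Nothing below requires the quiver to be finite: for infinite quivers a finite-dimensional
  representation has finite total dimension.
\<close>

record ('q, 'a, 'k, 'v) quiver_rep =
  scl :: "'k \<Rightarrow> 'v \<Rightarrow> 'v"
  spc :: "'q \<Rightarrow> 'v set"
  rmap :: "'a \<Rightarrow> 'v \<Rightarrow> 'v"

definition is_rep ::
  "('q, 'a) pre_digraph \<Rightarrow> ('q, 'a, 'k::field, 'v::ab_group_add) quiver_rep \<Rightarrow> bool" where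
  "is_rep Q X \<longleftrightarrow> vector_space (scl X) \<and>
     (\<forall>q\<in>verts Q. fin_dim_subspace (scl X) (spc X q)) \<and>
     finite {q \<in> verts Q. spc X q \<noteq> {0}} \<and>
     (\<forall>\<rho>\<in>arcs Q. rmap X \<rho> \<in> hom_space (scl X) (scl X) (spc X (tail Q \<rho>)) (spc X (head Q \<rho>)))"

definition is_subrep ::
  "('q, 'a) pre_digraph \<Rightarrow> ('q, 'a, 'k::field, 'v::ab_group_add) quiver_rep \<Rightarrow> ('q \<Rightarrow> 'v set) \<Rightarrow> bool" where
  "is_subrep Q X U \<longleftrightarrow>
     (\<forall>q\<in>verts Q. module.subspace (scl X) (U q) \<and> U q \<subseteq> spc X q) \<and>
     (\<forall>\<rho>\<in>arcs Q. rmap X \<rho> ` U (tail Q \<rho>) \<subseteq> U (head Q \<rho>))"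

definition indecomposable ::
  "('q, 'a) pre_digraph \<Rightarrow> ('q, 'a, 'k::field, 'v::ab_group_add) quiver_rep \<Rightarrow> bool" where
  "indecomposable Q X \<longleftrightarrow> is_rep Q X \<and> (\<exists>q\<in>verts Q. spc X q \<noteq> {0}) \<and>
     (\<forall>U W. is_subrep Q X U \<and> is_subrep Q X W \<and>
        (\<forall>q\<in>verts Q. U q \<inter> W q = {0} \<and> {u + w | u w. u \<in> U q \<and> w \<in> W q} = spc X q)
      \<longrightarrow> (\<forall>q\<in>verts Q. U q = {0}) \<or> (\<forall>q\<in>verts Q. W q = {0}))"

subsection \<open>Hom and Ext\<close>

text \<open>
  \<open>vert_maps\<close> and \<open>arc_maps\<close> are the source and the target of d_{X,Y}; families are 0
  outside the vertices, respectively arrows.  They are direct sums for a finite quiver.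
\<close>

definition vert_maps ::
  "('q, 'a) pre_digraph \<Rightarrow> ('q, 'a, 'k::field, 'v::ab_group_add) quiver_rep
     \<Rightarrow> ('q, 'a, 'k, 'w::ab_group_add) quiver_rep \<Rightarrow> ('q \<Rightarrow> 'v \<Rightarrow> 'w) set" where
  "vert_maps Q X Y = {f. (\<forall>q\<in>verts Q. f q \<in> hom_space (scl X) (scl Y) (spc X q) (spc Y q)) \<and>
     (\<forall>q. q \<notin> verts Q \<longrightarrow> f q = 0)}"

definition arc_maps ::
  "('q, 'a) pre_digraph \<Rightarrow> ('q, 'a, 'k::field, 'v::ab_group_add) quiver_rep
     \<Rightarrow> ('q, 'a, 'k, 'w::ab_group_add) quiver_rep \<Rightarrow> ('a \<Rightarrow> 'v \<Rightarrow> 'w) set" where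
  "arc_maps Q X Y = {\<phi>.
     (\<forall>\<rho>\<in>arcs Q. \<phi> \<rho> \<in> hom_space (scl X) (scl Y) (spc X (tail Q \<rho>)) (spc Y (head Q \<rho>))) \<and>
     (\<forall>\<rho>. \<rho> \<notin> arcs Q \<longrightarrow> \<phi> \<rho> = 0)}"

definition rep_diff ::
  "('q, 'a) pre_digraph \<Rightarrow> ('q, 'a, 'k::field, 'v::ab_group_add) quiver_rep
     \<Rightarrow> ('q, 'a, 'k, 'w::ab_group_add) quiver_rep \<Rightarrow> ('q \<Rightarrow> 'v \<Rightarrow> 'w) \<Rightarrow> ('a \<Rightarrow> 'v \<Rightarrow> 'w)" where
  "rep_diff Q X Y f = (\<lambda>\<rho>. if \<rho> \<in> arcs Q
     then (\<lambda>v. rmap Y \<rho> (f (tail Q \<rho>) v) - f (head Q \<rho>) (rmap X \<rho> v)) else 0)"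

definition Hom_Q ::
  "('q, 'a) pre_digraph \<Rightarrow> ('q, 'a, 'k::field, 'v::ab_group_add) quiver_rep
     \<Rightarrow> ('q, 'a, 'k, 'w::ab_group_add) quiver_rep \<Rightarrow> ('q \<Rightarrow> 'v \<Rightarrow> 'w) set" where
  "Hom_Q Q X Y = {f \<in> vert_maps Q X Y. rep_diff Q X Y f = 0}"

definition scalar_endo ::
  "('q, 'a) pre_digraph \<Rightarrow> ('q, 'a, 'k::field, 'v::ab_group_add) quiver_rep \<Rightarrow> 'k \<Rightarrow> ('q \<Rightarrow> 'v \<Rightarrow> 'v)" where
  "scalar_endo Q X c = (\<lambda>q v. if q \<in> verts Q \<and> v \<in> spc X q then scl X c v else 0)"

text \<open>Ext is the set of cosets of the image of d_{X,Y}, with its quotient vector space operations.\<close>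

definition ext_class ::
  "('q, 'a) pre_digraph \<Rightarrow> ('q, 'a, 'k::field, 'v::ab_group_add) quiver_rep
     \<Rightarrow> ('q, 'a, 'k, 'w::ab_group_add) quiver_rep \<Rightarrow> ('a \<Rightarrow> 'v \<Rightarrow> 'w) \<Rightarrow> ('a \<Rightarrow> 'v \<Rightarrow> 'w) set" where
  "ext_class Q X Y \<phi> = {\<phi> + rep_diff Q X Y f | f. f \<in> vert_maps Q X Y}"

definition Ext_Q ::
  "('q, 'a) pre_digraph \<Rightarrow> ('q, 'a, 'k::field, 'v::ab_group_add) quiver_rep
     \<Rightarrow> ('q, 'a, 'k, 'w::ab_group_add) quiver_rep \<Rightarrow> ('a \<Rightarrow> 'v \<Rightarrow> 'w) set set" where
  "Ext_Q Q X Y = ext_class Q X Y ` arc_maps Q X Y"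

definition fam_scale ::
  "('q, 'a, 'k, 'w) quiver_rep \<Rightarrow> 'k \<Rightarrow> ('a \<Rightarrow> 'v \<Rightarrow> 'w) \<Rightarrow> ('a \<Rightarrow> 'v \<Rightarrow> 'w)" where
  "fam_scale Y c \<phi> = (\<lambda>\<rho> v. scl Y c (\<phi> \<rho> v))"

definition ext_add :: "('a \<Rightarrow> 'v \<Rightarrow> 'w::ab_group_add) set \<Rightarrow> ('a \<Rightarrow> 'v \<Rightarrow> 'w) set \<Rightarrow> ('a \<Rightarrow> 'v \<Rightarrow> 'w) set" where
  "ext_add A B = {\<phi> + \<psi> | \<phi> \<psi>. \<phi> \<in> A \<and> \<psi> \<in> B}"

definition ext_scale ::
  "('q, 'a) pre_digraph \<Rightarrow> ('q, 'a, 'k::field, 'v::ab_group_add) quiver_rep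
     \<Rightarrow> ('q, 'a, 'k, 'w::ab_group_add) quiver_rep \<Rightarrow> 'k \<Rightarrow> ('a \<Rightarrow> 'v \<Rightarrow> 'w) set \<Rightarrow> ('a \<Rightarrow> 'v \<Rightarrow> 'w) set" where
  "ext_scale Q X Y c A = (\<Union>\<phi>\<in>A. ext_class Q X Y (fam_scale Y c \<phi>))"

text \<open>The residue classes of \<open>\<chi> 1, \<dots>, \<chi> n\<close> form a basis of Ext.\<close>

definition ext_basis ::
  "('q, 'a) pre_digraph \<Rightarrow> ('q, 'a, 'k::field, 'v::ab_group_add) quiver_rep
     \<Rightarrow> ('q, 'a, 'k, 'w::ab_group_add) quiver_rep \<Rightarrow> nat \<Rightarrow> (nat \<Rightarrow> 'a \<Rightarrow> 'v \<Rightarrow> 'w) \<Rightarrow> bool" where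
  "ext_basis Q X Y n \<chi> \<longleftrightarrow> (\<forall>l\<in>{1..n}. \<chi> l \<in> arc_maps Q X Y) \<and>
     (\<forall>e\<in>Ext_Q Q X Y. \<exists>!c. c \<in> {1..n} \<rightarrow>\<^sub>E UNIV \<and>
        e = ext_class Q X Y (\<Sum>l=1..n. fam_scale Y (c l) (\<chi> l)))"

definition ext_dim ::
  "('q, 'a) pre_digraph \<Rightarrow> ('q, 'a, 'k::field, 'v::ab_group_add) quiver_rep
     \<Rightarrow> ('q, 'a, 'k, 'w::ab_group_add) quiver_rep \<Rightarrow> nat" where
  "ext_dim Q X Y = (THE n. \<exists>\<chi>. ext_basis Q X Y n \<chi>)"

section \<open>The quiver Q(M) and the functor F_M\<close>

text \<open>The vertex m_i is the number i, and \<open>(i, j, l)\<close> is the arrow \<open>\<chi>\<close>^{ij}_l from m_i to m_j.\<close>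

definition QM ::
  "('q, 'a) pre_digraph \<Rightarrow> nat \<Rightarrow> (nat \<Rightarrow> ('q, 'a, 'k::field, 'v::ab_group_add) quiver_rep)
     \<Rightarrow> (nat, nat \<times> nat \<times> nat) pre_digraph" where
  "QM Q r M = \<lparr> verts = {1..r},
     arcs = {(i, j, l). i \<in> {1..r} \<and> j \<in> {1..r} \<and> i \<noteq> j \<and> l \<in> {1..ext_dim Q (M i) (M j)}},
     tail = (\<lambda>(i, j, l). i), head = (\<lambda>(i, j, l). j) \<rparr>"

text \<open>
  The representation with spaces \<open>M_q \<otimes> X_{m_i}\<close> and maps \<open>M_\<rho> \<otimes> id\<close>.  For \<open>M = M_i\<close> this is
  the representation \<open>M_i^{dim X_{m_i}}\<close>.
\<close>

definition tensor_rep ::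
  "('q, 'a) pre_digraph \<Rightarrow> ('q, 'a, 'k::field, 'v::ab_group_add) quiver_rep
     \<Rightarrow> (nat, 'b, 'k, 'w::ab_group_add) quiver_rep \<Rightarrow> nat \<Rightarrow> ('q, 'a, 'k, ('k, 'v, 'w) tensor) quiver_rep" where
  "tensor_rep Q N X i = \<lparr> scl = tensor_scale,
     spc = (\<lambda>q. tensor_space (scl N) (scl X) (spc N q) (spc X i)),
     rmap = (\<lambda>\<rho>. tensor_map (scl N) (scl X) (scl N) (scl X) (spc N (tail Q \<rho>)) (spc X i)
       (rmap N \<rho>) (\<lambda>x. x)) \<rparr>"

text \<open>
  \<open>chi_tensor Q M \<chi> X j i \<psi>\<close> is the family, indexed by the arrows \<open>\<rho>\<close>, of the maps
  \<open>\<Sum>l. (\<chi>^{ji}_l)_\<rho> \<otimes> \<psi> l\<close> from \<open>(M_j)_q \<otimes> X_{m_j}\<close> to \<open>(M_i)_q' \<otimes> X_{m_i}\<close>.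
\<close>

definition chi_tensor ::
  "('q, 'a) pre_digraph \<Rightarrow> (nat \<Rightarrow> ('q, 'a, 'k::field, 'v::ab_group_add) quiver_rep)
     \<Rightarrow> (nat \<Rightarrow> nat \<Rightarrow> nat \<Rightarrow> 'a \<Rightarrow> 'v \<Rightarrow> 'v) \<Rightarrow> (nat, 'b, 'k, 'w::ab_group_add) quiver_rep \<Rightarrow> nat \<Rightarrow> nat
     \<Rightarrow> (nat \<Rightarrow> 'w \<Rightarrow> 'w) \<Rightarrow> 'a \<Rightarrow> ('k, 'v, 'w) tensor \<Rightarrow> ('k, 'v, 'w) tensor" where
  "chi_tensor Q M \<chi> X j i \<psi> = (\<lambda>\<rho>. if \<rho> \<in> arcs Q
     then \<Sum>l=1..ext_dim Q (M j) (M i).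
       tensor_map (scl (M j)) (scl X) (scl (M i)) (scl X) (spc (M j) (tail Q \<rho>)) (spc X j)
         (\<chi> j i l \<rho>) (\<psi> l)
     else 0)"

text \<open>\<open>F_block \<dots> \<rho> i j\<close> is the block component \<open>((F_M X)_\<rho>)_{i,j}\<close>.\<close>

definition F_block ::
  "('q, 'a) pre_digraph \<Rightarrow> (nat \<Rightarrow> ('q, 'a, 'k::field, 'v::ab_group_add) quiver_rep)
     \<Rightarrow> (nat \<Rightarrow> nat \<Rightarrow> nat \<Rightarrow> 'a \<Rightarrow> 'v \<Rightarrow> 'v)
     \<Rightarrow> (nat, nat \<times> nat \<times> nat, 'k, 'w::ab_group_add) quiver_rep
     \<Rightarrow> 'a \<Rightarrow> nat \<Rightarrow> nat \<Rightarrow> ('k, 'v, 'w) tensor \<Rightarrow> ('k, 'v, 'w) tensor" where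
  "F_block Q M \<chi> X \<rho> i j =
     (if i = j then rmap (tensor_rep Q (M i) X i) \<rho>
      else chi_tensor Q M \<chi> X j i (\<lambda>l. rmap X (j, i, l)) \<rho>)"

definition F_space ::
  "nat \<Rightarrow> (nat \<Rightarrow> ('q, 'a, 'k::field, 'v::ab_group_add) quiver_rep)
     \<Rightarrow> (nat, 'b, 'k, 'w::ab_group_add) quiver_rep \<Rightarrow> 'q \<Rightarrow> (nat \<Rightarrow> ('k, 'v, 'w) tensor) set" where
  "F_space r M X q = {t.
     (\<forall>i\<in>{1..r}. t i \<in> tensor_space (scl (M i)) (scl X) (spc (M i) q) (spc X i)) \<and>
     (\<forall>i. i \<notin> {1..r} \<longrightarrow> t i = 0)}"

definition F_rep ::
  "('q, 'a) pre_digraph \<Rightarrow> nat \<Rightarrow> (nat \<Rightarrow> ('q, 'a, 'k::field, 'v::ab_group_add) quiver_rep)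
     \<Rightarrow> (nat \<Rightarrow> nat \<Rightarrow> nat \<Rightarrow> 'a \<Rightarrow> 'v \<Rightarrow> 'v)
     \<Rightarrow> (nat, nat \<times> nat \<times> nat, 'k, 'w::ab_group_add) quiver_rep
     \<Rightarrow> ('q, 'a, 'k, nat \<Rightarrow> ('k, 'v, 'w) tensor) quiver_rep" where
  "F_rep Q r M \<chi> X = \<lparr> scl = (\<lambda>c t i. tensor_scale c (t i)),
     spc = F_space r M X,
     rmap = (\<lambda>\<rho> t. if t \<in> F_space r M X (tail Q \<rho>)
       then (\<lambda>i. if i \<in> {1..r} then \<Sum>j=1..r. F_block Q M \<chi> X \<rho> i j (t j) else 0)
       else 0) \<rparr>"

text \<open>\<open>X_2\<close>, regarded as a representation of Q(M) with zero space at \<open>m_1\<close>.\<close>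

definition drop_first ::
  "(nat, nat \<times> nat \<times> nat, 'k, 'w::ab_group_add) quiver_rep \<Rightarrow> (nat, nat \<times> nat \<times> nat, 'k, 'w) quiver_rep" where
  "drop_first X = \<lparr> scl = scl X,
     spc = (\<lambda>i. if i = 1 then {0} else spc X i),
     rmap = (\<lambda>(i, j, l). if i = 1 \<or> j = 1 then 0 else rmap X (i, j, l)) \<rparr>"

section \<open>The isomorphism Theta and the induced map\<close>

definition Theta_dom ::
  "('q, 'a) pre_digraph \<Rightarrow> nat \<Rightarrow> (nat \<Rightarrow> ('q, 'a, 'k::field, 'v::ab_group_add) quiver_rep)
     \<Rightarrow> (nat, nat \<times> nat \<times> nat, 'k, 'w::ab_group_add) quiver_rep \<Rightarrow> (nat \<Rightarrow> nat \<Rightarrow> 'w \<Rightarrow> 'w) set" where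
  "Theta_dom Q r M X = {\<phi>. \<forall>i l.
     if i \<in> {2..r} \<and> l \<in> {1..ext_dim Q (M i) (M 1)}
     then \<phi> i l \<in> hom_space (scl X) (scl X) (spc X i) (spc X 1)
     else \<phi> i l = 0}"

definition Theta_cod ::
  "('q, 'a) pre_digraph \<Rightarrow> nat \<Rightarrow> (nat \<Rightarrow> ('q, 'a, 'k::field, 'v::ab_group_add) quiver_rep)
     \<Rightarrow> (nat, nat \<times> nat \<times> nat, 'k, 'w::ab_group_add) quiver_rep
     \<Rightarrow> (nat \<Rightarrow> ('a \<Rightarrow> ('k, 'v, 'w) tensor \<Rightarrow> ('k, 'v, 'w) tensor) set) set" where
  "Theta_cod Q r M X =
     (\<Pi>\<^sub>E i\<in>{2..r}. Ext_Q Q (tensor_rep Q (M i) X i) (tensor_rep Q (M 1) X 1))"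

definition Theta ::
  "('q, 'a) pre_digraph \<Rightarrow> nat \<Rightarrow> (nat \<Rightarrow> ('q, 'a, 'k::field, 'v::ab_group_add) quiver_rep)
     \<Rightarrow> (nat \<Rightarrow> nat \<Rightarrow> nat \<Rightarrow> 'a \<Rightarrow> 'v \<Rightarrow> 'v)
     \<Rightarrow> (nat, nat \<times> nat \<times> nat, 'k, 'w::ab_group_add) quiver_rep \<Rightarrow> (nat \<Rightarrow> nat \<Rightarrow> 'w \<Rightarrow> 'w)
     \<Rightarrow> nat \<Rightarrow> ('a \<Rightarrow> ('k, 'v, 'w) tensor \<Rightarrow> ('k, 'v, 'w) tensor) set" where
  "Theta Q r M \<chi> X \<phi> = (\<lambda>i\<in>{2..r}.
     ext_class Q (tensor_rep Q (M i) X i) (tensor_rep Q (M 1) X 1) (chi_tensor Q M \<chi> X i 1 (\<phi> i)))"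

text \<open>
  The class in \<open>Ext_Q(F_M X_2, M_1)\<close> of the element with components
  \<open>\<Sum>l. (\<chi>^{i1}_l)_\<rho> \<otimes> \<phi> i l\<close> on the i-th summand.  The target of these components is
  \<open>M_1 \<otimes> X_{m_1}\<close>, which for \<open>dim X_{m_1} = 1\<close> is the copy of \<open>M_1\<close> occurring in the statement.
\<close>

definition glued_class ::
  "('q, 'a) pre_digraph \<Rightarrow> nat \<Rightarrow> (nat \<Rightarrow> ('q, 'a, 'k::field, 'v::ab_group_add) quiver_rep)
     \<Rightarrow> (nat \<Rightarrow> nat \<Rightarrow> nat \<Rightarrow> 'a \<Rightarrow> 'v \<Rightarrow> 'v)
     \<Rightarrow> (nat, nat \<times> nat \<times> nat, 'k, 'w::ab_group_add) quiver_rep \<Rightarrow> (nat \<Rightarrow> nat \<Rightarrow> 'w \<Rightarrow> 'w)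
     \<Rightarrow> ('a \<Rightarrow> (nat \<Rightarrow> ('k, 'v, 'w) tensor) \<Rightarrow> ('k, 'v, 'w) tensor) set" where
  "glued_class Q r M \<chi> X \<phi> =
     ext_class Q (F_rep Q r M \<chi> (drop_first X)) (tensor_rep Q (M 1) X 1)
       (\<lambda>\<rho> t. if t \<in> F_space r M (drop_first X) (tail Q \<rho>)
          then \<Sum>i=2..r. chi_tensor Q M \<chi> X i 1 (\<phi> i) \<rho> (t i) else 0)"

definition Theta_induces_iso ::
  "('q, 'a) pre_digraph \<Rightarrow> nat \<Rightarrow> (nat \<Rightarrow> ('q, 'a, 'k::field, 'v::ab_group_add) quiver_rep)
     \<Rightarrow> (nat \<Rightarrow> nat \<Rightarrow> nat \<Rightarrow> 'a \<Rightarrow> 'v \<Rightarrow> 'v)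
     \<Rightarrow> (nat, nat \<times> nat \<times> nat, 'k, 'w::ab_group_add) quiver_rep \<Rightarrow> bool" where
  "Theta_induces_iso Q r M \<chi> X \<longleftrightarrow>
     (let N = (\<lambda>i. tensor_rep Q (M i) X i);
          FX2 = F_rep Q r M \<chi> (drop_first X);
          E = Theta_cod Q r M X
      in \<exists>h. bij_betw h E (Ext_Q Q FX2 (N 1)) \<and>
        (\<forall>e\<in>E. \<forall>e'\<in>E. h (\<lambda>i\<in>{2..r}. ext_add (e i) (e' i)) = ext_add (h e) (h e')) \<and>
        (\<forall>c. \<forall>e\<in>E. h (\<lambda>i\<in>{2..r}. ext_scale Q (N i) (N 1) c (e i)) = ext_scale Q FX2 (N 1) c (h e)) \<and>
        (\<forall>\<phi>\<in>Theta_dom Q r M X. h (Theta Q r M \<chi> X \<phi>) = glued_class Q r M \<chi> X \<phi>))"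

end

theory Submission
  imports Defs
begin

text \<open>
  Write N_i for M_i tensor X_{m_i}, and let e be an idempotent endomorphism of F_M X with blocks
  e_ij : N_j \<rightarrow> N_i.  Since Ext(M_j, M_i) = 0 for j < i, the structure maps of F_M X are upper
  triangular; together with Hom(M_j, M_i) = 0 for j < i this forces e_ij = 0 for j < i, by induction
  on the distance from the lower left corner.  Hence the diagonal blocks are idempotent endomorphisms
  of the N_i.  As dim X_{m_1} = 1, N_1 is a copy of the indecomposable M_1, so e_11 is 0 or 1, and
  replacing e by 1 - e we may assume e_11 = 0.  For i > 1, End(M_i) = k gives e_ii = id tensor g_i,
  and for 1 < i < k the linear independence of the classes of the chi and Hom(M_k, M_i) = 0 show,
  inductively in k - i, that the g_i commute with the maps of X and that e_ik = 0.

  The first row (e_1k) then bounds the glued cocycle with components chi tensor (X_chi g_k).  By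
  the injectivity of the map induced by Theta, X_chi g_k = 0 for all arrows into m_1, that is,
  (0, g_2, ..., g_r) is an idempotent endomorphism of X.  It is not the identity, so it vanishes as
  X is indecomposable.  Thus e vanishes outside the first row, and e = e e = 0.

  Spaces V tensor W are handled through the coordinates in V with respect to a basis B of W.
\<close>

section \<open>Coordinates on tensor products\<close>

text \<open>The obstacle is the first row. For 1 < i < k a block e_ik is a morphism once its defect
  vanishes, and Hom(M_k, M_i) = 0 disposes of it. Into M_1 there may be nonzero morphisms from M_k,
  so the blocks e_1k cannot be removed one at a time, and the relation for e_1k involves further
  e_1j through the structure maps of F_M X_2. Taken together, however, the e_1k form a single family
  of maps from F_M X_2 to N_1, and their relations say that its image under d is, up to sign, the
  glued cocycle; this is the situation that the condition on Theta governs. A term with e_11 would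
  disturb these relations, which is why e_11 = 0 is arranged beforehand. M_1 is only indecomposable,
  so End(M_1) may contain nilpotent maps; with dim X_{m_1} = 1 an idempotent e_11 is nevertheless
  trivial. This is the reason for arguing with idempotents, which also turn decompositions of X and
  of F_M X into equations between blocks.\<close>

definition lin_on ::
  "('k \<Rightarrow> 'v \<Rightarrow> 'v) \<Rightarrow> ('k \<Rightarrow> 'w \<Rightarrow> 'w) \<Rightarrow> 'v::ab_group_add set \<Rightarrow> ('v \<Rightarrow> 'w::ab_group_add) \<Rightarrow> bool" where
  "lin_on s t V f \<longleftrightarrow> (\<forall>x\<in>V. \<forall>y\<in>V. f (x + y) = f x + f y) \<and> (\<forall>c. \<forall>x\<in>V. f (s c x) = t c (f x))"

text \<open>Coordinates and the maps sending v to v tensor w do not vanish outside V, so linearity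
  on V is kept apart from the extension by 0 that \<open>hom_space\<close> demands.\<close>

lemma hom_space_iff:
  "f \<in> hom_space s t V W \<longleftrightarrow> lin_on s t V f \<and> f ` V \<subseteq> W \<and> (\<forall>x. x \<notin> V \<longrightarrow> f x = 0)"
  unfolding hom_space_def lin_on_def by auto

lemma lin_on_id: "lin_on s s V (\<lambda>x. x)"
  by (simp add: lin_on_def)

lemma lin_on_zero:
  assumes "vector_space t"
  shows "lin_on s t V (\<lambda>x. 0)" "lin_on s t V 0"
proof -
  interpret vector_space t by fact
  show "lin_on s t V (\<lambda>x. 0)" "lin_on s t V 0" by (simp_all add: lin_on_def)
qed

lemma lin_on_comp:
  "lin_on s t V f \<Longrightarrow> lin_on t u W g \<Longrightarrow> f ` V \<subseteq> W \<Longrightarrow> lin_on s u V (\<lambda>x. g (f x))"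
  unfolding lin_on_def by (auto simp: image_subset_iff)

lemma lin_on_add:
  assumes "vector_space t" "lin_on s t V f" "lin_on s t V g"
  shows "lin_on s t V (\<lambda>x. f x + g x)"
proof -
  interpret vector_space t by fact
  show ?thesis using assms(2,3) by (simp add: lin_on_def algebra_simps scale_right_distrib)
qed

lemma lin_on_diff:
  assumes "vector_space t" "lin_on s t V f" "lin_on s t V g"
  shows "lin_on s t V (\<lambda>x. f x - g x)"
proof -
  interpret vector_space t by fact
  show ?thesis using assms(2,3) by (simp add: lin_on_def algebra_simps scale_right_diff_distrib)
qed

lemma lin_on_sum:
  assumes "vector_space t" "\<And>i. i \<in> I \<Longrightarrow> lin_on s t V (f i)"
  shows "lin_on s t V (\<lambda>x. \<Sum>i\<in>I. f i x)"
  using assms(2)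
proof (induction I rule: infinite_finite_induct)
  case (insert i I)
  then show ?case using lin_on_add[OF assms(1), of s V "f i" "\<lambda>x. \<Sum>i\<in>I. f i x"] by simp
qed (simp_all add: lin_on_zero[OF assms(1)])

lemma lin_on_0:
  assumes "module.subspace s V" "vector_space s" "lin_on s t V f"
  shows "f 0 = 0"
proof -
  interpret vector_space s by fact
  have "f (0 + 0) = f 0 + f 0"
    using assms(1,3) unfolding lin_on_def by (metis subspace_0)
  then show ?thesis by simp
qed

lemma lin_on_sum_arg:
  assumes "module.subspace s V" "vector_space s" "lin_on s t V f" "\<And>i. i \<in> I \<Longrightarrow> a i \<in> V"
  shows "f (\<Sum>i\<in>I. a i) = (\<Sum>i\<in>I. f (a i))"
proof -
  interpret vector_space s by fact
  show ?thesis using assms(4)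
  proof (induction I rule: infinite_finite_induct)
    case (insert i I)
    then have "f (a i + (\<Sum>i\<in>I. a i)) = f (a i) + f (\<Sum>i\<in>I. a i)"
      using assms(1,3) by (simp add: lin_on_def subspace_sum)
    then show ?case using insert by simp
  qed (use lin_on_0[OF assms(1-3)] in auto)
qed

lemma lin_on_diff_arg:
  assumes "module.subspace s V" "vector_space s" "lin_on s t V f" "x \<in> V" "y \<in> V"
  shows "f (x - y) = f x - f y"
proof -
  interpret vector_space s by fact
  have "f (x - y + y) = f (x - y) + f y"
    using assms by (metis lin_on_def subspace_diff)
  then show ?thesis by simp
qed

lemma hom_space_restrictI:
  assumes "module.subspace s V" "vector_space s" "lin_on s t V f" "\<And>x. x \<in> V \<Longrightarrow> f x \<in> W"
  shows "(\<lambda>x. if x \<in> V then f x else 0) \<in> hom_space s t V W"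
proof -
  interpret vector_space s by fact
  show ?thesis
    using assms(3,4) subspace_add[OF assms(1)] subspace_scale[OF assms(1)]
    unfolding hom_space_iff lin_on_def by auto
qed

section \<open>Tensors as families of coordinates with respect to a basis of the right
  factor\<close>

lemma vector_space_tensor_scale: "vector_space tensor_scale"
  by unfold_locales (auto simp: tensor_scale_def fun_eq_iff algebra_simps)

interpretation tensor: vector_space tensor_scale
  by (rule vector_space_tensor_scale)

lemma vector_space_mult: "vector_space ((*) :: 'k::field \<Rightarrow> 'k \<Rightarrow> 'k)"
  by unfold_locales (auto simp: algebra_simps)

text \<open>With W the span of an independent set B, the space V tensor W becomes a direct sum of
  copies of V, one for each element of B. The left factor stays free of bases, because the
  conditions on Hom and Ext concern the maps on that side as they are.\<close>

locale tensor_coords = vector_space_pair s t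
  for s :: "'k::field \<Rightarrow> 'v::ab_group_add \<Rightarrow> 'v" and t :: "'k \<Rightarrow> 'w::ab_group_add \<Rightarrow> 'w" +
  fixes V :: "'v set" and B :: "'w set"
  assumes subspace_V: "vs1.subspace V"
    and finite_B: "finite B"
    and independent_B: "vs2.independent B"
begin

abbreviation W where "W \<equiv> vs2.span B"
abbreviation pt where "pt \<equiv> pure_tensor s t"
abbreviation TS where "TS \<equiv> tensor_space s t V W"

lemma bilinear_formD:
  assumes "bilinear_form s t \<beta>"
  shows "\<beta> (v + v') w = \<beta> v w + \<beta> v' w" "\<beta> v (w + w') = \<beta> v w + \<beta> v w'"
    "\<beta> (s c v) w = c * \<beta> v w" "\<beta> v (t c w) = c * \<beta> v w"
  using assms unfolding bilinear_form_def
  by (auto simp: linear_iff linear_add linear_scale Vector_Spaces.linear_iff)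

lemma pt_add_left: "pt (v + v') w = pt v w + pt v' w"
  by (auto simp: pure_tensor_def fun_eq_iff bilinear_formD)

lemma pt_add_right: "pt v (w + w') = pt v w + pt v w'"
  by (auto simp: pure_tensor_def fun_eq_iff bilinear_formD)

lemma pt_scale_left: "pt (s c v) w = tensor_scale c (pt v w)"
  by (auto simp: pure_tensor_def tensor_scale_def fun_eq_iff bilinear_formD)

lemma pt_scale_right: "pt v (t c w) = tensor_scale c (pt v w)"
  by (auto simp: pure_tensor_def tensor_scale_def fun_eq_iff bilinear_formD)

lemma pt_0_left [simp]: "pt 0 w = 0"
  using pt_add_left[of 0 0 w] by simp

lemma pt_0_right [simp]: "pt v 0 = 0"
  using pt_add_right[of v 0 0] by simp

lemma pt_sum_right: "pt v (\<Sum>i\<in>I. f i) = (\<Sum>i\<in>I. pt v (f i))"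
  by (induction I rule: infinite_finite_induct) (auto simp: pt_add_right)

lemma pt_diff_left: "pt (v - v') w = pt v w - pt v' w"
  using pt_add_left[of "v - v'" v' w] by simp

text \<open>Bilinear forms that are products of two linear functionals separate the coordinates.\<close>

lemma pt_sum_eq_0:
  assumes "(\<Sum>b\<in>B. pt (c b) b) = 0" "b \<in> B"
  shows "c b = 0"
proof (rule ccontr)
  assume nz: "c b \<noteq> 0"
  interpret p1: vector_space_pair s "(*)"
    by (intro vector_space_pair.intro vector_space_mult vs1.vector_space_axioms)
  interpret p2: vector_space_pair t "(*)"
    by (intro vector_space_pair.intro vector_space_mult vs2.vector_space_axioms)
  have "vs1.independent {c b}" using nz by simp
  from p1.linear_independent_extend[OF this, of "\<lambda>_. 1"] obtain \<mu>
    where \<mu>: "Vector_Spaces.linear s (*) \<mu>" "\<mu> (c b) = 1" by blast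
  from p2.linear_independent_extend[OF independent_B, of "\<lambda>x. if x = b then 1 else 0"] obtain \<nu>
    where \<nu>: "Vector_Spaces.linear t (*) \<nu>" "\<forall>x\<in>B. \<nu> x = (if x = b then 1 else 0)" by blast
  let ?\<beta> = "\<lambda>v w. \<mu> v * \<nu> w"
  have lin: "\<mu> (x + y) = \<mu> x + \<mu> y" "\<mu> (s a x) = a * \<mu> x"
    "\<nu> (u + w) = \<nu> u + \<nu> w" "\<nu> (t a u) = a * \<nu> u" for x y a u w
    using \<mu>(1) \<nu>(1) by (simp_all add: Vector_Spaces.linear_iff)
  have bil: "bilinear_form s t ?\<beta>"
    unfolding bilinear_form_def Vector_Spaces.linear_iff
  proof (intro conjI allI)
    show "vector_space s" "vector_space t" by unfold_locales
    show "vector_space ((*) :: 'k \<Rightarrow> 'k \<Rightarrow> 'k)" by (rule vector_space_mult)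
    then show "vector_space ((*) :: 'k \<Rightarrow> 'k \<Rightarrow> 'k)" .
  qed (simp_all only: lin distrib_left distrib_right mult.assoc mult.left_commute)
  have "0 = (\<Sum>b\<in>B. pt (c b) b) ?\<beta>" using assms(1) by simp
  also have "\<dots> = (\<Sum>b\<in>B. pt (c b) b ?\<beta>)"
    by (induction B rule: infinite_finite_induct) auto
  also have "\<dots> = (\<Sum>x\<in>B. if x = b then \<mu> (c x) else 0)"
    using bil \<nu>(2) by (intro sum.cong) (auto simp: pure_tensor_def)
  also have "\<dots> = 1" using assms(2) finite_B \<mu>(2) by simp
  finally show False by simp
qed

text \<open>The coefficients range over the whole ambient space and not over V. So
  \<open>coord\<close> depends on B alone, and one function serves all vertices of the quiver. Its
  values are determined only on B, and only for T of this form.\<close>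

definition coord :: "('k, 'v, 'w) tensor \<Rightarrow> 'w \<Rightarrow> 'v" where
  "coord T = (SOME c. T = (\<Sum>b\<in>B. pt (c b) b))"

lemma coord_eq:
  assumes "T = (\<Sum>b\<in>B. pt (c b) b)" "b \<in> B"
  shows "coord T b = c b"
proof -
  have "T = (\<Sum>b\<in>B. pt (coord T b) b)"
    unfolding coord_def by (rule someI[of _ c]) (rule assms)
  then have "(\<Sum>b\<in>B. pt (coord T b - c b) b) = 0"
    using assms(1) by (simp add: pt_diff_left sum_subtractf)
  from pt_sum_eq_0[OF this assms(2)] show ?thesis by simp
qed

lemma pt_expand:
  assumes "w \<in> W"
  shows "pt v w = (\<Sum>b\<in>B. pt (s (vs2.representation B w b) v) b)"
proof -
  have "pt v w = pt v (\<Sum>b\<in>B. t (vs2.representation B w b) b)"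
    using assms independent_B finite_B by (simp add: vs2.sum_representation_eq)
  then show ?thesis by (simp add: pt_sum_right pt_scale_left pt_scale_right)
qed

lemma coord_pt: "w \<in> W \<Longrightarrow> b \<in> B \<Longrightarrow> coord (pt v w) b = s (vs2.representation B w b) v"
  using coord_eq[OF pt_expand] by simp

lemma pt_in_TS: "v \<in> V \<Longrightarrow> w \<in> W \<Longrightarrow> pt v w \<in> TS"
  unfolding tensor_space_def by (rule tensor.span_base) auto

lemma pt_B_in_TS: "v \<in> V \<Longrightarrow> b \<in> B \<Longrightarrow> pt v b \<in> TS"
  by (simp add: pt_in_TS vs2.span_base)

lemma subspace_TS: "tensor.subspace TS"
  unfolding tensor_space_def by simp

text \<open>The span consists of sums with coefficients in V, and by \<open>coord_eq\<close> any
  such coefficients are the coordinates. Hence coordinates of elements of \<open>TS\<close> lie in V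
  although \<open>coord\<close> is chosen without regard to V.\<close>

lemma tensor_expand:
  assumes "T \<in> TS"
  shows "(\<Sum>b\<in>B. pt (coord T b) b) = T" "b \<in> B \<Longrightarrow> coord T b \<in> V"
proof -
  have "\<exists>c. (\<forall>b\<in>B. c b \<in> V) \<and> T = (\<Sum>b\<in>B. pt (c b) b)"
    using assms unfolding tensor_space_def
  proof (induction rule: tensor.span_induct_alt)
    case base
    show ?case using subspace_V by (intro exI[of _ "\<lambda>_. 0"]) (auto simp: vs1.subspace_0)
  next
    case (step a x y)
    then obtain v w c where "v \<in> V" "w \<in> W" "x = pt v w"
      "\<forall>b\<in>B. c b \<in> V" "y = (\<Sum>b\<in>B. pt (c b) b)" by blast
    note vw = this
    let ?d = "\<lambda>b. s a (s (vs2.representation B w b) v) + c b"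
    have "\<forall>b\<in>B. ?d b \<in> V"
      using vw(1,4) subspace_V by (blast intro: vs1.subspace_add vs1.subspace_scale)
    moreover have "tensor_scale a x + y = (\<Sum>b\<in>B. pt (?d b) b)"
      unfolding pt_add_left sum.distrib pt_scale_left[of a] vw(3,5) pt_expand[OF vw(2), of v]
        tensor.scale_sum_right ..
    ultimately show ?case by (intro exI[of _ ?d] conjI)
  qed
  then obtain c where c: "\<forall>b\<in>B. c b \<in> V" "T = (\<Sum>b\<in>B. pt (c b) b)" by blast
  have eq: "\<And>b. b \<in> B \<Longrightarrow> coord T b = c b" by (rule coord_eq[OF c(2)])
  then show "(\<Sum>b\<in>B. pt (coord T b) b) = T" using c(2) by simp
  show "b \<in> B \<Longrightarrow> coord T b \<in> V" using eq c(1) by simp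
qed

lemma lin_on_coord:
  assumes "b \<in> B"
  shows "lin_on tensor_scale s TS (\<lambda>T. coord T b)"
  unfolding lin_on_def
proof (intro conjI ballI allI)
  fix x y c assume x: "x \<in> TS"
  show "coord (tensor_scale c x) b = s c (coord x b)"
    by (rule coord_eq[OF _ assms])
      (simp add: pt_scale_left tensor_expand(1)[OF x] flip: tensor.scale_sum_right)
  assume y: "y \<in> TS"
  have "x + y = (\<Sum>b\<in>B. pt (coord x b + coord y b) b)"
    unfolding pt_add_left sum.distrib tensor_expand(1)[OF x] tensor_expand(1)[OF y] ..
  from coord_eq[OF this assms] show "coord (x + y) b = coord x b + coord y b" .
qed

lemma lin_on_pt: "lin_on s tensor_scale U (\<lambda>v. pt v w)"
  by (simp add: lin_on_def pt_add_left pt_scale_left)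

text \<open>Values on v tensor b with b in the basis suffice, because a tensor is the sum of its
  terms \<open>pt (coord T b) b\<close>. Most identities between maps on tensor products below come
  down to this.\<close>

lemma tensor_ext:
  assumes "lin_on tensor_scale u TS h" "lin_on tensor_scale u TS h'"
    and eq: "\<And>v b. v \<in> V \<Longrightarrow> b \<in> B \<Longrightarrow> h (pt v b) = h' (pt v b)" and T: "T \<in> TS"
  shows "h T = h' T"
proof -
  have in_TS: "\<And>b. b \<in> B \<Longrightarrow> pt (coord T b) b \<in> TS"
    using tensor_expand(2)[OF T] by (rule pt_B_in_TS)
  have "h (\<Sum>b\<in>B. pt (coord T b) b) = (\<Sum>b\<in>B. h (pt (coord T b) b))"
    by (rule lin_on_sum_arg[OF subspace_TS vector_space_tensor_scale assms(1) in_TS])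
  also have "\<dots> = (\<Sum>b\<in>B. h' (pt (coord T b) b))"
    using tensor_expand(2)[OF T] by (intro sum.cong) (auto simp: eq)
  also have "\<dots> = h' (\<Sum>b\<in>B. pt (coord T b) b)"
    by (rule lin_on_sum_arg[OF subspace_TS vector_space_tensor_scale assms(2) in_TS, symmetric])
  finally show ?thesis by (simp add: tensor_expand(1)[OF T])
qed

lemma TS_fin_dim:
  assumes "fin_dim_subspace s V"
  shows "fin_dim_subspace tensor_scale TS"
proof -
  obtain A where A: "finite A" "vs1.span A = V" using assms unfolding fin_dim_subspace_def by blast
  let ?P = "(\<lambda>(a, b). pt a b) ` (A \<times> B)"
  have "TS = tensor.span ?P"
  proof
    show "tensor.span ?P \<subseteq> TS"
      using A(2) by (intro tensor.span_minimal subspace_TS)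
        (use vs1.span_base[of _ A] pt_B_in_TS in auto)
    have pt_span: "pt v b \<in> tensor.span ?P" if "v \<in> V" "b \<in> B" for v b
      using that(1) unfolding A(2)[symmetric]
    proof (induction rule: vs1.span_induct_alt)
      case (step c x y)
      moreover have "pt x b \<in> tensor.span ?P" using step(1) that(2) by (intro tensor.span_base) auto
      ultimately show ?case
        unfolding pt_add_left pt_scale_left by (intro tensor.span_add tensor.span_scale)
    qed (simp add: tensor.span_zero[unfolded zero_fun_def])
    show "TS \<subseteq> tensor.span ?P"
    proof
      fix T assume T: "T \<in> TS"
      have "(\<Sum>b\<in>B. pt (coord T b) b) \<in> tensor.span ?P"
      proof (rule tensor.span_sum[of B "\<lambda>b. pt (coord T b) b"])
        fix b assume b: "b \<in> B"
        have "coord T b \<in> V" using T b by (rule tensor_expand(2))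
        then show "pt (coord T b) b \<in> tensor.span ?P" using b by (rule pt_span)
      qed
      then show "T \<in> tensor.span ?P" unfolding tensor_expand(1)[OF T] .
    qed
  qed
  moreover have "finite ?P" using A(1) finite_B by simp
  ultimately show ?thesis unfolding fin_dim_subspace_def by metis
qed

lemma TS_nonzero:
  assumes "V \<noteq> {0}" "B \<noteq> {}"
  shows "TS \<noteq> {0}"
proof
  assume "TS = {0}"
  obtain v b where vb: "v \<in> V" "v \<noteq> 0" "b \<in> B"
    using assms subspace_V vs1.subspace_0 by blast
  then have "coord (pt v b) b = v"
    by (simp add: coord_pt vs2.span_base vs2.representation_basis[OF independent_B])
  moreover have "pt v b = 0" using pt_B_in_TS[OF vb(1,3)] \<open>TS = {0}\<close> by simp
  moreover have "coord 0 b = 0" by (rule coord_eq[where c = "\<lambda>_. 0"]) (auto simp: vb)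
  ultimately show False using vb by simp
qed

text \<open>This justifies the definite description in \<open>tensor_map\<close>: \<open>?h\<close>,
  written in coordinates, has the required properties, and \<open>tensor_ext\<close> excludes any
  other map.\<close>

lemma tensor_map_char:
  fixes s' :: "'k \<Rightarrow> 'v'::ab_group_add \<Rightarrow> 'v'" and t' :: "'k \<Rightarrow> 'w'::ab_group_add \<Rightarrow> 'w'"
  assumes vs: "vector_space s'" "vector_space t'"
    and f: "lin_on s s' V f" and g: "lin_on t t' W g"
  defines "h \<equiv> tensor_map s t s' t' V W f g"
  shows "h \<in> hom_space tensor_scale tensor_scale TS UNIV"
    and "v \<in> V \<Longrightarrow> w \<in> W \<Longrightarrow> h (pt v w) = pure_tensor s' t' (f v) (g w)"
proof -
  interpret s': vector_space s' by fact
  interpret t': vector_space t' by fact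
  \<comment> \<open>Only the bilinearity of pure tensors in the target is wanted;
    \<open>UNIV\<close> and the empty basis are placeholders.\<close>
  interpret t': tensor_coords s' t' UNIV "{}"
    by unfold_locales (auto simp: t'.independent_empty)
  let ?P = "\<lambda>h. h \<in> hom_space tensor_scale tensor_scale TS UNIV \<and>
     (\<forall>v\<in>V. \<forall>w\<in>W. h (pt v w) = pure_tensor s' t' (f v) (g w))"
  let ?h = "\<lambda>T. if T \<in> TS then \<Sum>b\<in>B. t'.pt (f (coord T b)) (g b) else 0"
  have lin: "lin_on tensor_scale tensor_scale TS (\<lambda>T. \<Sum>b\<in>B. t'.pt (f (coord T b)) (g b))"
  proof (rule lin_on_sum[OF vector_space_tensor_scale])
    fix b assume b: "b \<in> B"
    have "lin_on tensor_scale s' TS (\<lambda>T. f (coord T b))"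
      by (rule lin_on_comp[OF lin_on_coord[OF b] f]) (use b tensor_expand(2) in auto)
    from lin_on_comp[OF this t'.lin_on_pt[of UNIV]]
    show "lin_on tensor_scale tensor_scale TS (\<lambda>T. t'.pt (f (coord T b)) (g b))" by simp
  qed
  have "?P ?h"
  proof (intro conjI ballI)
    show "?h \<in> hom_space tensor_scale tensor_scale TS UNIV"
      using lin unfolding hom_space_iff lin_on_def
      by (auto simp: tensor.subspace_add[OF subspace_TS] tensor.subspace_scale[OF subspace_TS])
    fix v w assume v: "v \<in> V" and w: "w \<in> W"
    \<comment> \<open>\<open>?h\<close> knows g only through its values on B, so g w is expanded in
      the basis before comparison.\<close>
    have "g w = g (\<Sum>b\<in>B. t (vs2.representation B w b) b)"
      using w independent_B finite_B by (simp add: vs2.sum_representation_eq)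
    also have "\<dots> = (\<Sum>b\<in>B. g (t (vs2.representation B w b) b))"
      by (rule lin_on_sum_arg[OF _ vs2.vector_space_axioms g])
        (auto intro: vs2.span_scale vs2.span_base)
    also have "\<dots> = (\<Sum>b\<in>B. t' (vs2.representation B w b) (g b))"
      using g by (intro sum.cong) (auto simp: lin_on_def vs2.span_base)
    finally have gw: "g w = (\<Sum>b\<in>B. t' (vs2.representation B w b) (g b))" .
    have "f (s c v) = s' c (f v)" for c using f v by (simp add: lin_on_def)
    then show "?h (pt v w) = pure_tensor s' t' (f v) (g w)"
      by (simp add: pt_in_TS v w coord_pt gw t'.pt_sum_right t'.pt_scale_left t'.pt_scale_right)
  qed
  moreover have "h' = ?h" if "?P h'" for h'
  proof
    fix T
    show "h' T = ?h T"
    proof (cases "T \<in> TS")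
      case True
      show ?thesis
        by (rule tensor_ext[OF _ _ _ True]) (use that \<open>?P ?h\<close> in \<open>auto simp: hom_space_iff vs2.span_base\<close>)
    qed (use that in \<open>auto simp: hom_space_iff\<close>)
  qed
  ultimately have "?P (THE h. ?P h)" by (rule theI[of ?P ?h])
  then have P: "?P h" unfolding h_def tensor_map_def .
  show "h \<in> hom_space tensor_scale tensor_scale TS UNIV" using P by blast
  show "v \<in> V \<Longrightarrow> w \<in> W \<Longrightarrow> h (pt v w) = pure_tensor s' t' (f v) (g w)" using P by blast
qed

end

section \<open>Tensor products of maps between two such spaces\<close>

locale tensor_coords_pair = src: tensor_coords s t V B + tgt: tensor_coords s' t' V' B'
  for s :: "'k::field \<Rightarrow> 'v::ab_group_add \<Rightarrow> 'v" and t :: "'k \<Rightarrow> 'w::ab_group_add \<Rightarrow> 'w" and V B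
    and s' :: "'k \<Rightarrow> 'v'::ab_group_add \<Rightarrow> 'v'" and t' :: "'k \<Rightarrow> 'w'::ab_group_add \<Rightarrow> 'w'" and V' B'
begin

abbreviation tmap where "tmap \<equiv> tensor_map s t s' t' V src.W"

context
  fixes f g
  assumes f: "lin_on s s' V f" "f ` V \<subseteq> V'" and g: "lin_on t t' src.W g" "g ` src.W \<subseteq> tgt.W"
begin

lemmas tmap_char = src.tensor_map_char[OF tgt.vs1.vector_space_axioms tgt.vs2.vector_space_axioms f(1) g(1)]

lemma tmap_pt: "v \<in> V \<Longrightarrow> w \<in> src.W \<Longrightarrow> tmap f g (src.pt v w) = tgt.pt (f v) (g w)"
  by (rule tmap_char(2))

lemma tmap_lin: "lin_on tensor_scale tensor_scale src.TS (tmap f g)"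
  using tmap_char(1) by (simp add: hom_space_iff)

lemma tmap_hom: "tmap f g \<in> hom_space tensor_scale tensor_scale src.TS tgt.TS"
proof -
  have "tmap f g T \<in> tgt.TS" if T: "T \<in> src.TS" for T
  proof -
    have "tmap f g (\<Sum>b\<in>B. src.pt (src.coord T b) b) = (\<Sum>b\<in>B. tmap f g (src.pt (src.coord T b) b))"
      by (rule lin_on_sum_arg[OF src.subspace_TS vector_space_tensor_scale tmap_lin])
        (use src.tensor_expand(2)[OF T] src.pt_B_in_TS in auto)
    also have "\<dots> \<in> tgt.TS"
      using f(2) g(2) src.tensor_expand(2)[OF T]
      by (intro tensor.subspace_sum tgt.subspace_TS)
        (auto simp: tmap_pt src.vs2.span_base image_subset_iff intro!: tgt.pt_in_TS)
    finally show ?thesis by (simp add: src.tensor_expand(1)[OF T])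
  qed
  then show ?thesis using tmap_char(1) by (auto simp: hom_space_iff)
qed

end

end

section \<open>Morphisms, Ext classes and indecomposability\<close>

lemma fin_dim_subspace_subspace:
  assumes "vector_space s" "fin_dim_subspace s V"
  shows "module.subspace s V"
proof -
  interpret vector_space s by fact
  show ?thesis using assms(2) unfolding fin_dim_subspace_def by auto
qed

lemma is_repD:
  assumes "is_rep Q X"
  shows "vector_space (scl X)" "q \<in> verts Q \<Longrightarrow> module.subspace (scl X) (spc X q)"
    "q \<in> verts Q \<Longrightarrow> fin_dim_subspace (scl X) (spc X q)"
    "\<rho> \<in> arcs Q \<Longrightarrow> rmap X \<rho> \<in> hom_space (scl X) (scl X) (spc X (tail Q \<rho>)) (spc X (head Q \<rho>))"
    "\<rho> \<in> arcs Q \<Longrightarrow> lin_on (scl X) (scl X) (spc X (tail Q \<rho>)) (rmap X \<rho>)"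
    "\<rho> \<in> arcs Q \<Longrightarrow> x \<in> spc X (tail Q \<rho>) \<Longrightarrow> rmap X \<rho> x \<in> spc X (head Q \<rho>)"
    "\<rho> \<in> arcs Q \<Longrightarrow> x \<notin> spc X (tail Q \<rho>) \<Longrightarrow> rmap X \<rho> x = 0"
    "q \<in> verts Q \<Longrightarrow> 0 \<in> spc X q"
proof -
  show vs: "vector_space (scl X)" using assms unfolding is_rep_def by blast
  interpret vector_space "scl X" by (rule vs)
  show sub: "q \<in> verts Q \<Longrightarrow> subspace (spc X q)"
    using assms fin_dim_subspace_subspace[OF vs] unfolding is_rep_def by blast
  then show "q \<in> verts Q \<Longrightarrow> 0 \<in> spc X q" by (simp add: subspace_0)
qed (use assms in \<open>auto simp: is_rep_def hom_space_iff\<close>)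

text \<open>Unlike \<open>vert_maps\<close>, this puts no condition on the values outside the spaces of X;
  \<open>restr\<close> extends by 0.\<close>

definition pre_hom ::
  "('q, 'a) pre_digraph \<Rightarrow> ('q, 'a, 'k::field, 'v::ab_group_add) quiver_rep
     \<Rightarrow> ('q, 'a, 'k, 'w::ab_group_add) quiver_rep \<Rightarrow> ('q \<Rightarrow> 'v \<Rightarrow> 'w) \<Rightarrow> bool" where
  "pre_hom Q X Y f \<longleftrightarrow>
     (\<forall>q\<in>verts Q. lin_on (scl X) (scl Y) (spc X q) (f q) \<and> f q ` spc X q \<subseteq> spc Y q)"

text \<open>This is d_{X,Y} f before the extension by 0, so only its values on
  \<open>spc X (tail Q \<rho>)\<close> carry meaning.\<close>

definition defect ::
  "('q, 'a) pre_digraph \<Rightarrow> ('q, 'a, 'k::field, 'v::ab_group_add) quiver_rep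
     \<Rightarrow> ('q, 'a, 'k, 'w::ab_group_add) quiver_rep \<Rightarrow> ('q \<Rightarrow> 'v \<Rightarrow> 'w) \<Rightarrow> ('a \<Rightarrow> 'v \<Rightarrow> 'w)" where
  "defect Q X Y f \<rho> v = rmap Y \<rho> (f (tail Q \<rho>) v) - f (head Q \<rho>) (rmap X \<rho> v)"

definition rep_hom ::
  "('q, 'a) pre_digraph \<Rightarrow> ('q, 'a, 'k::field, 'v::ab_group_add) quiver_rep
     \<Rightarrow> ('q, 'a, 'k, 'w::ab_group_add) quiver_rep \<Rightarrow> ('q \<Rightarrow> 'v \<Rightarrow> 'w) \<Rightarrow> bool" where
  "rep_hom Q X Y f \<longleftrightarrow> pre_hom Q X Y f \<and>
     (\<forall>\<rho>\<in>arcs Q. \<forall>v\<in>spc X (tail Q \<rho>). defect Q X Y f \<rho> v = 0)"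

definition restr ::
  "('q, 'a) pre_digraph \<Rightarrow> ('q, 'a, 'k::field, 'v::ab_group_add) quiver_rep
     \<Rightarrow> ('q \<Rightarrow> 'v \<Rightarrow> 'w::ab_group_add) \<Rightarrow> ('q \<Rightarrow> 'v \<Rightarrow> 'w)" where
  "restr Q X f = (\<lambda>q v. if q \<in> verts Q \<and> v \<in> spc X q then f q v else 0)"

lemma pre_homD:
  assumes "pre_hom Q X Y f" "q \<in> verts Q"
  shows "lin_on (scl X) (scl Y) (spc X q) (f q)" "x \<in> spc X q \<Longrightarrow> f q x \<in> spc Y q"
  using assms unfolding pre_hom_def by auto

lemma rep_homD:
  assumes "rep_hom Q X Y f"
  shows "pre_hom Q X Y f"
    "\<rho> \<in> arcs Q \<Longrightarrow> v \<in> spc X (tail Q \<rho>) \<Longrightarrow> rmap Y \<rho> (f (tail Q \<rho>) v) = f (head Q \<rho>) (rmap X \<rho> v)"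
  using assms unfolding rep_hom_def defect_def by auto

locale rep_pair =
  fixes Q :: "('q, 'a) pre_digraph"
    and X :: "('q, 'a, 'k::field, 'v::ab_group_add) quiver_rep"
    and Y :: "('q, 'a, 'k, 'w::ab_group_add) quiver_rep"
  assumes wf: "wf_digraph Q" and X: "is_rep Q X" and Y: "is_rep Q Y"
begin

lemma tail_in: "\<rho> \<in> arcs Q \<Longrightarrow> tail Q \<rho> \<in> verts Q"
  and head_in: "\<rho> \<in> arcs Q \<Longrightarrow> head Q \<rho> \<in> verts Q"
  using wf by (auto simp: wf_digraph_def)

lemma restr_vert_maps:
  assumes "pre_hom Q X Y f"
  shows "restr Q X f \<in> vert_maps Q X Y"
proof -
  have "restr Q X f q \<in> hom_space (scl X) (scl Y) (spc X q) (spc Y q)" if q: "q \<in> verts Q" for q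
  proof -
    interpret vector_space "scl X" by (rule is_repD(1)[OF X])
    show ?thesis using pre_homD[OF assms q] q subspace_add[OF is_repD(2)[OF X q]]
      subspace_scale[OF is_repD(2)[OF X q]]
      unfolding hom_space_iff lin_on_def restr_def by auto
  qed
  then show ?thesis by (auto simp: vert_maps_def restr_def fun_eq_iff)
qed

text \<open>Outside the space at the tail both terms of d vanish: \<open>restr\<close> gives 0
  there, and \<open>rmap X \<rho>\<close> sends v to 0, where f is 0 by linearity.\<close>

lemma rep_diff_restr:
  assumes "pre_hom Q X Y f" "\<rho> \<in> arcs Q"
  shows "rep_diff Q X Y (restr Q X f) \<rho> v = (if v \<in> spc X (tail Q \<rho>) then defect Q X Y f \<rho> v else 0)"
proof (cases "v \<in> spc X (tail Q \<rho>)")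
  case True
  then show ?thesis using assms tail_in head_in is_repD(6)[OF X assms(2) True]
    by (simp add: rep_diff_def restr_def defect_def)
next
  case False
  have "rmap Y \<rho> 0 = 0"
    by (rule lin_on_0[OF is_repD(2)[OF Y tail_in] is_repD(1)[OF Y] is_repD(5)[OF Y]]) fact+
  moreover have "f (head Q \<rho>) 0 = 0"
    by (rule lin_on_0[OF is_repD(2)[OF X head_in] is_repD(1)[OF X] pre_homD(1)[OF assms(1) head_in]]) fact+
  ultimately show ?thesis using False assms is_repD(7)[OF X assms(2) False]
    by (simp add: rep_diff_def restr_def)
qed

lemma rep_diff_restr_eq:
  assumes "pre_hom Q X Y f" "\<phi> \<in> arc_maps Q X Y"
    and "\<And>\<rho> v. \<rho> \<in> arcs Q \<Longrightarrow> v \<in> spc X (tail Q \<rho>) \<Longrightarrow> defect Q X Y f \<rho> v = \<phi> \<rho> v"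
  shows "rep_diff Q X Y (restr Q X f) = \<phi>"
proof (intro ext)
  fix \<rho> v
  show "rep_diff Q X Y (restr Q X f) \<rho> v = \<phi> \<rho> v"
  proof (cases "\<rho> \<in> arcs Q")
    case True
    then show ?thesis using assms(2,3) by (auto simp: rep_diff_restr[OF assms(1)] arc_maps_def hom_space_iff)
  next
    case False
    then show ?thesis using assms(2) by (simp add: rep_diff_def arc_maps_def)
  qed
qed

lemma zero_arc_maps: "0 \<in> arc_maps Q X Y"
  using is_repD(8)[OF Y head_in] by (auto simp: arc_maps_def hom_space_iff lin_on_zero[OF is_repD(1)[OF Y]])

lemma rep_hom_restr:
  assumes "rep_hom Q X Y f"
  shows "restr Q X f \<in> Hom_Q Q X Y"
  using restr_vert_maps[OF rep_homD(1)[OF assms]] assms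
    rep_diff_restr_eq[OF rep_homD(1)[OF assms] zero_arc_maps]
  unfolding Hom_Q_def rep_hom_def by simp

lemma rep_hom_eq_0:
  assumes "Hom_Q Q X Y = {0}" "rep_hom Q X Y f" "q \<in> verts Q" "v \<in> spc X q"
  shows "f q v = 0"
proof -
  have "restr Q X f = 0" using rep_hom_restr[OF assms(2)] assms(1) by simp
  then have "restr Q X f q v = 0" by simp
  then show ?thesis using assms(3,4) by (simp add: restr_def)
qed

lemma vert_maps_in:
  assumes "f \<in> vert_maps Q X Y" "q \<in> verts Q"
  shows "f q v \<in> spc Y q"
  using assms is_repD(8)[OF Y assms(2)] by (cases "v \<in> spc X q") (auto simp: vert_maps_def hom_space_iff)

lemma vert_maps_diff:
  assumes "f \<in> vert_maps Q X Y" "g \<in> vert_maps Q X Y"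
  shows "f - g \<in> vert_maps Q X Y" "rep_diff Q X Y (f - g) = rep_diff Q X Y f - rep_diff Q X Y g"
proof -
  interpret vector_space "scl Y" by (rule is_repD(1)[OF Y])
  have "lin_on (scl X) (scl Y) (spc X q) (f q - g q)" if "q \<in> verts Q" for q
    using lin_on_diff[OF is_repD(1)[OF Y], of "scl X" "spc X q" "f q" "g q"] assms that
    by (simp add: vert_maps_def hom_space_iff fun_diff_def)
  then show "f - g \<in> vert_maps Q X Y"
    using assms vert_maps_in[OF assms(1)] vert_maps_in[OF assms(2)] subspace_diff[OF is_repD(2)[OF Y]]
    by (auto simp: vert_maps_def hom_space_iff)
  show "rep_diff Q X Y (f - g) = rep_diff Q X Y f - rep_diff Q X Y g"
  proof (intro ext)
    fix \<rho> v
    show "rep_diff Q X Y (f - g) \<rho> v = (rep_diff Q X Y f - rep_diff Q X Y g) \<rho> v"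
    proof (cases "\<rho> \<in> arcs Q")
      case True
      have "rmap Y \<rho> (f (tail Q \<rho>) v - g (tail Q \<rho>) v) = rmap Y \<rho> (f (tail Q \<rho>) v) - rmap Y \<rho> (g (tail Q \<rho>) v)"
        by (rule lin_on_diff_arg[OF is_repD(2)[OF Y tail_in] is_repD(1)[OF Y] is_repD(5)[OF Y]
              vert_maps_in[OF assms(1)] vert_maps_in[OF assms(2)]]) (use True tail_in in auto)
      then show ?thesis using True by (simp add: rep_diff_def)
    qed (simp add: rep_diff_def)
  qed
qed

lemma zero_vert_maps: "0 \<in> vert_maps Q X Y" "rep_diff Q X Y 0 = 0"
proof -
  show "0 \<in> vert_maps Q X Y"
    using is_repD(8)[OF Y] by (auto simp: vert_maps_def hom_space_iff lin_on_zero[OF is_repD(1)[OF Y]])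
  have "rmap Y \<rho> 0 = 0" if "\<rho> \<in> arcs Q" for \<rho>
    by (rule lin_on_0[OF is_repD(2)[OF Y tail_in] is_repD(1)[OF Y] is_repD(5)[OF Y]]) fact+
  then show "rep_diff Q X Y 0 = 0" by (auto simp: rep_diff_def fun_eq_iff)
qed

section \<open>Ext classes and linear independence\<close>

lemma ext_class_eqD:
  assumes "ext_class Q X Y \<phi> = ext_class Q X Y \<psi>"
  obtains f where "f \<in> vert_maps Q X Y" "\<phi> = \<psi> + rep_diff Q X Y f"
proof -
  have "\<phi> \<in> ext_class Q X Y \<phi>"
    unfolding ext_class_def using zero_vert_maps by force
  then show thesis using assms that unfolding ext_class_def by auto
qed

lemma ext_class_eq_0:
  assumes "f \<in> vert_maps Q X Y"
  shows "ext_class Q X Y (rep_diff Q X Y f) = ext_class Q X Y 0"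
proof -
  have neg: "0 - g \<in> vert_maps Q X Y \<and> rep_diff Q X Y (0 - g) = - rep_diff Q X Y g"
    if "g \<in> vert_maps Q X Y" for g
    using vert_maps_diff[OF zero_vert_maps(1) that] zero_vert_maps(2) by simp
  \<comment> \<open>Closure is available for differences, so a sum is treated as g - (0 -
    h).\<close>
  have add: "g + h \<in> vert_maps Q X Y \<and> rep_diff Q X Y (g + h) = rep_diff Q X Y g + rep_diff Q X Y h"
    if "g \<in> vert_maps Q X Y" "h \<in> vert_maps Q X Y" for g h
    using vert_maps_diff[OF that(1), of "0 - h"] neg[OF that(2)] by simp
  show ?thesis
  proof
    show "ext_class Q X Y (rep_diff Q X Y f) \<subseteq> ext_class Q X Y 0"
      unfolding ext_class_def using add[OF assms] by force
    show "ext_class Q X Y 0 \<subseteq> ext_class Q X Y (rep_diff Q X Y f)"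
    proof
      fix x assume "x \<in> ext_class Q X Y 0"
      then obtain g where g: "g \<in> vert_maps Q X Y" "x = rep_diff Q X Y g" unfolding ext_class_def by auto
      then have "x = rep_diff Q X Y f + rep_diff Q X Y (g - f)"
        using vert_maps_diff[OF g(1) assms] by simp
      then show "x \<in> ext_class Q X Y (rep_diff Q X Y f)"
        unfolding ext_class_def using vert_maps_diff(1)[OF g(1) assms] by blast
    qed
  qed
qed

text \<open>Linear independence of the classes of the \<open>\<chi> l\<close>: a combination that is
  a coboundary represents the class 0, as does the zero combination, and \<open>ext_basis\<close>
  makes the coefficients unique.\<close>

lemma ext_basis_coeff_0:
  assumes basis: "ext_basis Q X Y n \<chi>" and f: "pre_hom Q X Y f"
    and eq: "\<And>\<rho> v. \<rho> \<in> arcs Q \<Longrightarrow> v \<in> spc X (tail Q \<rho>) \<Longrightarrow>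
      defect Q X Y f \<rho> v = (\<Sum>l=1..n. scl Y (c l) (\<chi> l \<rho> v))"
    and l: "l \<in> {1..n}"
  shows "c l = 0"
proof -
  interpret vector_space "scl Y" by (rule is_repD(1)[OF Y])
  have sum_apply: "(\<Sum>l=1..n. fam_scale Y (d l) (\<chi> l)) \<rho> v = (\<Sum>l=1..n. scl Y (d l) (\<chi> l \<rho> v))" for d \<rho> v
  proof -
    have "(\<Sum>l\<in>A. fam_scale Y (d l) (\<chi> l)) \<rho> v = (\<Sum>l\<in>A. scl Y (d l) (\<chi> l \<rho> v))" for A
      by (induction A rule: infinite_finite_induct) (auto simp: fam_scale_def)
    then show ?thesis .
  qed
  \<comment> \<open>Uniqueness in \<open>ext_basis\<close> is among extensional functions, hence
    both coefficient families are cut down to \<open>{1..n}\<close>.\<close>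
  let ?c = "restrict c {1..n}" and ?z = "\<lambda>l\<in>{1..n}. 0"
  have \<chi>: "l \<in> {1..n} \<Longrightarrow> \<chi> l \<in> arc_maps Q X Y" for l using basis by (auto simp: ext_basis_def)
  have z: "(\<Sum>l=1..n. fam_scale Y (?z l) (\<chi> l)) = 0"
    by (intro sum.neutral) (auto simp: fam_scale_def fun_eq_iff)
  have c: "(\<Sum>l=1..n. fam_scale Y (?c l) (\<chi> l)) \<rho> v = (\<Sum>l=1..n. scl Y (c l) (\<chi> l \<rho> v))" for \<rho> v
    unfolding sum_apply by (rule sum.cong) auto
  have "rep_diff Q X Y (restr Q X f) \<rho> v = (\<Sum>l=1..n. fam_scale Y (?c l) (\<chi> l)) \<rho> v" for \<rho> v
  proof (cases "\<rho> \<in> arcs Q")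
    case True
    have "(\<Sum>l=1..n. scl Y (c l) (\<chi> l \<rho> v)) = 0" if "v \<notin> spc X (tail Q \<rho>)"
      using \<chi> that True by (intro sum.neutral) (auto simp: arc_maps_def hom_space_iff)
    then show ?thesis using True unfolding c by (auto simp: rep_diff_restr[OF f True] eq)
  next
    case False
    then have "(\<Sum>l=1..n. scl Y (c l) (\<chi> l \<rho> v)) = 0"
      using \<chi> by (intro sum.neutral) (auto simp: arc_maps_def)
    then show ?thesis using False unfolding c by (simp add: rep_diff_def)
  qed
  then have "(\<Sum>l=1..n. fam_scale Y (?c l) (\<chi> l)) = rep_diff Q X Y (restr Q X f)"
    by (intro ext) simp
  then have "ext_class Q X Y (\<Sum>l=1..n. fam_scale Y (?c l) (\<chi> l)) = ext_class Q X Y 0"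
    using ext_class_eq_0[OF restr_vert_maps[OF f]] by simp
  then have eq0: "ext_class Q X Y 0 = ext_class Q X Y (\<Sum>l=1..n. fam_scale Y (?c l) (\<chi> l))" ..
  define P where "P d \<longleftrightarrow> d \<in> {1..n} \<rightarrow>\<^sub>E UNIV \<and>
      ext_class Q X Y 0 = ext_class Q X Y (\<Sum>l=1..n. fam_scale Y (d l) (\<chi> l))" for d
  have in_Ext: "ext_class Q X Y 0 \<in> Ext_Q Q X Y"
    unfolding Ext_Q_def by (rule imageI[OF zero_arc_maps])
  have "\<forall>e\<in>Ext_Q Q X Y. \<exists>!c. c \<in> {1..n} \<rightarrow>\<^sub>E UNIV \<and>
      e = ext_class Q X Y (\<Sum>l=1..n. fam_scale Y (c l) (\<chi> l))"
    using basis unfolding ext_basis_def by (rule conjunct2)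
  from bspec[OF this in_Ext] have ex1: "\<exists>!c. P c" unfolding P_def .
  have "P ?c" "P ?z" using eq0 unfolding z P_def by simp_all
  then have "?c = ?z" using ex1 by blast
  then show ?thesis using l by (metis restrict_apply')
qed

text \<open>If Ext vanishes and n > 0, then \<open>\<chi> 1\<close> is a coboundary, and
  independence forces its coefficient 1 to be 0.\<close>

lemma ext_dim_0:
  assumes basis: "ext_basis Q X Y n \<chi>" and "Ext_Q Q X Y = {ext_class Q X Y 0}"
  shows "n = 0"
proof (rule ccontr)
  interpret vector_space "scl Y" by (rule is_repD(1)[OF Y])
  assume n: "n \<noteq> 0"
  then have "\<chi> 1 \<in> arc_maps Q X Y" using basis by (auto simp: ext_basis_def)
  then have "ext_class Q X Y (\<chi> 1) = ext_class Q X Y 0" using assms(2) unfolding Ext_Q_def by blast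
  then obtain f where f: "f \<in> vert_maps Q X Y" "\<chi> 1 = 0 + rep_diff Q X Y f" by (rule ext_class_eqD)
  then have pre: "pre_hom Q X Y f" by (auto simp: pre_hom_def vert_maps_def hom_space_iff)
  have "(if (1::nat) = 1 then 1 else 0 :: 'k) = 0"
  proof (rule ext_basis_coeff_0[OF basis pre, where c = "\<lambda>l. if l = 1 then 1 else 0" and l = 1])
    fix \<rho> v assume "\<rho> \<in> arcs Q"
    then have "defect Q X Y f \<rho> v = \<chi> 1 \<rho> v" using f(2) by (simp add: defect_def rep_diff_def)
    also have "\<dots> = (\<Sum>l=1..n. if l = 1 then \<chi> l \<rho> v else 0)" using n by simp
    also have "\<dots> = (\<Sum>l=1..n. scl Y (if l = 1 then 1 else 0) (\<chi> l \<rho> v))"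
      by (rule sum.cong) auto
    finally show "defect Q X Y f \<rho> v = (\<Sum>l=1..n. scl Y (if l = 1 then 1 else 0) (\<chi> l \<rho> v))" .
  qed (use n in auto)
  then show False by simp
qed

end

section \<open>Decompositions and idempotent endomorphisms\<close>

lemma indecomposableD:
  assumes "indecomposable Q Y" "is_subrep Q Y U" "is_subrep Q Y W"
    and "\<And>q. q \<in> verts Q \<Longrightarrow> U q \<inter> W q = {0}"
    and "\<And>q. q \<in> verts Q \<Longrightarrow> {u + w | u w. u \<in> U q \<and> w \<in> W q} = spc Y q"
  shows "(\<forall>q\<in>verts Q. U q = {0}) \<or> (\<forall>q\<in>verts Q. W q = {0})"
  using assms unfolding indecomposable_def by simp

text \<open>Kernel and image of an idempotent morphism are complementary subrepresentations, by x =
  (x - e x) + e x. One of them is 0: a vanishing image means e = 0, and a vanishing kernel means x =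
  e x.\<close>

lemma indecomposable_idempotent:
  assumes ind: "indecomposable Q Y" and wf: "wf_digraph Q" and e: "rep_hom Q Y Y e"
    and idem: "\<And>q x. q \<in> verts Q \<Longrightarrow> x \<in> spc Y q \<Longrightarrow> e q (e q x) = e q x"
  shows "(\<forall>q\<in>verts Q. \<forall>x\<in>spc Y q. e q x = 0) \<or> (\<forall>q\<in>verts Q. \<forall>x\<in>spc Y q. e q x = x)"
proof -
  have rep: "is_rep Q Y" using ind unfolding indecomposable_def by blast
  interpret rep_pair Q Y Y by (rule rep_pair.intro[OF wf rep rep])
  interpret vector_space "scl Y" by (rule is_repD(1)[OF rep])
  have lin: "lin_on (scl Y) (scl Y) (spc Y q) (e q)" and into: "x \<in> spc Y q \<Longrightarrow> e q x \<in> spc Y q"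
    if "q \<in> verts Q" for q x using pre_homD[OF rep_homD(1)[OF e] that] by auto
  have e0: "e q 0 = 0" if "q \<in> verts Q" for q
    by (rule lin_on_0[OF is_repD(2)[OF rep that] is_repD(1)[OF rep] lin[OF that]])
  have ediff: "e q (x - y) = e q x - e q y" if "q \<in> verts Q" "x \<in> spc Y q" "y \<in> spc Y q" for q x y
    by (rule lin_on_diff_arg[OF is_repD(2)[OF rep that(1)] is_repD(1)[OF rep] lin[OF that(1)] that(2,3)])
  have ker: "subspace {x \<in> spc Y q. e q x = 0}" and im: "subspace (e q ` spc Y q)" if q: "q \<in> verts Q" for q
  proof -
    note sub = is_repD(2)[OF rep q]
    show "subspace {x \<in> spc Y q. e q x = 0}"
      using lin[OF q] e0[OF q] subspace_0[OF sub] subspace_add[OF sub] subspace_scale[OF sub]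
      by (auto simp: subspace_def lin_on_def)
    have "e q x + e q y \<in> e q ` spc Y q" "scl Y c (e q x) \<in> e q ` spc Y q"
      if "x \<in> spc Y q" "y \<in> spc Y q" for x y c
      using lin[OF q] that subspace_add[OF sub that] subspace_scale[OF sub that(1)]
      unfolding lin_on_def by (metis image_eqI)+
    moreover have "0 \<in> e q ` spc Y q" using e0[OF q] subspace_0[OF sub] by (metis image_eqI)
    ultimately show "subspace (e q ` spc Y q)" unfolding subspace_def by blast
  qed
  have sub1: "is_subrep Q Y (\<lambda>q. {x \<in> spc Y q. e q x = 0})" unfolding is_subrep_def
  proof (intro conjI ballI)
    fix \<rho> assume \<rho>: "\<rho> \<in> arcs Q"
    have "rmap Y \<rho> 0 = 0"
      by (rule lin_on_0[OF is_repD(2)[OF rep tail_in[OF \<rho>]] is_repD(1)[OF rep] is_repD(5)[OF rep \<rho>]])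
    then show "rmap Y \<rho> ` {x \<in> spc Y (tail Q \<rho>). e (tail Q \<rho>) x = 0}
        \<subseteq> {x \<in> spc Y (head Q \<rho>). e (head Q \<rho>) x = 0}"
      using is_repD(6)[OF rep \<rho>] rep_homD(2)[OF e \<rho>] by (auto simp del: zero_fun_apply) metis
  qed (use ker in auto)
  have sub2: "is_subrep Q Y (\<lambda>q. e q ` spc Y q)" unfolding is_subrep_def
    using im into is_repD(6)[OF rep] rep_homD(2)[OF e] by (fastforce simp: tail_in head_in)
  have dir: "{x \<in> spc Y q. e q x = 0} \<inter> e q ` spc Y q = {0}"
    "{u + w | u w. u \<in> {x \<in> spc Y q. e q x = 0} \<and> w \<in> e q ` spc Y q} = spc Y q" if q: "q \<in> verts Q" for q
  proof -
    note sub = is_repD(2)[OF rep q]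
    show "{x \<in> spc Y q. e q x = 0} \<inter> e q ` spc Y q = {0}"
      using idem[OF q] e0[OF q] subspace_0[OF sub] by (auto intro!: image_eqI[of 0])
    have "\<exists>u w. x = u + w \<and> u \<in> {x \<in> spc Y q. e q x = 0} \<and> w \<in> e q ` spc Y q" if x: "x \<in> spc Y q" for x
      using ediff[OF q x into[OF q x]] idem[OF q x] subspace_diff[OF sub x into[OF q x]] x
      by (intro exI[of _ "x - e q x"] exI[of _ "e q x"]) auto
    then show "{u + w | u w. u \<in> {x \<in> spc Y q. e q x = 0} \<and> w \<in> e q ` spc Y q} = spc Y q"
      using subspace_add[OF sub] into[OF q] by blast
  qed
  have "(\<forall>q\<in>verts Q. {x \<in> spc Y q. e q x = 0} = {0}) \<or> (\<forall>q\<in>verts Q. e q ` spc Y q = {0})"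
    by (rule indecomposableD[OF ind sub1 sub2 dir])
  then show ?thesis
  proof
    assume ker0: "\<forall>q\<in>verts Q. {x \<in> spc Y q. e q x = 0} = {0}"
    have "e q x = x" if q: "q \<in> verts Q" and x: "x \<in> spc Y q" for q x
    proof -
      have "x - e q x \<in> {x \<in> spc Y q. e q x = 0}"
        using ediff[OF q x into[OF q x]] idem[OF q x] subspace_diff[OF is_repD(2)[OF rep q] x into[OF q x]] by simp
      then show ?thesis using ker0 q by auto
    qed
    then show ?thesis by blast
  qed blast
qed

text \<open>A decomposition into U and W yields an idempotent endomorphism, the projection onto U
  along W; if it is 0 then U = 0, and if it is the identity then W = 0.\<close>

lemma indecomposableI:
  assumes wf: "wf_digraph Q" and rep: "is_rep Q Y" and nz: "\<exists>q\<in>verts Q. spc Y q \<noteq> {0}"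
    and *: "\<And>e. rep_hom Q Y Y e \<Longrightarrow> (\<And>q x. q \<in> verts Q \<Longrightarrow> x \<in> spc Y q \<Longrightarrow> e q (e q x) = e q x) \<Longrightarrow>
      (\<forall>q\<in>verts Q. \<forall>x\<in>spc Y q. e q x = 0) \<or> (\<forall>q\<in>verts Q. \<forall>x\<in>spc Y q. e q x = x)"
  shows "indecomposable Q Y"
proof -
  interpret rep_pair Q Y Y by (rule rep_pair.intro[OF wf rep rep])
  interpret vector_space "scl Y" by (rule is_repD(1)[OF rep])
  have "(\<forall>q\<in>verts Q. U q = {0}) \<or> (\<forall>q\<in>verts Q. W q = {0})"
    if U: "is_subrep Q Y U" and W: "is_subrep Q Y W"
      and dir: "\<forall>q\<in>verts Q. U q \<inter> W q = {0} \<and> {u + w | u w. u \<in> U q \<and> w \<in> W q} = spc Y q" for U W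
  proof -
    \<comment> \<open>On \<open>spc Y q\<close> the description is met because U and W span, and by
      one element only, because two candidates differ by an element of both U and W.\<close>
    define e where "e q x = (THE u. u \<in> U q \<and> x - u \<in> W q)" for q x
    have subU: "subspace (U q)" and subW: "subspace (W q)" if "q \<in> verts Q" for q
      using U W that unfolding is_subrep_def by auto
    have e_eq: "e q x = u" if q: "q \<in> verts Q" and "u \<in> U q" "x - u \<in> W q" for q x u
      unfolding e_def
    proof (rule the_equality)
      fix u' assume u': "u' \<in> U q \<and> x - u' \<in> W q"
      have "u' - u \<in> U q" using subspace_diff[OF subU[OF q]] u' that by simp
      moreover have "(x - u) - (x - u') \<in> W q" using subspace_diff[OF subW[OF q]] u' that by blast
      then have "u' - u \<in> W q" by simp
      ultimately have "u' - u = 0" using dir q by blast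
      then show "u' = u" by simp
    qed (use that in blast)
    have e_in: "e q x \<in> U q" "x - e q x \<in> W q" if q: "q \<in> verts Q" and x: "x \<in> spc Y q" for q x
    proof -
      obtain u w where "u \<in> U q" "w \<in> W q" "x = u + w" using dir q x by blast
      moreover from this have "e q x = u" by (intro e_eq[OF q]) auto
      ultimately show "e q x \<in> U q" "x - e q x \<in> W q" by auto
    qed
    have Usp: "U q \<subseteq> spc Y q" if "q \<in> verts Q" for q using U that unfolding is_subrep_def by blast
    have "rep_hom Q Y Y e" unfolding rep_hom_def pre_hom_def
    proof (intro conjI ballI)
      fix q assume q: "q \<in> verts Q"
      show "lin_on (scl Y) (scl Y) (spc Y q) (e q)" unfolding lin_on_def
      proof (intro conjI ballI allI)
        fix x y c assume x: "x \<in> spc Y q"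
        have "scl Y c x - scl Y c (e q x) \<in> W q"
          using subspace_scale[OF subW[OF q] e_in(2)[OF q x], of c] by (simp add: scale_right_diff_distrib)
        then show "e q (scl Y c x) = scl Y c (e q x)"
          using subspace_scale[OF subU[OF q] e_in(1)[OF q x]] by (intro e_eq[OF q])
        assume y: "y \<in> spc Y q"
        have "x + y - (e q x + e q y) \<in> W q"
          using subspace_add[OF subW[OF q] e_in(2)[OF q x] e_in(2)[OF q y]] by (simp add: algebra_simps)
        then show "e q (x + y) = e q x + e q y"
          using subspace_add[OF subU[OF q] e_in(1)[OF q x] e_in(1)[OF q y]] by (intro e_eq[OF q])
      qed
      show "e q ` spc Y q \<subseteq> spc Y q" using e_in(1)[OF q] Usp[OF q] by blast
    next
      fix \<rho> x assume \<rho>: "\<rho> \<in> arcs Q" and x: "x \<in> spc Y (tail Q \<rho>)"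
      note t = tail_in[OF \<rho>]
      have "rmap Y \<rho> (x - e (tail Q \<rho>) x) = rmap Y \<rho> x - rmap Y \<rho> (e (tail Q \<rho>) x)"
        using e_in(1)[OF t x] Usp[OF t]
        by (intro lin_on_diff_arg[OF is_repD(2)[OF rep t] is_repD(1)[OF rep] is_repD(5)[OF rep \<rho>] x]) blast
      moreover have "rmap Y \<rho> (x - e (tail Q \<rho>) x) \<in> W (head Q \<rho>)"
        using W \<rho> e_in(2)[OF t x] unfolding is_subrep_def by blast
      moreover have "rmap Y \<rho> (e (tail Q \<rho>) x) \<in> U (head Q \<rho>)"
        using U \<rho> e_in(1)[OF t x] unfolding is_subrep_def by blast
      ultimately have "e (head Q \<rho>) (rmap Y \<rho> x) = rmap Y \<rho> (e (tail Q \<rho>) x)"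
        by (intro e_eq[OF head_in[OF \<rho>]]) auto
      then show "defect Q Y Y e \<rho> x = 0" by (simp add: defect_def)
    qed
    moreover have eU: "e q u = u" if "q \<in> verts Q" "u \<in> U q" for q u
      using that subspace_0[OF subW[OF that(1)]] by (intro e_eq) auto
    moreover have eW: "e q w = 0" if "q \<in> verts Q" "w \<in> W q" for q w
      using that subspace_0[OF subU[OF that(1)]] by (intro e_eq) auto
    ultimately have "(\<forall>q\<in>verts Q. \<forall>x\<in>spc Y q. e q x = 0) \<or> (\<forall>q\<in>verts Q. \<forall>x\<in>spc Y q. e q x = x)"
      using e_in(1) by (intro *) auto
    then show ?thesis
    proof
      assume z: "\<forall>q\<in>verts Q. \<forall>x\<in>spc Y q. e q x = 0"
      have "U q = {0}" if "q \<in> verts Q" for q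
      proof -
        have "u = 0" if "u \<in> U q" for u using eU[OF \<open>q \<in> verts Q\<close> that] z \<open>q \<in> verts Q\<close> that Usp[of q] by auto
        then show ?thesis using subspace_0[OF subU[OF that]] by blast
      qed
      then show ?thesis by blast
    next
      assume id: "\<forall>q\<in>verts Q. \<forall>x\<in>spc Y q. e q x = x"
      have "W q = {0}" if "q \<in> verts Q" for q
      proof -
        have "W q \<subseteq> spc Y q" using W that unfolding is_subrep_def by blast
        then have "w = 0" if "w \<in> W q" for w using eW[OF \<open>q \<in> verts Q\<close> that] id \<open>q \<in> verts Q\<close> that by auto
        then show ?thesis using subspace_0[OF subW[OF that]] by blast
      qed
      then show ?thesis by blast
    qed
  qed
  then show ?thesis using rep nz unfolding indecomposable_def by blast
qed

section \<open>The representations with spaces M_q tensor X_m\<close>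

lemma sum_fun_apply: "(\<Sum>i\<in>I. f i) x = (\<Sum>i\<in>I. f i x)"
  by (induction I rule: infinite_finite_induct) auto

text \<open>These assumptions hold for X and for X_2 alike, so everything proved from them applies
  to F_M X and to F_M X_2. The vanishing conditions on Hom and Ext are added later, in
  \<open>theorem_setting\<close>.\<close>

locale tensor_setting =
  fixes Q :: "('q, 'a) pre_digraph"
    and r :: nat
    and M :: "nat \<Rightarrow> ('q, 'a, 'k::field, 'v::ab_group_add) quiver_rep"
    and \<chi> :: "nat \<Rightarrow> nat \<Rightarrow> nat \<Rightarrow> 'a \<Rightarrow> 'v \<Rightarrow> 'v"
    and X :: "(nat, nat \<times> nat \<times> nat, 'k, 'w::ab_group_add) quiver_rep"
  assumes wf: "wf_digraph Q"
    and M_rep: "\<And>i. i \<in> {1..r} \<Longrightarrow> is_rep Q (M i)"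
    and chi: "\<And>i j. i \<in> {1..r} \<Longrightarrow> j \<in> {1..r} \<Longrightarrow> i \<noteq> j \<Longrightarrow>
          ext_basis Q (M i) (M j) (ext_dim Q (M i) (M j)) (\<chi> i j)"
    and X_rep: "is_rep (QM Q r M) X"
begin

abbreviation "I \<equiv> {1..r}"
abbreviation "N i \<equiv> tensor_rep Q (M i) X i"
abbreviation "T i q \<equiv> tensor_space (scl (M i)) (scl X) (spc (M i) q) (spc X i)"
abbreviation "pt i \<equiv> pure_tensor (scl (M i)) (scl X)"
abbreviation "X_hom j i \<equiv> hom_space (scl X) (scl X) (spc X j) (spc X i)"
abbreviation "n j i \<equiv> ext_dim Q (M j) (M i)"

lemma tail_in: "\<rho> \<in> arcs Q \<Longrightarrow> tail Q \<rho> \<in> verts Q"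
  and head_in: "\<rho> \<in> arcs Q \<Longrightarrow> head Q \<rho> \<in> verts Q"
  using wf by (auto simp: wf_digraph_def)

lemma N_simps: "scl (N i) = tensor_scale" "spc (N i) = T i"
  "rmap (N i) \<rho> = tensor_map (scl (M i)) (scl X) (scl (M i)) (scl X) (spc (M i) (tail Q \<rho>)) (spc X i)
       (rmap (M i) \<rho>) (\<lambda>x. x)"
  by (simp_all add: tensor_rep_def fun_eq_iff)

lemma X_vs: "vector_space (scl X)"
  by (rule is_repD(1)[OF X_rep])

sublocale Xs: vector_space "scl X"
  by (rule X_vs)

lemma X_sub: "i \<in> I \<Longrightarrow> Xs.subspace (spc X i)"
  by (rule is_repD(2)[OF X_rep]) (simp add: QM_def)

lemma X_rmap: "i \<in> I \<Longrightarrow> j \<in> I \<Longrightarrow> i \<noteq> j \<Longrightarrow> l \<in> {1..n j i} \<Longrightarrow> rmap X (j, i, l) \<in> X_hom j i"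
  using is_repD(4)[OF X_rep, of "(j, i, l)"] by (simp add: QM_def)

text \<open>The basis depends on i only, so at every vertex q the space \<open>T i q\<close> is
  written as copies of \<open>spc (M i) q\<close> over the same index set; this exhibits N_i as a
  direct sum of copies of M_i.\<close>

definition B :: "nat \<Rightarrow> 'w set" where
  "B i = (SOME B. finite B \<and> Xs.independent B \<and> Xs.span B = spc X i)"

lemma B:
  assumes "i \<in> I"
  shows "finite (B i)" "Xs.independent (B i)" "Xs.span (B i) = spc X i"
proof -
  have "fin_dim_subspace (scl X) (spc X i)"
    using assms by (intro is_repD(3)[OF X_rep]) (simp add: QM_def)
  then obtain C where C: "finite C" "Xs.span C = spc X i" unfolding fin_dim_subspace_def by blast
  obtain A where "A \<subseteq> C" "Xs.independent A" "C \<subseteq> Xs.span A" by (rule Xs.maximal_independent_subset)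
  moreover from this have "Xs.span A = Xs.span C" by (meson Xs.span_eq Xs.span_superset order_trans)
  ultimately have "finite A \<and> Xs.independent A \<and> Xs.span A = spc X i"
    using C finite_subset by blast
  then have "finite (B i) \<and> Xs.independent (B i) \<and> Xs.span (B i) = spc X i"
    unfolding B_def by (rule someI)
  then show "finite (B i)" "Xs.independent (B i)" "Xs.span (B i) = spc X i" by auto
qed

lemma B_in: "i \<in> I \<Longrightarrow> b \<in> B i \<Longrightarrow> b \<in> spc X i"
  using B(3) Xs.span_base by blast

lemma tc:
  assumes "i \<in> I" "q \<in> verts Q"
  shows "tensor_coords (scl (M i)) (scl X) (spc (M i) q) (B i)"
  using assms B is_repD(1,2)[OF M_rep] X_vs
  by (intro tensor_coords.intro vector_space_pair.intro tensor_coords_axioms.intro) auto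

abbreviation "crd i \<equiv> tensor_coords.coord (scl (M i)) (scl X) (B i)"

context
  fixes i q
  assumes i: "i \<in> I" and q: "q \<in> verts Q"
begin

lemmas pt_in = tensor_coords.pt_in_TS[OF tc[OF i q], unfolded B(3)[OF i]]
lemmas subspace_T = tensor_coords.subspace_TS[OF tc[OF i q], unfolded B(3)[OF i]]
lemmas T_fin_dim = tensor_coords.TS_fin_dim[OF tc[OF i q], unfolded B(3)[OF i]]
lemmas T_nonzero = tensor_coords.TS_nonzero[OF tc[OF i q], unfolded B(3)[OF i]]
lemmas crd_pt = tensor_coords.coord_pt[OF tc[OF i q], unfolded B(3)[OF i]]
lemmas crd_lin = tensor_coords.lin_on_coord[OF tc[OF i q], unfolded B(3)[OF i]]
lemmas T_expand = tensor_coords.tensor_expand[OF tc[OF i q], unfolded B(3)[OF i]]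
lemmas T_ext = tensor_coords.tensor_ext[OF tc[OF i q], unfolded B(3)[OF i]]
lemmas pt_expand = tensor_coords.pt_expand[OF tc[OF i q], unfolded B(3)[OF i]]
lemmas pt_lin = tensor_coords.lin_on_pt[OF tc[OF i q]]
lemmas pt_add_right = tensor_coords.pt_add_right[OF tc[OF i q]]
lemmas pt_scale_left = tensor_coords.pt_scale_left[OF tc[OF i q]]
lemmas pt_scale_right = tensor_coords.pt_scale_right[OF tc[OF i q]]
lemmas pt_sum_right = tensor_coords.pt_sum_right[OF tc[OF i q]]
lemmas pt_0_left = tensor_coords.pt_0_left[OF tc[OF i q]]
lemmas pt_0_right = tensor_coords.pt_0_right[OF tc[OF i q]]

lemma crd_pt_B: "b \<in> B i \<Longrightarrow> b' \<in> B i \<Longrightarrow> crd i (pt i v b) b' = (if b = b' then v else 0)"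
proof -
  interpret Mi: vector_space "scl (M i)" by (rule is_repD(1)[OF M_rep[OF i]])
  show "b \<in> B i \<Longrightarrow> b' \<in> B i \<Longrightarrow> crd i (pt i v b) b' = (if b = b' then v else 0)"
    by (auto simp: crd_pt B_in[OF i] Xs.representation_basis[OF B(2)[OF i]])
qed

end

context
  fixes i j q q' f g
  assumes i: "i \<in> I" and j: "j \<in> I" and q: "q \<in> verts Q" and q': "q' \<in> verts Q"
    and f: "lin_on (scl (M j)) (scl (M i)) (spc (M j) q) f" "f ` spc (M j) q \<subseteq> spc (M i) q'"
    and g: "lin_on (scl X) (scl X) (spc X j) g" "g ` spc X j \<subseteq> spc X i"
begin

lemma tcp: "tensor_coords_pair (scl (M j)) (scl X) (spc (M j) q) (B j) (scl (M i)) (scl X) (spc (M i) q') (B i)"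
  by (intro tensor_coords_pair.intro tc i j q q')

lemmas tmap_pt = tensor_coords_pair.tmap_pt[OF tcp, unfolded B(3)[OF i] B(3)[OF j], OF f g]
lemmas tmap_hom = tensor_coords_pair.tmap_hom[OF tcp, unfolded B(3)[OF i] B(3)[OF j], OF f g]

end

lemma N_rmap:
  assumes i: "i \<in> I" and \<rho>: "\<rho> \<in> arcs Q"
  shows "rmap (N i) \<rho> \<in> hom_space tensor_scale tensor_scale (T i (tail Q \<rho>)) (T i (head Q \<rho>))"
    and "v \<in> spc (M i) (tail Q \<rho>) \<Longrightarrow> w \<in> spc X i \<Longrightarrow> rmap (N i) \<rho> (pt i v w) = pt i (rmap (M i) \<rho> v) w"
proof -
  have *: "rmap (M i) \<rho> ` spc (M i) (tail Q \<rho>) \<subseteq> spc (M i) (head Q \<rho>)" "(\<lambda>x. x) ` spc X i \<subseteq> spc X i"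
    using is_repD(6)[OF M_rep[OF i] \<rho>] by auto
  show "rmap (N i) \<rho> \<in> hom_space tensor_scale tensor_scale (T i (tail Q \<rho>)) (T i (head Q \<rho>))"
    unfolding N_simps
    by (rule tmap_hom[OF i i tail_in[OF \<rho>] head_in[OF \<rho>] is_repD(5)[OF M_rep[OF i] \<rho>] *(1) lin_on_id *(2)])
  show "v \<in> spc (M i) (tail Q \<rho>) \<Longrightarrow> w \<in> spc X i \<Longrightarrow> rmap (N i) \<rho> (pt i v w) = pt i (rmap (M i) \<rho> v) w"
    unfolding N_simps
    by (rule tmap_pt[OF i i tail_in[OF \<rho>] head_in[OF \<rho>] is_repD(5)[OF M_rep[OF i] \<rho>] *(1) lin_on_id *(2)])
qed

lemma N_rep:
  assumes i: "i \<in> I"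
  shows "is_rep Q (N i)"
  unfolding is_rep_def N_simps(1,2)
proof (intro conjI ballI)
  fix q assume q: "q \<in> verts Q"
  show "fin_dim_subspace tensor_scale (T i q)"
    by (rule T_fin_dim[OF i q is_repD(3)[OF M_rep[OF i] q]])
next
  have "T i q = {0}" if q: "q \<in> verts Q" and "spc (M i) q = {0}" for q
  proof -
    have "t = 0" if "t \<in> T i q" for t
    proof -
      have "(\<Sum>b\<in>B i. pt i (crd i t b) b) = 0"
        using T_expand(2)[OF i q that] \<open>spc (M i) q = {0}\<close>
        by (intro sum.neutral ballI) (simp add: pt_0_left[OF i q])
      then show ?thesis using T_expand(1)[OF i q that] by simp
    qed
    then show ?thesis using tensor.subspace_0[OF subspace_T[OF i q]] by blast
  qed
  then have "{q \<in> verts Q. T i q \<noteq> {0}} \<subseteq> {q \<in> verts Q. spc (M i) q \<noteq> {0}}" by blast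
  then show "finite {q \<in> verts Q. T i q \<noteq> {0}}"
    by (rule finite_subset) (use M_rep[OF i] in \<open>simp add: is_rep_def\<close>)
qed (use N_rmap(1)[OF i] vector_space_tensor_scale in auto)

lemma N_pair: "i \<in> I \<Longrightarrow> j \<in> I \<Longrightarrow> rep_pair Q (N i) (N j)"
  by (intro rep_pair.intro wf N_rep)

lemma M_pair: "i \<in> I \<Longrightarrow> j \<in> I \<Longrightarrow> rep_pair Q (M i) (M j)"
  by (intro rep_pair.intro wf M_rep)

section \<open>Families with components chi tensor psi\<close>

context
  fixes i j \<psi>
  assumes i: "i \<in> I" and j: "j \<in> I" and ij: "i \<noteq> j"
    and \<psi>: "\<And>l. l \<in> {1..n j i} \<Longrightarrow> \<psi> l \<in> X_hom j i"
begin

lemma chi_arc: "l \<in> {1..n j i} \<Longrightarrow> \<chi> j i l \<in> arc_maps Q (M j) (M i)"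
  using chi[OF j i] ij by (simp add: ext_basis_def)

lemma chi_in: "l \<in> {1..n j i} \<Longrightarrow> \<rho> \<in> arcs Q \<Longrightarrow> v \<in> spc (M j) (tail Q \<rho>) \<Longrightarrow>
    \<chi> j i l \<rho> v \<in> spc (M i) (head Q \<rho>)"
  using chi_arc[of l] by (auto simp: arc_maps_def hom_space_iff)

lemma chi_tmap:
  assumes \<rho>: "\<rho> \<in> arcs Q" and l: "l \<in> {1..n j i}"
  defines "h \<equiv> tensor_map (scl (M j)) (scl X) (scl (M i)) (scl X) (spc (M j) (tail Q \<rho>)) (spc X j) (\<chi> j i l \<rho>) (\<psi> l)"
  shows "h \<in> hom_space tensor_scale tensor_scale (T j (tail Q \<rho>)) (T i (head Q \<rho>))"
    and "v \<in> spc (M j) (tail Q \<rho>) \<Longrightarrow> w \<in> spc X j \<Longrightarrow> h (pt j v w) = pt i (\<chi> j i l \<rho> v) (\<psi> l w)"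
proof -
  have 1: "lin_on (scl (M j)) (scl (M i)) (spc (M j) (tail Q \<rho>)) (\<chi> j i l \<rho>)"
    "\<chi> j i l \<rho> ` spc (M j) (tail Q \<rho>) \<subseteq> spc (M i) (head Q \<rho>)"
    using chi_arc[OF l] \<rho> by (auto simp: arc_maps_def hom_space_iff)
  have 2: "lin_on (scl X) (scl X) (spc X j) (\<psi> l)" "\<psi> l ` spc X j \<subseteq> spc X i"
    using \<psi>[OF l] by (auto simp: hom_space_iff)
  show "h \<in> hom_space tensor_scale tensor_scale (T j (tail Q \<rho>)) (T i (head Q \<rho>))"
    unfolding h_def by (rule tmap_hom[OF i j tail_in[OF \<rho>] head_in[OF \<rho>] 1 2])
  show "v \<in> spc (M j) (tail Q \<rho>) \<Longrightarrow> w \<in> spc X j \<Longrightarrow> h (pt j v w) = pt i (\<chi> j i l \<rho> v) (\<psi> l w)"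
    unfolding h_def by (rule tmap_pt[OF i j tail_in[OF \<rho>] head_in[OF \<rho>] 1 2])
qed

lemma chi_pt:
  assumes "\<rho> \<in> arcs Q" "v \<in> spc (M j) (tail Q \<rho>)" "w \<in> spc X j"
  shows "chi_tensor Q M \<chi> X j i \<psi> \<rho> (pt j v w) = (\<Sum>l=1..n j i. pt i (\<chi> j i l \<rho> v) (\<psi> l w))"
  using assms by (simp only: chi_tensor_def if_True sum_fun_apply) (simp only: chi_tmap(2) cong: sum.cong)

lemma chi_hom:
  assumes \<rho>: "\<rho> \<in> arcs Q"
  shows "chi_tensor Q M \<chi> X j i \<psi> \<rho> \<in> hom_space tensor_scale tensor_scale (T j (tail Q \<rho>)) (T i (head Q \<rho>))"
proof -
  let ?h = "\<lambda>l. tensor_map (scl (M j)) (scl X) (scl (M i)) (scl X) (spc (M j) (tail Q \<rho>)) (spc X j) (\<chi> j i l \<rho>) (\<psi> l)"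
  have h: "lin_on tensor_scale tensor_scale (T j (tail Q \<rho>)) (?h l)"
      "t \<in> T j (tail Q \<rho>) \<Longrightarrow> ?h l t \<in> T i (head Q \<rho>)" "t \<notin> T j (tail Q \<rho>) \<Longrightarrow> ?h l t = 0"
    if "l \<in> {1..n j i}" for l t
    using chi_tmap(1)[OF \<rho> that] by (auto simp: hom_space_iff simp del: zero_fun_apply)
  have eq: "chi_tensor Q M \<chi> X j i \<psi> \<rho> = (\<lambda>t. \<Sum>l=1..n j i. ?h l t)"
    using \<rho> unfolding chi_tensor_def by (intro ext) (simp only: if_True sum_fun_apply)
  show ?thesis unfolding eq hom_space_iff
  proof (intro conjI allI impI subsetI)
    show "lin_on tensor_scale tensor_scale (T j (tail Q \<rho>)) (\<lambda>t. \<Sum>l=1..n j i. ?h l t)"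
      by (rule lin_on_sum[OF vector_space_tensor_scale h(1)])
    fix u assume "u \<in> (\<lambda>t. \<Sum>l=1..n j i. ?h l t) ` T j (tail Q \<rho>)"
    then obtain t where t: "u = (\<Sum>l=1..n j i. ?h l t)" "t \<in> T j (tail Q \<rho>)" by (rule imageE)
    show "u \<in> T i (head Q \<rho>)" unfolding t(1)
      by (rule tensor.subspace_sum[OF subspace_T[OF i head_in[OF \<rho>]], of "{1..n j i}" "\<lambda>l. ?h l t"])
        (rule h(2)[OF _ t(2)])
  next
    show "(\<Sum>l=1..n j i. ?h l t) = 0" if "t \<notin> T j (tail Q \<rho>)" for t
      by (rule sum.neutral, rule ballI) (rule h(3)[OF _ that])
  qed
qed

lemma chi_arc_maps: "chi_tensor Q M \<chi> X j i \<psi> \<in> arc_maps Q (N j) (N i)"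
  unfolding arc_maps_def N_simps(1,2) using chi_hom by (auto simp: chi_tensor_def)

end

end

section \<open>Reduction of morphisms to coordinates\<close>

context tensor_setting
begin

lemma crd_in: "i \<in> I \<Longrightarrow> q \<in> verts Q \<Longrightarrow> t \<in> T i q \<Longrightarrow> b \<in> B i \<Longrightarrow> crd i t b \<in> spc (M i) q"
  by (rule T_expand(2))

lemma crd_0: "i \<in> I \<Longrightarrow> q \<in> verts Q \<Longrightarrow> b \<in> B i \<Longrightarrow> crd i 0 b = 0"
  by (rule lin_on_0[OF subspace_T vector_space_tensor_scale crd_lin])

lemma crd_eq_0D:
  assumes "i \<in> I" "q \<in> verts Q" "t \<in> T i q" "\<And>b. b \<in> B i \<Longrightarrow> crd i t b = 0"
  shows "t = 0"
proof -
  have "(\<Sum>b\<in>B i. pt i (crd i t b) b) = 0"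
    using assms(4) pt_0_left[OF assms(1,2)] by (intro sum.neutral ballI) simp
  then show ?thesis using T_expand(1)[OF assms(1-3)] by simp
qed

text \<open>The structure maps of N_i leave the right factor alone, so they act on each coordinate
  as the structure maps of M_i.\<close>

lemma crd_rmap:
  assumes i: "i \<in> I" and \<rho>: "\<rho> \<in> arcs Q" and b: "b \<in> B i" and t: "t \<in> T i (tail Q \<rho>)"
  shows "crd i (rmap (N i) \<rho> t) b = rmap (M i) \<rho> (crd i t b)"
proof -
  note tl = tail_in[OF \<rho>] and hd = head_in[OF \<rho>]
  interpret Mi: vector_space "scl (M i)" by (rule is_repD(1)[OF M_rep[OF i]])
  have r0: "rmap (M i) \<rho> 0 = 0"
    by (rule lin_on_0[OF is_repD(2)[OF M_rep[OF i] tl] is_repD(1)[OF M_rep[OF i]] is_repD(5)[OF M_rep[OF i] \<rho>]])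
  have R: "lin_on tensor_scale tensor_scale (T i (tail Q \<rho>)) (rmap (N i) \<rho>)"
    "rmap (N i) \<rho> ` T i (tail Q \<rho>) \<subseteq> T i (head Q \<rho>)"
    using N_rmap(1)[OF i \<rho>] unfolding hom_space_iff by auto
  have "(\<lambda>t. crd i t b) ` T i (tail Q \<rho>) \<subseteq> spc (M i) (tail Q \<rho>)"
    using crd_in[OF i tl _ b] by blast
  from lin_on_comp[OF crd_lin[OF i tl b] is_repD(5)[OF M_rep[OF i] \<rho>] this]
  have L2: "lin_on tensor_scale (scl (M i)) (T i (tail Q \<rho>)) (\<lambda>t. rmap (M i) \<rho> (crd i t b))" .
  show ?thesis
  proof (rule T_ext[OF i tl lin_on_comp[OF R(1) crd_lin[OF i hd b] R(2)] L2 _ t])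
    fix v b' assume v: "v \<in> spc (M i) (tail Q \<rho>)" and b': "b' \<in> B i"
    show "crd i (rmap (N i) \<rho> (pt i v b')) b = rmap (M i) \<rho> (crd i (pt i v b') b)"
      unfolding N_rmap(2)[OF i \<rho> v B_in[OF i b']] crd_pt_B[OF i hd b' b] crd_pt_B[OF i tl b' b]
      using r0 by simp
  qed
qed

lemma N_lin: "pre_hom Q (N k) (N i) f \<Longrightarrow> q \<in> verts Q \<Longrightarrow> lin_on tensor_scale tensor_scale (T k q) (f q)"
  and N_in: "pre_hom Q (N k) (N i) f \<Longrightarrow> q \<in> verts Q \<Longrightarrow> t \<in> T k q \<Longrightarrow> f q t \<in> T i q"
  using pre_homD[of Q "N k" "N i" f q] unfolding N_simps by auto

context
  fixes i k f b b'
  assumes i: "i \<in> I" and k: "k \<in> I" and f: "pre_hom Q (N k) (N i) f" and b: "b \<in> B k" and b': "b' \<in> B i"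
begin

text \<open>N_k and N_i are sums of copies of M_k and M_i over the bases \<open>B k\<close> and
  \<open>B i\<close>; this family is the (b', b) entry of the resulting matrix of f.\<close>

lemma comp_pre_hom: "pre_hom Q (M k) (M i) (\<lambda>q v. crd i (f q (pt k v b)) b')"
  unfolding pre_hom_def
proof (intro conjI ballI subsetI)
  fix q assume q: "q \<in> verts Q"
  have 1: "(\<lambda>v. pt k v b) ` spc (M k) q \<subseteq> T k q" using pt_in[OF k q _ B_in[OF k b]] by blast
  have 2: "(\<lambda>v. f q (pt k v b)) ` spc (M k) q \<subseteq> T i q" using 1 N_in[OF f q] by blast
  show "lin_on (scl (M k)) (scl (M i)) (spc (M k) q) (\<lambda>v. crd i (f q (pt k v b)) b')"
    by (rule lin_on_comp[OF lin_on_comp[OF pt_lin[OF k q] N_lin[OF f q] 1] crd_lin[OF i q b'] 2])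
  fix x assume "x \<in> (\<lambda>v. crd i (f q (pt k v b)) b') ` spc (M k) q"
  then show "x \<in> spc (M i) q" using 2 crd_in[OF i q _ b'] by blast
qed

text \<open>Taking matrix entries commutes with d. This is how conditions on Hom and Ext between M_k
  and M_i become available for N_k and N_i.\<close>

lemma comp_defect:
  assumes \<rho>: "\<rho> \<in> arcs Q" and v: "v \<in> spc (M k) (tail Q \<rho>)"
  shows "defect Q (M k) (M i) (\<lambda>q v. crd i (f q (pt k v b)) b') \<rho> v = crd i (defect Q (N k) (N i) f \<rho> (pt k v b)) b'"
proof -
  note tl = tail_in[OF \<rho>] and hd = head_in[OF \<rho>]
  have 1: "pt k v b \<in> T k (tail Q \<rho>)" by (rule pt_in[OF k tl v B_in[OF k b]])
  have 2: "pt k (rmap (M k) \<rho> v) b \<in> T k (head Q \<rho>)"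
    by (rule pt_in[OF k hd is_repD(6)[OF M_rep[OF k] \<rho> v] B_in[OF k b]])
  have 3: "rmap (N i) \<rho> (f (tail Q \<rho>) (pt k v b)) \<in> T i (head Q \<rho>)"
    using N_rmap(1)[OF i \<rho>] N_in[OF f tl 1] unfolding hom_space_iff by blast
  show ?thesis
    unfolding defect_def crd_rmap[OF i \<rho> b' N_in[OF f tl 1], symmetric] N_rmap(2)[OF k \<rho> v B_in[OF k b]]
    by (rule lin_on_diff_arg[OF subspace_T[OF i hd] vector_space_tensor_scale crd_lin[OF i hd b'] 3 N_in[OF f hd 2], symmetric])
qed

lemma comp_rep_hom:
  assumes "rep_hom Q (N k) (N i) f"
  shows "rep_hom Q (M k) (M i) (\<lambda>q v. crd i (f q (pt k v b)) b')"
  unfolding rep_hom_def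
proof (intro conjI ballI comp_pre_hom)
  fix \<rho> v assume \<rho>: "\<rho> \<in> arcs Q" and v: "v \<in> spc (M k) (tail Q \<rho>)"
  have "pt k v b \<in> T k (tail Q \<rho>)" by (rule pt_in[OF k tail_in[OF \<rho>] v B_in[OF k b]])
  then have "defect Q (N k) (N i) f \<rho> (pt k v b) = 0"
    using assms \<rho> unfolding rep_hom_def N_simps by blast
  then show "defect Q (M k) (M i) (\<lambda>q v. crd i (f q (pt k v b)) b') \<rho> v = 0"
    unfolding comp_defect[OF \<rho> v] by (simp only: crd_0[OF i head_in[OF \<rho>] b'])
qed

end

section \<open>Morphisms and coboundaries between the representations N_i\<close>

lemma N_hom_eq_0:
  assumes i: "i \<in> I" and k: "k \<in> I" and Hom: "Hom_Q Q (M k) (M i) = {0}"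
    and f: "rep_hom Q (N k) (N i) f" and q: "q \<in> verts Q" and t: "t \<in> T k q"
  shows "f q t = 0"
proof -
  note pre = rep_homD(1)[OF f]
  have "f q (pt k v b) = 0" if v: "v \<in> spc (M k) q" and b: "b \<in> B k" for v b
  proof (rule crd_eq_0D[OF i q N_in[OF pre q pt_in[OF k q v B_in[OF k b]]]])
    fix b' assume "b' \<in> B i"
    from rep_pair.rep_hom_eq_0[OF M_pair[OF k i] Hom comp_rep_hom[OF i k pre b this f] q v]
    show "crd i (f q (pt k v b)) b' = 0" .
  qed
  from T_ext[OF k q N_lin[OF pre q] lin_on_zero(1)[OF vector_space_tensor_scale] this t]
  show ?thesis .
qed

lemma X_hom_ext_0:
  assumes k: "k \<in> I" and g: "g \<in> X_hom k i" "\<And>b. b \<in> B k \<Longrightarrow> g b = 0" and w: "w \<in> spc X k"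
  shows "g w = 0"
proof -
  have lin: "lin_on (scl X) (scl X) (spc X k) g" using g(1) by (simp add: hom_space_iff)
  have w_eq: "(\<Sum>b\<in>B k. scl X (Xs.representation (B k) w b) b) = w"
    using w B[OF k] by (intro Xs.sum_representation_eq) auto
  have "g (\<Sum>b\<in>B k. scl X (Xs.representation (B k) w b) b) = (\<Sum>b\<in>B k. g (scl X (Xs.representation (B k) w b) b))"
    by (rule lin_on_sum_arg[OF X_sub[OF k] X_vs lin]) (use B_in[OF k] Xs.subspace_scale[OF X_sub[OF k]] in blast)
  also have "\<dots> = 0"
    using lin B_in[OF k] by (intro sum.neutral ballI) (simp add: lin_on_def g(2))
  finally show ?thesis unfolding w_eq .
qed

text \<open>Every matrix entry of f is an endomorphism of M_i, hence a scalar. The matrix of these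
  scalars defines g, which amounts to End(M_i tensor X_{m_i}) = id tensor End(X_{m_i}).\<close>

lemma N_end_scalar:
  assumes i: "i \<in> I" and End: "Hom_Q Q (M i) (M i) = range (scalar_endo Q (M i))"
    and f: "rep_hom Q (N i) (N i) f"
  obtains g where "g \<in> X_hom i i"
    "\<And>q v w. q \<in> verts Q \<Longrightarrow> v \<in> spc (M i) q \<Longrightarrow> w \<in> spc X i \<Longrightarrow> f q (pt i v w) = pt i v (g w)"
proof -
  note pre = rep_homD(1)[OF f]
  have "\<exists>c. \<forall>q\<in>verts Q. \<forall>v\<in>spc (M i) q. crd i (f q (pt i v b)) b' = scl (M i) c v"
    if b: "b \<in> B i" and b': "b' \<in> B i" for b b'
  proof -
    let ?h = "\<lambda>q v. crd i (f q (pt i v b)) b'"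
    have "restr Q (M i) ?h \<in> range (scalar_endo Q (M i))"
      using rep_pair.rep_hom_restr[OF M_pair[OF i i] comp_rep_hom[OF i i pre b b' f]] unfolding End .
    then obtain c where c: "restr Q (M i) ?h = scalar_endo Q (M i) c" by blast
    have "?h q v = scl (M i) c v" if "q \<in> verts Q" "v \<in> spc (M i) q" for q v
      using fun_cong[OF fun_cong[OF c, of q], of v] that by (simp add: restr_def scalar_endo_def)
    then show ?thesis by blast
  qed
  then obtain c where c: "\<And>b b' q v. b \<in> B i \<Longrightarrow> b' \<in> B i \<Longrightarrow> q \<in> verts Q \<Longrightarrow> v \<in> spc (M i) q \<Longrightarrow>
      crd i (f q (pt i v b)) b' = scl (M i) (c b b') v" by metis
  interpret XX: vector_space_pair "scl X" "scl X" by (intro vector_space_pair.intro X_vs)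
  \<comment> \<open>g is the linear map with matrix \<open>c\<close> in the basis
    \<open>B i\<close>, extended to the ambient space; outside \<open>spc X i\<close> it is replaced
    by 0 below.\<close>
  obtain g where g: "Vector_Spaces.linear (scl X) (scl X) g"
    "\<forall>b\<in>B i. g b = (\<Sum>b'\<in>B i. scl X (c b b') b')"
    using XX.linear_independent_extend[OF B(2)[OF i], of "\<lambda>b. \<Sum>b'\<in>B i. scl X (c b b') b'"] by blast
  have gB: "g b \<in> spc X i" if "b \<in> B i" for b
    using g(2) that Xs.subspace_scale[OF X_sub[OF i]] B_in[OF i]
    by (auto intro!: Xs.subspace_sum[OF X_sub[OF i]])
  have glin: "lin_on (scl X) (scl X) (spc X i) g"
    using g(1) by (simp add: lin_on_def Vector_Spaces.linear_iff)
  have g_sum: "g w = (\<Sum>b\<in>B i. scl X (Xs.representation (B i) w b) (g b))" if w: "w \<in> spc X i" for w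
  proof -
    have w_eq: "(\<Sum>b\<in>B i. scl X (Xs.representation (B i) w b) b) = w"
      using w B[OF i] by (intro Xs.sum_representation_eq) auto
    have "g (\<Sum>b\<in>B i. scl X (Xs.representation (B i) w b) b) = (\<Sum>b\<in>B i. g (scl X (Xs.representation (B i) w b) b))"
      by (rule lin_on_sum_arg[OF X_sub[OF i] X_vs glin]) (use B_in[OF i] Xs.subspace_scale[OF X_sub[OF i]] in blast)
    then show ?thesis using g(1) unfolding w_eq by (simp add: Vector_Spaces.linear_iff)
  qed
  have g_in: "g w \<in> spc X i" if w: "w \<in> spc X i" for w
    unfolding g_sum[OF w] using gB Xs.subspace_scale[OF X_sub[OF i]]
    by (intro Xs.subspace_sum[OF X_sub[OF i]]) blast
  let ?g = "\<lambda>w. if w \<in> spc X i then g w else 0"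
  show thesis
  proof
    show "?g \<in> X_hom i i"
      using glin g_in Xs.subspace_add[OF X_sub[OF i]] Xs.subspace_scale[OF X_sub[OF i]]
      unfolding hom_space_iff lin_on_def by auto
    fix q v w assume q: "q \<in> verts Q" and v: "v \<in> spc (M i) q" and w: "w \<in> spc X i"
    interpret Mi: vector_space "scl (M i)" by (rule is_repD(1)[OF M_rep[OF i]])
    have fB: "f q (pt i u b) = pt i u (g b)" if u: "u \<in> spc (M i) q" and b: "b \<in> B i" for u b
    proof -
      have "f q (pt i u b) = (\<Sum>b'\<in>B i. pt i (crd i (f q (pt i u b)) b') b')"
        by (rule T_expand(1)[OF i q N_in[OF pre q pt_in[OF i q u B_in[OF i b]]], symmetric])
      also have "\<dots> = (\<Sum>b'\<in>B i. pt i u (scl X (c b b') b'))"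
        by (rule sum.cong) (simp_all add: c[OF b _ q u] pt_scale_left[OF i q] pt_scale_right[OF i q])
      also have "\<dots> = pt i u (g b)" using g(2) b by (simp add: pt_sum_right[OF i q])
      finally show ?thesis .
    qed
    \<comment> \<open>The scalars of the expansion of w are moved to the left factor, since
      \<open>fB\<close> covers every left factor but only basis vectors on the right.\<close>
    let ?r = "\<lambda>b. scl (M i) (Xs.representation (B i) w b) v"
    have r_in: "?r b \<in> spc (M i) q" for b by (rule Mi.subspace_scale[OF is_repD(2)[OF M_rep[OF i] q] v])
    have "f q (pt i v w) = f q (\<Sum>b\<in>B i. pt i (?r b) b)" unfolding pt_expand[OF i q w, of v] ..
    also have "\<dots> = (\<Sum>b\<in>B i. f q (pt i (?r b) b))"
      by (rule lin_on_sum_arg[OF subspace_T[OF i q] vector_space_tensor_scale N_lin[OF pre q]])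
        (rule pt_in[OF i q r_in B_in[OF i]])
    also have "\<dots> = (\<Sum>b\<in>B i. pt i v (scl X (Xs.representation (B i) w b) (g b)))"
      by (rule sum.cong[OF refl], rule trans[OF fB[OF r_in]])
        (simp_all add: pt_scale_left[OF i q] pt_scale_right[OF i q])
    also have "\<dots> = pt i v (g w)" unfolding g_sum[OF w] pt_sum_right[OF i q] ..
    finally show "f q (pt i v w) = pt i v (?g w)" using w by simp
  qed
qed

text \<open>With a basis of one element, the map sending v to v tensor b identifies M_i with N_i,
  and f corresponds to its single matrix entry, an idempotent endomorphism of the indecomposable
  M_i.\<close>

lemma N_idempotent:
  assumes i: "i \<in> I" and b: "B i = {b}" and ind: "indecomposable Q (M i)"
    and f: "rep_hom Q (N i) (N i) f"
    and idem: "\<And>q t. q \<in> verts Q \<Longrightarrow> t \<in> T i q \<Longrightarrow> f q (f q t) = f q t"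
  shows "(\<forall>q\<in>verts Q. \<forall>t\<in>T i q. f q t = 0) \<or> (\<forall>q\<in>verts Q. \<forall>t\<in>T i q. f q t = t)"
proof -
  note pre = rep_homD(1)[OF f]
  have bB: "b \<in> B i" using b by simp
  let ?h = "\<lambda>q v. crd i (f q (pt i v b)) b"
  have hom: "rep_hom Q (M i) (M i) ?h" by (rule comp_rep_hom[OF i i pre bB bB f])
  have in_T: "pt i v b \<in> T i q" if "q \<in> verts Q" "v \<in> spc (M i) q" for q v
    by (rule pt_in[OF i that B_in[OF i bB]])
  have f_eq: "f q (pt i v b) = pt i (?h q v) b" if q: "q \<in> verts Q" and v: "v \<in> spc (M i) q" for q v
    using T_expand(1)[OF i q N_in[OF pre q in_T[OF q v]]] unfolding b by simp
  have h_in: "?h q v \<in> spc (M i) q" if "q \<in> verts Q" "v \<in> spc (M i) q" for q v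
    using pre_homD(2)[OF rep_homD(1)[OF hom] that] .
  have hh: "?h q (?h q v) = ?h q v" if q: "q \<in> verts Q" and v: "v \<in> spc (M i) q" for q v
  proof -
    obtain u where u: "u = ?h q v" by blast
    note A = f_eq[OF q v, folded u]
    have "f q (pt i u b) = pt i u b" using idem[OF q in_T[OF q v]] unfolding A .
    then show ?thesis unfolding u[symmetric] using crd_pt_B[OF i q bB bB, of u] by simp
  qed
  have "(\<forall>q\<in>verts Q. \<forall>v\<in>spc (M i) q. ?h q v = 0) \<or> (\<forall>q\<in>verts Q. \<forall>v\<in>spc (M i) q. ?h q v = v)"
    by (rule indecomposable_idempotent[OF ind wf hom]) (rule hh)
  then show ?thesis
  proof (elim disjE)
    assume z: "\<forall>q\<in>verts Q. \<forall>v\<in>spc (M i) q. ?h q v = 0"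
    have "f q t = 0" if q: "q \<in> verts Q" and t: "t \<in> T i q" for q t
    proof -
      have "f q (pt i v b') = 0" if "v \<in> spc (M i) q" "b' \<in> B i" for v b'
      proof -
        have "b' = b" "?h q v = 0" using that b z q by auto
        with f_eq[OF q that(1)] pt_0_left[OF i q] show ?thesis by metis
      qed
      from T_ext[OF i q N_lin[OF pre q] lin_on_zero(1)[OF vector_space_tensor_scale] this t]
      show ?thesis .
    qed
    then show ?thesis by blast
  next
    assume id: "\<forall>q\<in>verts Q. \<forall>v\<in>spc (M i) q. ?h q v = v"
    have "f q t = t" if q: "q \<in> verts Q" and t: "t \<in> T i q" for q t
    proof -
      have "f q (pt i v b') = pt i v b'" if "v \<in> spc (M i) q" "b' \<in> B i" for v b'
      proof -
        have "b' = b" "?h q v = v" using that b id q by auto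
        with f_eq[OF q that(1)] show ?thesis by metis
      qed
      from T_ext[OF i q N_lin[OF pre q] lin_on_id this t]
      show ?thesis .
    qed
    then show ?thesis by blast
  qed
qed

text \<open>At v tensor b, the coordinate b' of the hypothesis says that a combination of the
  \<open>\<chi> k i l\<close>, with the b'-coordinates of \<open>\<psi> l b\<close> as coefficients,
  is a coboundary from M_k to M_i. These coefficients are 0 by linear independence of the
  classes.\<close>

lemma chi_inj:
  assumes i: "i \<in> I" and k: "k \<in> I" and ik: "i \<noteq> k"
    and \<psi>: "\<And>l. l \<in> {1..n k i} \<Longrightarrow> \<psi> l \<in> X_hom k i"
    and f: "pre_hom Q (N k) (N i) f"
    and eq: "\<And>\<rho> t. \<rho> \<in> arcs Q \<Longrightarrow> t \<in> T k (tail Q \<rho>) \<Longrightarrow>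
      defect Q (N k) (N i) f \<rho> t = chi_tensor Q M \<chi> X k i \<psi> \<rho> t"
    and l: "l \<in> {1..n k i}" and w: "w \<in> spc X k"
  shows "\<psi> l w = 0"
proof (rule X_hom_ext_0[OF k \<psi>[OF l] _ w])
  fix b assume b: "b \<in> B k"
  note bX = B_in[OF k b]
  have \<psi>b: "\<psi> l b \<in> spc X i" if "l \<in> {1..n k i}" for l using \<psi>[OF that] bX by (auto simp: hom_space_iff)
  have rep0: "Xs.representation (B i) (\<psi> l b) b' = 0" if b': "b' \<in> B i" for b'
  proof (rule rep_pair.ext_basis_coeff_0[OF M_pair[OF k i] chi[OF k i ik[symmetric]] comp_pre_hom[OF i k f b b'] _ l])
    fix \<rho> v assume \<rho>: "\<rho> \<in> arcs Q" and v: "v \<in> spc (M k) (tail Q \<rho>)"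
    note hd = head_in[OF \<rho>]
    have c: "\<chi> k i l \<rho> v \<in> spc (M i) (head Q \<rho>)" if "l \<in> {1..n k i}" for l
      by (rule chi_in[OF i k ik \<psi> that \<rho> v])
    have "crd i (defect Q (N k) (N i) f \<rho> (pt k v b)) b'
        = crd i (\<Sum>l=1..n k i. pt i (\<chi> k i l \<rho> v) (\<psi> l b)) b'"
      unfolding eq[OF \<rho> pt_in[OF k tail_in[OF \<rho>] v bX]] by (subst chi_pt[OF i k ik \<psi> \<rho> v bX]) simp_all
    also have "\<dots> = (\<Sum>l=1..n k i. crd i (pt i (\<chi> k i l \<rho> v) (\<psi> l b)) b')"
      by (rule lin_on_sum_arg[OF subspace_T[OF i hd] vector_space_tensor_scale crd_lin[OF i hd b']])
        (rule pt_in[OF i hd c \<psi>b])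
    also have "\<dots> = (\<Sum>l=1..n k i. scl (M i) (Xs.representation (B i) (\<psi> l b) b') (\<chi> k i l \<rho> v))"
      by (rule sum.cong) (simp_all only: crd_pt[OF i hd \<psi>b b'])
    finally show "defect Q (M k) (M i) (\<lambda>q v. crd i (f q (pt k v b)) b') \<rho> v =
        (\<Sum>l=1..n k i. scl (M i) (Xs.representation (B i) (\<psi> l b) b') (\<chi> k i l \<rho> v))"
      unfolding comp_defect[OF i k f b b' \<rho> v] .
  qed
  have "\<psi> l b = (\<Sum>b'\<in>B i. scl X (Xs.representation (B i) (\<psi> l b) b') b')"
    using \<psi>b[OF l] B[OF i] by (intro Xs.sum_representation_eq[symmetric]) auto
  also have "\<dots> = 0" using rep0 by (intro sum.neutral ballI) simp
  finally show "\<psi> l b = 0" .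
qed

end

section \<open>The representation F_M X and the blocks of its endomorphisms\<close>

text \<open>The inclusion of the k-th summand; the block e_ij is read off as component i of the
  values of e on \<open>single j\<close>.\<close>

definition single :: "nat \<Rightarrow> 'x \<Rightarrow> nat \<Rightarrow> 'x::zero" where
  "single k t = (\<lambda>i. if i = k then t else 0)"

lemma sum_single:
  assumes "finite I" "\<And>i. i \<notin> I \<Longrightarrow> t i = 0"
  shows "(\<Sum>k\<in>I. single k (t k)) = (t :: nat \<Rightarrow> 'x::comm_monoid_add)"
proof
  fix i
  have "(\<Sum>k\<in>I. single k (t k)) i = (\<Sum>k\<in>I. if i = k then t k else 0)"
    by (simp add: sum_fun_apply single_def cong: if_cong)
  also have "\<dots> = t i" using assms by simp
  finally show "(\<Sum>k\<in>I. single k (t k)) i = t i" .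
qed

context tensor_setting
begin

abbreviation "F \<equiv> F_rep Q r M \<chi> X"
abbreviation "Fs \<equiv> F_space r M X"
abbreviation "blk \<equiv> F_block Q M \<chi> X"
abbreviation "sclF \<equiv> (\<lambda>c (t :: nat \<Rightarrow> ('k, 'v, 'w) tensor) i. tensor_scale c (t i))"

lemma F_simps: "scl F = sclF" "spc F = Fs"
  "t \<in> Fs (tail Q \<rho>) \<Longrightarrow> rmap F \<rho> t = (\<lambda>i. if i \<in> I then \<Sum>j=1..r. blk \<rho> i j (t j) else 0)"
  "t \<notin> Fs (tail Q \<rho>) \<Longrightarrow> rmap F \<rho> t = 0"
  by (simp_all add: F_rep_def)

lemma sclF_vs: "vector_space sclF"
  by unfold_locales (auto simp: tensor_scale_def fun_eq_iff algebra_simps)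

sublocale Fv: vector_space sclF
  by (rule sclF_vs)

lemma Fs_D: "t \<in> Fs q \<Longrightarrow> i \<in> I \<Longrightarrow> t i \<in> T i q" "t \<in> Fs q \<Longrightarrow> i \<notin> I \<Longrightarrow> t i = 0"
  unfolding F_space_def by blast+

lemma Fs_I: "(\<And>i. i \<in> I \<Longrightarrow> t i \<in> T i q) \<Longrightarrow> (\<And>i. i \<notin> I \<Longrightarrow> t i = 0) \<Longrightarrow> t \<in> Fs q"
  unfolding F_space_def by blast

lemma Fs_sub:
  assumes q: "q \<in> verts Q"
  shows "Fv.subspace (Fs q)"
  unfolding Fv.subspace_def
proof (intro conjI ballI allI)
  show "0 \<in> Fs q"
    by (rule Fs_I) (simp_all only: zero_fun_apply tensor.subspace_0[OF subspace_T[OF _ q]])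
  fix x y c assume x: "x \<in> Fs q"
  show "sclF c x \<in> Fs q"
  proof (rule Fs_I)
    show "sclF c x i \<in> T i q" if "i \<in> I" for i
      by (rule tensor.subspace_scale[OF subspace_T[OF that q] Fs_D(1)[OF x that]])
    show "sclF c x i = 0" if "i \<notin> I" for i
      unfolding Fs_D(2)[OF x that] by (rule tensor.scale_zero_right)
  qed
  assume y: "y \<in> Fs q"
  show "x + y \<in> Fs q"
  proof (rule Fs_I)
    show "(x + y) i \<in> T i q" if "i \<in> I" for i
      unfolding plus_fun_apply[of x y]
      by (rule tensor.subspace_add[OF subspace_T[OF that q] Fs_D(1)[OF x that] Fs_D(1)[OF y that]])
    show "(x + y) i = 0" if "i \<notin> I" for i
      unfolding plus_fun_apply[of x y] Fs_D(2)[OF x that] Fs_D(2)[OF y that] by (rule add_0)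
  qed
qed

lemma single_in:
  assumes "k \<in> I" "q \<in> verts Q" "t \<in> T k q"
  shows "single k t \<in> Fs q"
proof (rule Fs_I)
  fix i assume "i \<in> I"
  then show "single k t i \<in> T i q"
    using assms tensor.subspace_0[OF subspace_T[OF _ assms(2)]] unfolding single_def by (cases "i = k") simp_all
next
  fix i assume "i \<notin> I"
  with assms(1) have "i \<noteq> k" by metis
  then show "single k t i = 0" by (simp only: single_def if_False)
qed

lemma single_lin: "lin_on tensor_scale sclF U (single k)"
proof -
  have "single k (x + y) = single k x + single k y" "single k (tensor_scale c x) = sclF c (single k x)"
    for x y :: "('k, 'v, 'w) tensor" and c
    by (intro ext; simp add: single_def tensor.scale_zero_right[unfolded zero_fun_def])+
  then show ?thesis by (simp add: lin_on_def)
qed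

lemma component_lin: "lin_on sclF tensor_scale U (\<lambda>t. t i)"
  by (simp add: lin_on_def)

lemma Fs_sum_single: "t \<in> Fs q \<Longrightarrow> (\<Sum>k\<in>I. single k (t k)) = t"
  by (rule sum_single[OF finite_atLeastAtMost Fs_D(2)])

section \<open>The structure maps of F_M X as block matrices\<close>

lemma blk_hom:
  assumes i: "i \<in> I" and j: "j \<in> I" and \<rho>: "\<rho> \<in> arcs Q"
  shows "lin_on tensor_scale tensor_scale (T j (tail Q \<rho>)) (blk \<rho> i j)"
    "t \<in> T j (tail Q \<rho>) \<Longrightarrow> blk \<rho> i j t \<in> T i (head Q \<rho>)"
proof -
  have "blk \<rho> i j \<in> hom_space tensor_scale tensor_scale (T j (tail Q \<rho>)) (T i (head Q \<rho>))"
  proof (cases "i = j")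
    case True
    show ?thesis unfolding True[symmetric] F_block_def if_P[OF refl] by (rule N_rmap(1)[OF i \<rho>])
  next
    case False
    show ?thesis unfolding F_block_def if_not_P[OF False]
      by (rule chi_hom[OF i j False _ \<rho>]) (rule X_rmap[OF i j False])
  qed
  then show "lin_on tensor_scale tensor_scale (T j (tail Q \<rho>)) (blk \<rho> i j)"
    "t \<in> T j (tail Q \<rho>) \<Longrightarrow> blk \<rho> i j t \<in> T i (head Q \<rho>)"
    unfolding hom_space_iff by blast+
qed

lemma blk_0: "i \<in> I \<Longrightarrow> j \<in> I \<Longrightarrow> \<rho> \<in> arcs Q \<Longrightarrow> blk \<rho> i j 0 = 0"
  by (rule lin_on_0[OF subspace_T vector_space_tensor_scale blk_hom(1)]) (auto simp: tail_in)

lemma blk_offdiag: "i \<noteq> j \<Longrightarrow> blk \<rho> i j = chi_tensor Q M \<chi> X j i (\<lambda>l. rmap X (j, i, l)) \<rho>"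
  by (simp add: F_block_def)

lemma blk_diag: "blk \<rho> i i = rmap (N i) \<rho>"
  by (simp add: F_block_def)

lemma blk_n_0: "i \<noteq> j \<Longrightarrow> n j i = 0 \<Longrightarrow> blk \<rho> i j t = 0"
  by (simp add: F_block_def chi_tensor_def)

lemma F_rmap_hom:
  assumes \<rho>: "\<rho> \<in> arcs Q"
  shows "lin_on sclF sclF (Fs (tail Q \<rho>)) (rmap F \<rho>)"
    and "t \<in> Fs (tail Q \<rho>) \<Longrightarrow> rmap F \<rho> t \<in> Fs (head Q \<rho>)"
proof -
  note sub = Fs_sub[OF tail_in[OF \<rho>]]
  have L: "lin_on sclF tensor_scale (Fs (tail Q \<rho>)) (\<lambda>t. \<Sum>j=1..r. blk \<rho> i j (t j))" if i: "i \<in> I" for i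
  proof (rule lin_on_sum[OF vector_space_tensor_scale])
    fix j assume j: "j \<in> {1..r}"
    have "(\<lambda>t. t j) ` Fs (tail Q \<rho>) \<subseteq> T j (tail Q \<rho>)" using Fs_D(1)[OF _ j] by blast
    from lin_on_comp[OF component_lin blk_hom(1)[OF i j \<rho>] this]
    show "lin_on sclF tensor_scale (Fs (tail Q \<rho>)) (\<lambda>t. blk \<rho> i j (t j))" .
  qed
  show "lin_on sclF sclF (Fs (tail Q \<rho>)) (rmap F \<rho>)"
    unfolding lin_on_def
  proof (intro conjI ballI allI)
    fix x y c assume x: "x \<in> Fs (tail Q \<rho>)"
    show "rmap F \<rho> (sclF c x) = sclF c (rmap F \<rho> x)"
    proof
      fix i
      show "rmap F \<rho> (sclF c x) i = sclF c (rmap F \<rho> x) i"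
        unfolding F_simps(3)[OF x] F_simps(3)[OF Fv.subspace_scale[OF sub x]]
        using L[of i] x unfolding lin_on_def by (cases "i \<in> I") (simp_all only: if_True if_False tensor.scale_zero_right)
    qed
    assume y: "y \<in> Fs (tail Q \<rho>)"
    show "rmap F \<rho> (x + y) = rmap F \<rho> x + rmap F \<rho> y"
    proof
      fix i
      show "rmap F \<rho> (x + y) i = (rmap F \<rho> x + rmap F \<rho> y) i"
        unfolding plus_fun_apply[of "rmap F \<rho> x" "rmap F \<rho> y" i] F_simps(3)[OF x] F_simps(3)[OF y] F_simps(3)[OF Fv.subspace_add[OF sub x y]]
        using L[of i] x y unfolding lin_on_def
        by (cases "i \<in> I") (simp_all only: if_True if_False add_0 plus_fun_apply[of "\<lambda>i. if i \<in> I then f i else g" for f g])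
    qed
  qed
  show "rmap F \<rho> t \<in> Fs (head Q \<rho>)" if t: "t \<in> Fs (tail Q \<rho>)"
    unfolding F_simps(3)[OF t]
  proof (rule Fs_I)
    fix i assume i: "i \<in> I"
    have "(\<Sum>j=1..r. blk \<rho> i j (t j)) \<in> T i (head Q \<rho>)"
    proof (rule tensor.subspace_sum[OF subspace_T[OF i head_in[OF \<rho>]], of "{1..r}" "\<lambda>j. blk \<rho> i j (t j)"])
      fix j assume j: "j \<in> {1..r}"
      show "blk \<rho> i j (t j) \<in> T i (head Q \<rho>)" by (rule blk_hom(2)[OF i j \<rho> Fs_D(1)[OF t j]])
    qed
    then show "(if i \<in> I then \<Sum>j=1..r. blk \<rho> i j (t j) else 0) \<in> T i (head Q \<rho>)"
      using i by (simp only: if_True)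
  qed (simp only: if_False)
qed

lemma Fs_fin_dim:
  assumes q: "q \<in> verts Q"
  shows "fin_dim_subspace sclF (Fs q)"
proof -
  have "\<exists>A. finite A \<and> tensor.span A = T k q" if "k \<in> I" for k
    using T_fin_dim[OF that q is_repD(3)[OF M_rep[OF that] q]] unfolding fin_dim_subspace_def .
  then have "\<forall>k\<in>I. \<exists>A. finite A \<and> tensor.span A = T k q" by (rule ballI)
  from bchoice[OF this] obtain A where A: "\<forall>k\<in>I. finite (A k) \<and> tensor.span (A k) = T k q" ..
  define P where "P = (\<Union>k\<in>I. single k ` A k)"
  have "finite P" unfolding P_def using A by simp
  moreover have "Fv.span P = Fs q"
  proof
    show "Fv.span P \<subseteq> Fs q"
    proof (rule Fv.span_minimal[OF _ Fs_sub[OF q]], rule subsetI)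
      fix x assume "x \<in> P"
      then obtain k a where k: "k \<in> I" and a: "a \<in> A k" and x: "x = single k a" unfolding P_def by blast
      have "a \<in> T k q" using tensor.span_base[OF a] A k by simp
      then show "x \<in> Fs q" unfolding x by (rule single_in[OF k q])
    qed
    show "Fs q \<subseteq> Fv.span P"
    proof
      fix t assume t: "t \<in> Fs q"
      have "single k s \<in> Fv.span P" if k: "k \<in> I" and s: "s \<in> T k q" for k s
      proof -
        have "s \<in> tensor.span (A k)" using A k s by simp
        then show ?thesis
        proof (induction s rule: tensor.span_induct_alt)
          case base
          have "single k (0 :: ('k, 'v, 'w) tensor) = 0" by (intro ext) (simp add: single_def)
          then show ?case using Fv.span_zero by (simp only:)
        next
          case (step c x y)
          have lin: "single k (tensor_scale c x + y) = sclF c (single k x) + single k y"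
            using single_lin[of UNIV k] unfolding lin_on_def by simp
          have "single k x \<in> P" using step(1) k unfolding P_def by blast
          then show ?case unfolding lin by (intro Fv.span_add Fv.span_scale Fv.span_base step)
        qed
      qed
      then have "(\<Sum>k\<in>I. single k (t k)) \<in> Fv.span P"
        by (intro Fv.span_sum) (use Fs_D(1)[OF t] in auto)
      then show "t \<in> Fv.span P" unfolding Fs_sum_single[OF t] .
    qed
  qed
  ultimately show ?thesis unfolding fin_dim_subspace_def by (intro exI[of _ P] conjI)
qed

lemma F_is_rep: "is_rep Q F"
  unfolding is_rep_def F_simps(1,2)
proof (intro conjI ballI)
  show "vector_space sclF" by (rule sclF_vs)
  show "fin_dim_subspace sclF (Fs q)" if "q \<in> verts Q" for q by (rule Fs_fin_dim[OF that])
  have "{q \<in> verts Q. Fs q \<noteq> {0}} \<subseteq> (\<Union>i\<in>I. {q \<in> verts Q. T i q \<noteq> {0}})"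
  proof
    fix q assume "q \<in> {q \<in> verts Q. Fs q \<noteq> {0}}"
    then have q: "q \<in> verts Q" and nz: "Fs q \<noteq> {0}" by auto
    have "0 \<in> Fs q" by (rule Fv.subspace_0[OF Fs_sub[OF q]])
    with nz obtain t where t: "t \<in> Fs q" "t \<noteq> 0" by (metis singletonI subsetI subset_singletonD empty_iff)
    have "\<exists>i\<in>I. t i \<noteq> 0"
    proof (rule ccontr)
      assume "\<not> (\<exists>i\<in>I. t i \<noteq> 0)"
      then have "t i = 0" for i using Fs_D(2)[OF t(1)] by (cases "i \<in> I") metis+
      then have "t = 0" by (intro ext) (simp only: zero_fun_apply)
      with t(2) show False by (rule notE)
    qed
    then obtain i where i: "i \<in> I" "t i \<noteq> 0" ..
    have "t i \<in> T i q" by (rule Fs_D(1)[OF t(1) i(1)])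
    with i have "T i q \<noteq> {0}" by (metis singletonD)
    with q i(1) show "q \<in> (\<Union>i\<in>I. {q \<in> verts Q. T i q \<noteq> {0}})" by blast
  qed
  moreover have "finite (\<Union>i\<in>I. {q \<in> verts Q. T i q \<noteq> {0}})"
  proof (rule finite_UN_I)
    show "finite {q \<in> verts Q. T i q \<noteq> {0}}" if "i \<in> I" for i
      using N_rep[OF that] unfolding is_rep_def N_simps by blast
  qed simp
  ultimately show "finite {q \<in> verts Q. Fs q \<noteq> {0}}" by (rule finite_subset)
  show "rmap F \<rho> \<in> hom_space sclF sclF (Fs (tail Q \<rho>)) (Fs (head Q \<rho>))" if "\<rho> \<in> arcs Q" for \<rho>
    unfolding hom_space_iff using F_rmap_hom[OF that] F_simps(4) by blast
qed

section \<open>Blocks of an endomorphism of F_M X\<close>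

definition entry :: "('q \<Rightarrow> (nat \<Rightarrow> ('k, 'v, 'w) tensor) \<Rightarrow> (nat \<Rightarrow> ('k, 'v, 'w) tensor))
    \<Rightarrow> nat \<Rightarrow> nat \<Rightarrow> 'q \<Rightarrow> ('k, 'v, 'w) tensor \<Rightarrow> ('k, 'v, 'w) tensor" where
  "entry e i j q s = e q (single j s) i"

context
  fixes e
  assumes e: "rep_hom Q F F e"
begin

lemma e_lin: "q \<in> verts Q \<Longrightarrow> lin_on sclF sclF (Fs q) (e q)"
  and e_in: "q \<in> verts Q \<Longrightarrow> t \<in> Fs q \<Longrightarrow> e q t \<in> Fs q"
  using pre_homD[OF rep_homD(1)[OF e], of q] unfolding F_simps by blast+

lemma entry_pre:
  assumes i: "i \<in> I" and j: "j \<in> I"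
  shows "pre_hom Q (N j) (N i) (entry e i j)"
  unfolding pre_hom_def N_simps
proof (intro conjI ballI subsetI)
  fix q assume q: "q \<in> verts Q"
  have 1: "single j ` T j q \<subseteq> Fs q" using single_in[OF j q] by blast
  show "lin_on tensor_scale tensor_scale (T j q) (entry e i j q)"
    using lin_on_comp[OF lin_on_comp[OF single_lin e_lin[OF q] 1] component_lin[of UNIV i] subset_UNIV]
    unfolding entry_def .
  fix x assume "x \<in> entry e i j q ` T j q"
  then obtain s where s: "x = entry e i j q s" "s \<in> T j q" by (rule imageE)
  show "x \<in> T i q" unfolding s(1) entry_def by (rule Fs_D(1)[OF e_in[OF q single_in[OF j q s(2)]] i])
qed

lemma entry_lin: "i \<in> I \<Longrightarrow> j \<in> I \<Longrightarrow> q \<in> verts Q \<Longrightarrow> lin_on tensor_scale tensor_scale (T j q) (entry e i j q)"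
  by (rule N_lin[OF entry_pre])

lemma entry_in: "i \<in> I \<Longrightarrow> j \<in> I \<Longrightarrow> q \<in> verts Q \<Longrightarrow> s \<in> T j q \<Longrightarrow> entry e i j q s \<in> T i q"
  by (rule N_in[OF entry_pre])

lemma entry_0: "i \<in> I \<Longrightarrow> j \<in> I \<Longrightarrow> q \<in> verts Q \<Longrightarrow> entry e i j q 0 = 0"
  by (rule lin_on_0[OF subspace_T vector_space_tensor_scale entry_lin])

lemma e_entry:
  assumes q: "q \<in> verts Q" and t: "t \<in> Fs q"
  shows "e q t i = (\<Sum>j\<in>I. entry e i j q (t j))"
proof -
  have "e q t = e q (\<Sum>j\<in>I. single j (t j))" unfolding Fs_sum_single[OF t] ..
  also have "\<dots> = (\<Sum>j\<in>I. e q (single j (t j)))"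
  proof (rule lin_on_sum_arg[OF Fs_sub[OF q] sclF_vs e_lin[OF q]])
    fix j assume j: "j \<in> I"
    show "single j (t j) \<in> Fs q" by (rule single_in[OF j q Fs_D(1)[OF t j]])
  qed
  finally have "e q t = (\<Sum>j\<in>I. e q (single j (t j)))" .
  then show ?thesis by (simp only: sum_fun_apply entry_def)
qed

text \<open>The commutation relation for the block (i, k), solved for the diagonal blocks of F_M X.\<close>

lemma entry_defect_eq:
  assumes i: "i \<in> I" and k: "k \<in> I" and \<rho>: "\<rho> \<in> arcs Q" and s: "s \<in> T k (tail Q \<rho>)"
  shows "defect Q (N k) (N i) (entry e i k) \<rho> s =
    (\<Sum>j\<in>I - {k}. entry e i j (head Q \<rho>) (blk \<rho> j k s)) - (\<Sum>j\<in>I - {i}. blk \<rho> i j (entry e j k (tail Q \<rho>) s))"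
proof -
  note tl = tail_in[OF \<rho>] and hd = head_in[OF \<rho>]
  have sin: "single k s \<in> Fs (tail Q \<rho>)" by (rule single_in[OF k tl s])
  have row: "rmap F \<rho> (single k s) j = blk \<rho> j k s" if j: "j \<in> I" for j
  proof -
    have "rmap F \<rho> (single k s) j = (\<Sum>m\<in>I. blk \<rho> j m (single k s m))"
      unfolding F_simps(3)[OF sin] using j by (simp only: if_True)
    also have "\<dots> = (\<Sum>m\<in>I. if k = m then blk \<rho> j m s else 0)"
    proof (rule sum.cong[OF refl])
      fix m assume m: "m \<in> I"
      show "blk \<rho> j m (single k s m) = (if k = m then blk \<rho> j m s else 0)"
        unfolding single_def using blk_0[OF j m \<rho>] by (cases "m = k") (simp_all only: if_True if_False refl eq_commute[of k m])
    qed
    also have "\<dots> = blk \<rho> j k s" by (subst sum.delta') (use k in simp_all)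
    finally show ?thesis .
  qed
  have L: "rmap F \<rho> (e (tail Q \<rho>) (single k s)) i = (\<Sum>j\<in>I. blk \<rho> i j (entry e j k (tail Q \<rho>) s))"
    unfolding F_simps(3)[OF e_in[OF tl sin]] entry_def using i by (simp only: if_True)
  have R: "e (head Q \<rho>) (rmap F \<rho> (single k s)) i = (\<Sum>j\<in>I. entry e i j (head Q \<rho>) (blk \<rho> j k s))"
    unfolding e_entry[OF hd F_rmap_hom(2)[OF \<rho> sin]] by (rule sum.cong[OF refl]) (simp only: row)
  have "rmap F \<rho> (e (tail Q \<rho>) (single k s)) = e (head Q \<rho>) (rmap F \<rho> (single k s))"
    using rep_homD(2)[OF e \<rho>] sin unfolding F_simps(2) by blast
  then have eq: "(\<Sum>j\<in>I. blk \<rho> i j (entry e j k (tail Q \<rho>) s)) = (\<Sum>j\<in>I. entry e i j (head Q \<rho>) (blk \<rho> j k s))"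
    using L R by metis
  have "(\<Sum>j\<in>I. blk \<rho> i j (entry e j k (tail Q \<rho>) s)) = rmap (N i) \<rho> (entry e i k (tail Q \<rho>) s)
      + (\<Sum>j\<in>I - {i}. blk \<rho> i j (entry e j k (tail Q \<rho>) s))"
    using sum.remove[OF _ i, of "\<lambda>j. blk \<rho> i j (entry e j k (tail Q \<rho>) s)"] by (simp only: blk_diag finite_atLeastAtMost)
  moreover have "(\<Sum>j\<in>I. entry e i j (head Q \<rho>) (blk \<rho> j k s)) = entry e i k (head Q \<rho>) (rmap (N k) \<rho> s)
      + (\<Sum>j\<in>I - {k}. entry e i j (head Q \<rho>) (blk \<rho> j k s))"
    using sum.remove[OF _ k, of "\<lambda>j. entry e i j (head Q \<rho>) (blk \<rho> j k s)"] by (simp only: blk_diag finite_atLeastAtMost)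
  ultimately show ?thesis using eq unfolding defect_def by (simp only: algebra_simps)
qed

end

end

section \<open>Indecomposability of F_M X\<close>

context tensor_setting
begin

lemma pt_diff_right:
  "i \<in> I \<Longrightarrow> q \<in> verts Q \<Longrightarrow> pt i v (w - w') = pt i v w - pt i v w'"
  using pt_add_right[of i q v "w - w'" w'] by (simp only: diff_add_cancel eq_diff_eq)

lemma blk_pt:
  assumes "i \<in> I" "k \<in> I" "i \<noteq> k" "\<rho> \<in> arcs Q" "v \<in> spc (M k) (tail Q \<rho>)" "w \<in> spc X k"
  shows "blk \<rho> i k (pt k v w) = (\<Sum>l=1..n k i. pt i (\<chi> k i l \<rho> v) (rmap X (k, i, l) w))"
  unfolding blk_offdiag[OF assms(3)] using X_rmap[OF assms(1-3)] assms(4-6) by (rule chi_pt[OF assms(1-3)])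

text \<open>This cancels a nonzero left factor, so that identities for id tensor g_i descend to
  g_i.\<close>

lemma pt_eq_0D:
  assumes i: "i \<in> I" and q: "q \<in> verts Q" and w: "w \<in> spc X i"
    and v: "v \<in> spc (M i) q" "v \<noteq> 0" and eq: "pt i v w = 0"
  shows "w = 0"
proof -
  interpret Mi: vector_space "scl (M i)" by (rule is_repD(1)[OF M_rep[OF i]])
  have "Xs.representation (B i) w b = 0" if b: "b \<in> B i" for b
  proof -
    have "scl (M i) (Xs.representation (B i) w b) v = 0"
      using crd_pt[OF i q w b, of v] unfolding eq crd_0[OF i q b] ..
    then show ?thesis using v(2) by simp
  qed
  then have "(\<Sum>b\<in>B i. scl X (Xs.representation (B i) w b) b) = 0" by (intro sum.neutral ballI) simp
  moreover have "(\<Sum>b\<in>B i. scl X (Xs.representation (B i) w b) b) = w"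
    using w B[OF i] by (intro Xs.sum_representation_eq) auto
  ultimately show ?thesis by metis
qed

lemma Fs_nonzero:
  assumes i: "i \<in> I" and q: "q \<in> verts Q" and "spc (M i) q \<noteq> {0}" "B i \<noteq> {}"
  shows "Fs q \<noteq> {0}"
proof
  assume F0: "Fs q = {0}"
  have "t = 0" if t: "t \<in> T i q" for t
  proof -
    have "single i t = 0" using single_in[OF i q t] unfolding F0 by (rule singletonD)
    from fun_cong[OF this, of i] show ?thesis unfolding single_def if_P[OF refl] zero_fun_apply[of i] .
  qed
  then have "T i q = {0}" using tensor.subspace_0[OF subspace_T[OF i q]] by blast
  with T_nonzero[OF i q assms(3,4)] show False by (rule notE)
qed

end

section \<open>Consequences of the hypotheses on M and X\<close>

locale theorem_setting = tensor_setting Q r M \<chi> X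
  for Q :: "('q, 'a) pre_digraph"
    and r :: nat
    and M :: "nat \<Rightarrow> ('q, 'a, 'k::field, 'v::ab_group_add) quiver_rep"
    and \<chi> :: "nat \<Rightarrow> nat \<Rightarrow> nat \<Rightarrow> 'a \<Rightarrow> 'v \<Rightarrow> 'v"
    and X :: "(nat, nat \<times> nat \<times> nat, 'k, 'w::ab_group_add) quiver_rep" +
  assumes r_pos: "1 \<le> r"
    and M_indec: "\<And>i. i \<in> {1..r} \<Longrightarrow> indecomposable Q (M i)"
    and End_k: "\<And>j. j \<in> {2..r} \<Longrightarrow> Hom_Q Q (M j) (M j) = range (scalar_endo Q (M j))"
    and Hom_zero: "\<And>i j. i \<in> {1..r} \<Longrightarrow> j \<in> {1..r} \<Longrightarrow> i < j \<Longrightarrow> Hom_Q Q (M i) (M j) = {0}"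
    and Ext_zero: "\<And>i j. i \<in> {1..r} \<Longrightarrow> j \<in> {1..r} \<Longrightarrow> i < j \<Longrightarrow>
          Ext_Q Q (M i) (M j) = {ext_class Q (M i) (M j) 0}"
    and Hom_back_zero: "\<And>i j. i \<in> {1..r} \<Longrightarrow> j \<in> {1..r} \<Longrightarrow> i < j \<Longrightarrow> i \<noteq> 1 \<Longrightarrow> j \<noteq> 1 \<Longrightarrow>
          Hom_Q Q (M j) (M i) = {0}"
    and dim_X_m1: "vector_space.dim (scl X) (spc X 1) = 1"
    and iso: "Theta_induces_iso Q r M \<chi> X"
    and X_indec: "indecomposable (QM Q r M) X"
begin

lemma I1: "1 \<in> I"
  using r_pos by simp

text \<open>Hence the arrows of Q(M) strictly decrease the index; in particular none leaves
  m_1.\<close>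

lemma n_eq_0: "i \<in> I \<Longrightarrow> j \<in> I \<Longrightarrow> j < i \<Longrightarrow> n j i = 0"
  by (rule rep_pair.ext_dim_0[OF M_pair chi Ext_zero]) auto

lemma blk_upper: "i \<in> I \<Longrightarrow> j \<in> I \<Longrightarrow> j < i \<Longrightarrow> blk \<rho> i j t = 0"
  by (rule blk_n_0) (simp_all add: n_eq_0)

lemma B1: obtains b where "B 1 = {b}"
proof -
  have "card (B 1) = 1"
    using dim_X_m1 Xs.dim_eq_card_independent[OF B(2)[OF I1]] Xs.dim_span[of "B 1"]
    unfolding B(3)[OF I1] by metis
  then show thesis using that by (rule card_1_singletonE)
qed

lemma M_nonzero:
  assumes "i \<in> I"
  obtains q v where "q \<in> verts Q" "v \<in> spc (M i) q" "v \<noteq> 0"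
proof -
  obtain q where q: "q \<in> verts Q" "spc (M i) q \<noteq> {0}"
    using M_indec[OF assms] unfolding indecomposable_def by blast
  moreover have "0 \<in> spc (M i) q" by (rule is_repD(8)[OF M_rep[OF assms] q(1)])
  ultimately show thesis using that by blast
qed

text \<open>These are the right factors that arise when a block of F_M X is composed with id tensor
  g_k. For i = 1 they are the coefficients of the glued cocycle.\<close>

definition X_after :: "(nat \<Rightarrow> 'w \<Rightarrow> 'w) \<Rightarrow> nat \<Rightarrow> nat \<Rightarrow> nat \<Rightarrow> 'w \<Rightarrow> 'w" where
  "X_after g k i l = (\<lambda>w. if w \<in> spc X k then rmap X (k, i, l) (g k w) else 0)"

lemma X_after_hom:
  assumes "i \<in> I" "k \<in> I" "i \<noteq> k" "l \<in> {1..n k i}" "g k \<in> X_hom k k"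
  shows "X_after g k i l \<in> X_hom k i"
  unfolding X_after_def
proof (rule hom_space_restrictI[OF X_sub[OF assms(2)] X_vs])
  have g: "lin_on (scl X) (scl X) (spc X k) (g k)" "g k ` spc X k \<subseteq> spc X k"
    and R: "lin_on (scl X) (scl X) (spc X k) (rmap X (k, i, l))" "rmap X (k, i, l) ` spc X k \<subseteq> spc X i"
    using assms(5) X_rmap[OF assms(1-4)] unfolding hom_space_iff by blast+
  show "lin_on (scl X) (scl X) (spc X k) (\<lambda>w. rmap X (k, i, l) (g k w))"
    by (rule lin_on_comp[OF g(1) R(1) g(2)])
  show "rmap X (k, i, l) (g k w) \<in> spc X i" if "w \<in> spc X k" for w
    using that g(2) R(2) by blast
qed

section \<open>Triangular shape of endomorphisms of F_M X\<close>

context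
  fixes e
  assumes e: "rep_hom Q F F e"
begin

text \<open>In the relation for the block (i, k), each term contains either a structure map below
  the diagonal, which is 0, or a block e_ij with j < k or e_jk with j > i, which lies farther from
  the diagonal and is 0 by induction. So e_ik is a morphism from N_k to N_i.\<close>

lemma entry_lower:
  assumes "i \<in> I" "k \<in> I" "k < i" "q \<in> verts Q" "s \<in> T k q"
  shows "entry e i k q s = 0"
  using assms
\<comment> \<open>Here 0 < i - k < r, so subtraction of natural numbers loses nothing.\<close>
proof (induction "r - (i - k)" arbitrary: i k q s rule: less_induct)
  case (less i k)
  note i = less.prems(1) and k = less.prems(2) and ki = less.prems(3)
  have "rep_hom Q (N k) (N i) (entry e i k)"
    unfolding rep_hom_def N_simps(2)
  proof (intro conjI ballI entry_pre[OF e i k])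
    fix \<rho> s assume \<rho>: "\<rho> \<in> arcs Q" and s: "s \<in> T k (tail Q \<rho>)"
    note tl = tail_in[OF \<rho>] and hd = head_in[OF \<rho>]
    have "entry e i j (head Q \<rho>) (blk \<rho> j k s) = 0" if j: "j \<in> I - {k}" for j
    proof (cases "k < j")
      case True
      then show ?thesis using blk_upper[of j k \<rho> s] j k entry_0[OF e i _ hd, of j] by simp
    next
      case False
      then have "j < k" "j \<in> I" using j by auto
      then show ?thesis using ki i
        by (intro less.hyps[of i j] blk_hom(2)[OF _ k \<rho> s] hd) auto
    qed
    moreover have "blk \<rho> i j (entry e j k (tail Q \<rho>) s) = 0" if j: "j \<in> I - {i}" for j
    proof (cases "j < i")
      case True
      then show ?thesis using blk_upper[of i j \<rho>] j i by simp
    next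
      case False
      then have ji: "i < j" "j \<in> I" using j by auto
      then have "entry e j k (tail Q \<rho>) s = 0" using ki k
        by (intro less.hyps[of j k] s tl) auto
      then show ?thesis using blk_0[OF i ji(2) \<rho>] by (simp only:)
    qed
    ultimately show "defect Q (N k) (N i) (entry e i k) \<rho> s = 0"
      unfolding entry_defect_eq[OF e i k \<rho> s] by (simp only: sum.neutral_const cong: sum.cong) simp
  qed
  from N_hom_eq_0[OF i k Hom_zero[OF k i ki] this less.prems(4,5)] show ?case .
qed

text \<open>Every term on the right of the relation for (i, i) contains a block below the diagonal,
  either of e or of the structure map, so the defect of e_ii is 0.\<close>

lemma entry_diag:
  assumes i: "i \<in> I"
  shows "rep_hom Q (N i) (N i) (entry e i i)"
  unfolding rep_hom_def N_simps(2)
proof (intro conjI ballI entry_pre[OF e i i])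
  fix \<rho> s assume \<rho>: "\<rho> \<in> arcs Q" and s: "s \<in> T i (tail Q \<rho>)"
  note tl = tail_in[OF \<rho>] and hd = head_in[OF \<rho>]
  have "entry e i j (head Q \<rho>) (blk \<rho> j i s) = 0" if j: "j \<in> I - {i}" for j
  proof (cases "i < j")
    case True
    then show ?thesis using blk_upper[of j i \<rho> s] j i entry_0[OF e i _ hd, of j] by simp
  next
    case False
    then have "j < i" "j \<in> I" using j by auto
    then show ?thesis by (intro entry_lower i hd blk_hom(2)[OF _ i \<rho> s])
  qed
  moreover have "blk \<rho> i j (entry e j i (tail Q \<rho>) s) = 0" if j: "j \<in> I - {i}" for j
  proof (cases "j < i")
    case True
    then show ?thesis using blk_upper[of i j \<rho>] j i by simp
  next
    case False
    then have ji: "i < j" "j \<in> I" using j by auto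
    then have "entry e j i (tail Q \<rho>) s = 0" by (intro entry_lower i tl s)
    then show ?thesis using blk_0[OF i ji(2) \<rho>] by (simp only:)
  qed
  ultimately show "defect Q (N i) (N i) (entry e i i) \<rho> s = 0"
    unfolding entry_defect_eq[OF e i i \<rho> s] by (simp only: sum.neutral_const cong: sum.cong) simp
qed

text \<open>For triangular matrices the diagonal of a product is the product of the
  diagonals.\<close>

lemma entry_diag_idem:
  assumes idem: "\<And>q t. q \<in> verts Q \<Longrightarrow> t \<in> Fs q \<Longrightarrow> e q (e q t) = e q t"
    and i: "i \<in> I" and q: "q \<in> verts Q" and s: "s \<in> T i q"
  shows "entry e i i q (entry e i i q s) = entry e i i q s"
proof -
  note sin = single_in[OF i q s]
  have "entry e i i q s = e q (e q (single i s)) i" unfolding idem[OF q sin] entry_def ..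
  also have "\<dots> = (\<Sum>j\<in>I. entry e i j q (entry e j i q s))"
    unfolding e_entry[OF e q e_in[OF e q sin]] entry_def ..
  also have "\<dots> = (\<Sum>j\<in>I. if i = j then entry e i j q (entry e j i q s) else 0)"
  proof (rule sum.cong[OF refl])
    fix j assume j: "j \<in> I"
    show "entry e i j q (entry e j i q s) = (if i = j then entry e i j q (entry e j i q s) else 0)"
    proof (cases i j rule: linorder_cases)
      case less
      then have "entry e j i q s = 0" by (intro entry_lower j i q s)
      then show ?thesis using less entry_0[OF e i j q] by simp
    next
      case greater
      then have "entry e i j q (entry e j i q s) = 0" by (intro entry_lower j i q entry_in[OF e] s)
      then show ?thesis using greater by simp
    qed simp
  qed
  also have "\<dots> = entry e i i q (entry e i i q s)" by (subst sum.delta') (use i in simp_all)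
  finally show ?thesis ..
qed

section \<open>The rows below the first, for diagonal blocks id tensor g_i\<close>

context
  fixes g
  assumes g: "\<And>i. i \<in> {2..r} \<Longrightarrow> g i \<in> X_hom i i"
    and g_eq: "\<And>i q v w. i \<in> {2..r} \<Longrightarrow> q \<in> verts Q \<Longrightarrow> v \<in> spc (M i) q \<Longrightarrow> w \<in> spc X i \<Longrightarrow>
      entry e i i q (pt i v w) = pt i v (g i w)"
begin

lemma g_in: "i \<in> {2..r} \<Longrightarrow> w \<in> spc X i \<Longrightarrow> g i w \<in> spc X i"
  using g by (auto simp: hom_space_iff)

lemma g_lin: "i \<in> {2..r} \<Longrightarrow> lin_on (scl X) (scl X) (spc X i) (g i)"
  using g by (auto simp: hom_space_iff)

text \<open>Composing chi tensor X_chi with e_kk = id tensor g_k affects the right factor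
  only.\<close>

lemma blk_entry:
  assumes i: "i \<in> I" and k: "k \<in> {2..r}" and ik: "i \<noteq> k" and \<rho>: "\<rho> \<in> arcs Q" and s: "s \<in> T k (tail Q \<rho>)"
  shows "blk \<rho> i k (entry e k k (tail Q \<rho>) s) = chi_tensor Q M \<chi> X k i (X_after g k i) \<rho> s"
proof -
  note tl = tail_in[OF \<rho>]
  have kI: "k \<in> I" using k by simp
  have \<psi>: "\<And>l. l \<in> {1..n k i} \<Longrightarrow> X_after g k i l \<in> X_hom k i"
    by (rule X_after_hom[where g = g, OF i kI ik _ g[OF k]])
  have into: "entry e k k (tail Q \<rho>) ` T k (tail Q \<rho>) \<subseteq> T k (tail Q \<rho>)" using entry_in[OF e kI kI tl] by blast
  have L: "lin_on tensor_scale tensor_scale (T k (tail Q \<rho>)) (chi_tensor Q M \<chi> X k i (X_after g k i) \<rho>)"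
    using chi_hom[where \<psi> = "X_after g k i", OF i kI ik \<psi> \<rho>] unfolding hom_space_iff by blast
  show ?thesis
  proof (rule T_ext[OF kI tl lin_on_comp[OF entry_lin[OF e kI kI tl] blk_hom(1)[OF i kI \<rho>] into] L _ s])
    fix v b assume v: "v \<in> spc (M k) (tail Q \<rho>)" and b: "b \<in> B k"
    note bX = B_in[OF kI b]
    show "blk \<rho> i k (entry e k k (tail Q \<rho>) (pt k v b)) = chi_tensor Q M \<chi> X k i (X_after g k i) \<rho> (pt k v b)"
    proof -
      have "chi_tensor Q M \<chi> X k i (X_after g k i) \<rho> (pt k v b) = (\<Sum>l=1..n k i. pt i (\<chi> k i l \<rho> v) (X_after g k i l b))"
        using \<psi> \<rho> v bX by (rule chi_pt[OF i kI ik])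
      then show ?thesis unfolding g_eq[OF k tl v bX] blk_pt[OF i kI ik \<rho> v g_in[OF k bX]]
        by (simp only: X_after_def bX if_True)
    qed
  qed
qed

text \<open>The induction hypothesis removes all blocks strictly between the diagonal and (i, k), so
  the defect of e_ik is the difference of e_ii after the block (i, k) and that block after e_kk.
  This is chi tensor psi with psi the commutator of g with X_chi. Being a coboundary, it forces psi
  = 0 by independence of the classes, and then e_ik is a morphism, hence 0. Only the vanishing of
  the blocks feeds the induction.\<close>

lemma entry_upper:
  assumes "i \<in> {2..r}" "k \<in> {2..r}" "i < k"
  shows "(\<forall>q\<in>verts Q. \<forall>s\<in>T k q. entry e i k q s = 0) \<and>
    (\<forall>l\<in>{1..n k i}. \<forall>w\<in>spc X k. g i (rmap X (k, i, l) w) = rmap X (k, i, l) (g k w))"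
  using assms
proof (induction "k - i" arbitrary: i k rule: less_induct)
  case (less i k)
  note i = less.prems(1) and k = less.prems(2) and ik = less.prems(3)
  have iI: "i \<in> I" and kI: "k \<in> I" and ne: "i \<noteq> k" using i k ik by auto
  \<comment> \<open>The failure of g to commute with X along the l-th arrow from m_k to m_i.\<close>
  define \<psi> where "\<psi> l = (\<lambda>w. if w \<in> spc X k then g i (rmap X (k, i, l) w) - rmap X (k, i, l) (g k w) else 0)" for l
  note Xr = X_rmap[OF iI kI ne]
  have X_in: "rmap X (k, i, l) w \<in> spc X i" if "l \<in> {1..n k i}" "w \<in> spc X k" for l w
    using Xr[OF that(1)] that(2) by (auto simp: hom_space_iff)
  have \<psi>: "\<psi> l \<in> X_hom k i" if l: "l \<in> {1..n k i}" for l
  proof -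
    have X_lin: "lin_on (scl X) (scl X) (spc X k) (rmap X (k, i, l))" using Xr[OF l] by (simp add: hom_space_iff)
    have "lin_on (scl X) (scl X) (spc X k) (\<lambda>w. g i (rmap X (k, i, l) w) - rmap X (k, i, l) (g k w))"
      by (rule lin_on_diff[OF X_vs lin_on_comp[OF X_lin g_lin[OF i]] lin_on_comp[OF g_lin[OF k] X_lin]])
        (use X_in[OF l] g_in[OF k] in auto)
    from hom_space_restrictI[OF X_sub[OF kI] X_vs this] show ?thesis unfolding \<psi>_def
      using Xs.subspace_diff[OF X_sub[OF iI] g_in[OF i X_in[OF l]] X_in[OF l g_in[OF k]]] by blast
  qed
  have defect: "defect Q (N k) (N i) (entry e i k) \<rho> s = chi_tensor Q M \<chi> X k i \<psi> \<rho> s"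
    if \<rho>: "\<rho> \<in> arcs Q" and s: "s \<in> T k (tail Q \<rho>)" for \<rho> s
  proof -
    note tl = tail_in[OF \<rho>] and hd = head_in[OF \<rho>]
    \<comment> \<open>Only j = i survives: for j > k the structure map is below the diagonal, for j
      < i the block e_ij is, and for i < j < k the block e_ij is closer to the diagonal than
      e_ik.\<close>
    have "(\<Sum>j\<in>I - {k}. entry e i j (head Q \<rho>) (blk \<rho> j k s))
        = (\<Sum>j\<in>I - {k}. if i = j then entry e i i (head Q \<rho>) (blk \<rho> i k s) else 0)"
    proof (rule sum.cong[OF refl])
      fix j assume j: "j \<in> I - {k}"
      then have jI: "j \<in> I" and jk: "j \<noteq> k" by auto
      show "entry e i j (head Q \<rho>) (blk \<rho> j k s) = (if i = j then entry e i i (head Q \<rho>) (blk \<rho> i k s) else 0)"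
      proof (cases "j = i")
        case False
        have "entry e i j (head Q \<rho>) (blk \<rho> j k s) = 0"
        proof (cases "k < j")
          case True
          then show ?thesis using blk_upper[OF jI kI] entry_0[OF e iI jI hd] by simp
        next
          case jk': False
          have in_T: "blk \<rho> j k s \<in> T j (head Q \<rho>)" by (rule blk_hom(2)[OF jI kI \<rho> s])
          show ?thesis
          proof (cases "j < i")
            case True
            then show ?thesis by (intro entry_lower iI jI hd in_T)
          next
            case ji: False
            then have "j - i < k - i" "j \<in> {2..r}" "i < j" using False jk jk' i jI by auto
            from less.hyps[OF this(1) i this(2,3)] show ?thesis using hd in_T by blast
          qed
        qed
        then show ?thesis using False by simp
      qed simp
    qed
    also have "\<dots> = entry e i i (head Q \<rho>) (blk \<rho> i k s)"
      by (subst sum.delta') (use iI ne in simp_all)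
    finally have S1: "(\<Sum>j\<in>I - {k}. entry e i j (head Q \<rho>) (blk \<rho> j k s)) = entry e i i (head Q \<rho>) (blk \<rho> i k s)" .
    \<comment> \<open>Dually, only j = k survives: j < i kills the structure map, j > k gives a
      block of e below the diagonal, and i < j < k is covered by induction.\<close>
    have "(\<Sum>j\<in>I - {i}. blk \<rho> i j (entry e j k (tail Q \<rho>) s))
        = (\<Sum>j\<in>I - {i}. if k = j then blk \<rho> i k (entry e k k (tail Q \<rho>) s) else 0)"
    proof (rule sum.cong[OF refl])
      fix j assume j: "j \<in> I - {i}"
      then have jI: "j \<in> I" and ji: "j \<noteq> i" by auto
      show "blk \<rho> i j (entry e j k (tail Q \<rho>) s) = (if k = j then blk \<rho> i k (entry e k k (tail Q \<rho>) s) else 0)"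
      proof (cases "j = k")
        case False
        have "blk \<rho> i j (entry e j k (tail Q \<rho>) s) = 0"
        proof (cases "j < i")
          case True
          then show ?thesis by (rule blk_upper[OF iI jI])
        next
          case ji': False
          have "entry e j k (tail Q \<rho>) s = 0"
          proof (cases "k < j")
            case True
            then show ?thesis by (intro entry_lower jI kI tl s)
          next
            case kj: False
            then have "k - j < k - i" "j \<in> {2..r}" "j < k" using False ji ji' i jI by auto
            from less.hyps[OF this(1) this(2) k this(3)] show ?thesis using tl s by blast
          qed
          then show ?thesis using blk_0[OF iI jI \<rho>] by (simp only:)
        qed
        then show ?thesis using False by simp
      qed simp
    qed
    also have "\<dots> = blk \<rho> i k (entry e k k (tail Q \<rho>) s)"
      by (subst sum.delta') (use kI ne in simp_all)
    finally have S2: "(\<Sum>j\<in>I - {i}. blk \<rho> i j (entry e j k (tail Q \<rho>) s)) = blk \<rho> i k (entry e k k (tail Q \<rho>) s)" .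
    have L1: "lin_on tensor_scale tensor_scale (T k (tail Q \<rho>)) (\<lambda>s. entry e i i (head Q \<rho>) (blk \<rho> i k s))"
      by (rule lin_on_comp[OF blk_hom(1)[OF iI kI \<rho>] entry_lin[OF e iI iI hd]]) (use blk_hom(2)[OF iI kI \<rho>] in blast)
    have L2: "lin_on tensor_scale tensor_scale (T k (tail Q \<rho>)) (\<lambda>s. blk \<rho> i k (entry e k k (tail Q \<rho>) s))"
      by (rule lin_on_comp[OF entry_lin[OF e kI kI tl] blk_hom(1)[OF iI kI \<rho>]]) (use entry_in[OF e kI kI tl] in blast)
    have L3: "lin_on tensor_scale tensor_scale (T k (tail Q \<rho>)) (chi_tensor Q M \<chi> X k i \<psi> \<rho>)"
      using chi_hom[where \<psi> = \<psi>, OF iI kI ne \<psi> \<rho>] unfolding hom_space_iff by blast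
    have "entry e i i (head Q \<rho>) (blk \<rho> i k s) - blk \<rho> i k (entry e k k (tail Q \<rho>) s) = chi_tensor Q M \<chi> X k i \<psi> \<rho> s"
    proof (rule T_ext[OF kI tl lin_on_diff[OF vector_space_tensor_scale L1 L2] L3 _ s])
      fix v b assume v: "v \<in> spc (M k) (tail Q \<rho>)" and b: "b \<in> B k"
      note bX = B_in[OF kI b]
      have c: "\<chi> k i l \<rho> v \<in> spc (M i) (head Q \<rho>)" if "l \<in> {1..n k i}" for l
        by (rule chi_in[OF iI kI ne \<psi> that \<rho> v])
      have "entry e i i (head Q \<rho>) (blk \<rho> i k (pt k v b))
          = entry e i i (head Q \<rho>) (\<Sum>l=1..n k i. pt i (\<chi> k i l \<rho> v) (rmap X (k, i, l) b))"
        unfolding blk_pt[OF iI kI ne \<rho> v bX] ..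
      also have "\<dots> = (\<Sum>l=1..n k i. entry e i i (head Q \<rho>) (pt i (\<chi> k i l \<rho> v) (rmap X (k, i, l) b)))"
        by (rule lin_on_sum_arg[OF subspace_T[OF iI hd] vector_space_tensor_scale entry_lin[OF e iI iI hd]])
          (rule pt_in[OF iI hd c X_in[OF _ bX]])
      also have "\<dots> = (\<Sum>l=1..n k i. pt i (\<chi> k i l \<rho> v) (g i (rmap X (k, i, l) b)))"
        by (rule sum.cong[OF refl]) (rule g_eq[OF i hd c X_in[OF _ bX]])
      finally have E1: "entry e i i (head Q \<rho>) (blk \<rho> i k (pt k v b))
          = (\<Sum>l=1..n k i. pt i (\<chi> k i l \<rho> v) (g i (rmap X (k, i, l) b)))" .
      have E2: "blk \<rho> i k (entry e k k (tail Q \<rho>) (pt k v b)) = (\<Sum>l=1..n k i. pt i (\<chi> k i l \<rho> v) (rmap X (k, i, l) (g k b)))"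
        unfolding g_eq[OF k tl v bX] blk_pt[OF iI kI ne \<rho> v g_in[OF k bX]] ..
      have E3: "chi_tensor Q M \<chi> X k i \<psi> \<rho> (pt k v b) = (\<Sum>l=1..n k i. pt i (\<chi> k i l \<rho> v) (\<psi> l b))"
        using \<psi> \<rho> v bX by (rule chi_pt[OF iI kI ne])
      show "entry e i i (head Q \<rho>) (blk \<rho> i k (pt k v b)) - blk \<rho> i k (entry e k k (tail Q \<rho>) (pt k v b))
          = chi_tensor Q M \<chi> X k i \<psi> \<rho> (pt k v b)"
        unfolding E1 E2 E3 sum_subtractf[symmetric] pt_diff_right[OF iI hd, symmetric]
        by (simp only: \<psi>_def bX if_True)
    qed
    then show ?thesis unfolding entry_defect_eq[OF e iI kI \<rho> s] S1 S2 .
  qed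
  have \<psi>0: "\<psi> l w = 0" if "l \<in> {1..n k i}" "w \<in> spc X k" for l w
    by (rule chi_inj[OF iI kI ne \<psi> entry_pre[OF e iI kI] defect that])
  have "rep_hom Q (N k) (N i) (entry e i k)"
    unfolding rep_hom_def N_simps(2)
  proof (intro conjI ballI entry_pre[OF e iI kI])
    fix \<rho> s assume \<rho>: "\<rho> \<in> arcs Q" and s: "s \<in> T k (tail Q \<rho>)"
    have L: "lin_on tensor_scale tensor_scale (T k (tail Q \<rho>)) (chi_tensor Q M \<chi> X k i \<psi> \<rho>)"
      using chi_hom[where \<psi> = \<psi>, OF iI kI ne \<psi> \<rho>] unfolding hom_space_iff by blast
    have "chi_tensor Q M \<chi> X k i \<psi> \<rho> s = 0"
    proof (rule T_ext[OF kI tail_in[OF \<rho>] L lin_on_zero(1)[OF vector_space_tensor_scale] _ s])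
      fix v b assume v: "v \<in> spc (M k) (tail Q \<rho>)" and b: "b \<in> B k"
      note bX = B_in[OF kI b]
      show "chi_tensor Q M \<chi> X k i \<psi> \<rho> (pt k v b) = 0"
      proof -
        have "chi_tensor Q M \<chi> X k i \<psi> \<rho> (pt k v b) = (\<Sum>l=1..n k i. pt i (\<chi> k i l \<rho> v) (\<psi> l b))"
          using \<psi> \<rho> v bX by (rule chi_pt[OF iI kI ne])
        also have "\<dots> = 0"
          by (rule sum.neutral, rule ballI) (simp only: \<psi>0[OF _ bX] pt_0_right[OF iI head_in[OF \<rho>]])
        finally show ?thesis .
      qed
    qed
    then show "defect Q (N k) (N i) (entry e i k) \<rho> s = 0" unfolding defect[OF \<rho> s] .
  qed
  \<comment> \<open>The condition i > 1 is essential at this point: morphisms from M_k to M_1 need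
    not vanish.\<close>
  from N_hom_eq_0[OF iI kI Hom_back_zero[OF iI kI ik] this]
  have "\<forall>q\<in>verts Q. \<forall>s\<in>T k q. entry e i k q s = 0" using i k by simp
  moreover have "g i (rmap X (k, i, l) w) = rmap X (k, i, l) (g k w)" if "l \<in> {1..n k i}" "w \<in> spc X k" for l w
    using \<psi>0[OF that] that(2) unfolding \<psi>_def by simp
  ultimately show ?case by blast
qed

end

end

end

section \<open>The restriction X_2 and the injectivity of the induced map\<close>

context theorem_setting
begin

abbreviation "X2 \<equiv> drop_first X"
abbreviation "F2 \<equiv> F_rep Q r M \<chi> X2"
abbreviation "F2s \<equiv> F_space r M X2"

lemma I_insert: "I = insert 1 {2..r}"
  using r_pos by auto

lemma X2_setting: "tensor_setting Q r M \<chi> X2"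
proof (rule tensor_setting.intro[OF wf M_rep chi])
  have fd: "fin_dim_subspace (scl X) {0}"
    unfolding fin_dim_subspace_def by (rule exI[of _ "{}"]) simp
  show "is_rep (QM Q r M) X2"
    unfolding is_rep_def
  proof (intro conjI ballI)
    show "vector_space (scl X2)" using X_vs by (simp add: drop_first_def)
    show "fin_dim_subspace (scl X2) (spc X2 i)" if "i \<in> verts (QM Q r M)" for i
      using fd is_repD(3)[OF X_rep that] by (simp add: drop_first_def)
    show "finite {i \<in> verts (QM Q r M). spc X2 i \<noteq> {0}}"
      by (simp add: QM_def)
    fix \<rho> assume \<rho>: "\<rho> \<in> arcs (QM Q r M)"
    obtain i j l where ijl: "\<rho> = (i, j, l)" by (cases \<rho>)
    have ij: "i \<in> verts (QM Q r M)" "j \<in> verts (QM Q r M)" using \<rho> unfolding ijl by (auto simp: QM_def)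
    show "rmap X2 \<rho> \<in> hom_space (scl X2) (scl X2) (spc X2 (tail (QM Q r M) \<rho>)) (spc X2 (head (QM Q r M) \<rho>))"
    proof (cases "i = 1 \<or> j = 1")
      case True
      then show ?thesis using is_repD(8)[OF X_rep ij(2)]
        unfolding ijl hom_space_iff by (auto simp: drop_first_def QM_def lin_on_zero[OF X_vs])
    next
      case False
      then show ?thesis using is_repD(4)[OF X_rep \<rho>] unfolding ijl by (simp add: drop_first_def QM_def)
    qed
  qed
qed

sublocale X2: tensor_setting Q r M \<chi> X2
  by (rule X2_setting)

lemma F2s_D:
  assumes "q \<in> verts Q" "t \<in> F2s q"
  shows "i \<in> {2..r} \<Longrightarrow> t i \<in> T i q" "t 1 = 0"
proof -
  show "t i \<in> T i q" if i: "i \<in> {2..r}"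
  proof -
    have "i \<in> I" "i \<noteq> 1" using i by auto
    then show ?thesis using X2.Fs_D(1)[OF assms(2), of i] by (simp add: drop_first_def)
  qed
  have "tensor_space (scl (M 1)) (scl X) (spc (M 1) q) {0} \<subseteq> {0}"
    unfolding tensor_space_def
    by (rule tensor.span_minimal[OF _ tensor.subspace_single_0]) (use pt_0_right[OF I1 assms(1)] in auto)
  moreover have "t 1 \<in> tensor_space (scl (M 1)) (scl X) (spc (M 1) q) {0}"
    using X2.Fs_D(1)[OF assms(2) I1] by (simp add: drop_first_def)
  ultimately show "t 1 = 0" by blast
qed

text \<open>Column 1 contributes nothing because t has no component at m_1, and the remaining blocks
  in rows j > 1 are those of F_M X. Thus sums over these blocks can be read as structure maps of F_M
  X_2.\<close>

lemma F2_rmap: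
  assumes \<rho>: "\<rho> \<in> arcs Q" and t: "t \<in> F2s (tail Q \<rho>)" and j: "j \<in> {2..r}"
  shows "rmap F2 \<rho> t j = (\<Sum>m\<in>{2..r}. blk \<rho> j m (t m))"
proof -
  have jI: "j \<in> I" using j by simp
  have blk_eq: "X2.blk \<rho> j m = blk \<rho> j m" if "m \<in> {2..r}" for m
    using that j by (simp add: F_block_def tensor_rep_def chi_tensor_def drop_first_def)
  have "rmap F2 \<rho> t j = (\<Sum>m\<in>I. X2.blk \<rho> j m (t m))"
    unfolding X2.F_simps(3)[OF t] using jI by (simp only: if_True)
  also have "\<dots> = X2.blk \<rho> j 1 (t 1) + (\<Sum>m\<in>{2..r}. X2.blk \<rho> j m (t m))"
    unfolding I_insert by (rule sum.insert) simp_all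
  also have "X2.blk \<rho> j 1 (t 1) = 0"
    unfolding F2s_D(2)[OF tail_in[OF \<rho>] t] by (rule X2.blk_0[OF jI I1 \<rho>])
  also have "(\<Sum>m\<in>{2..r}. X2.blk \<rho> j m (t m)) = (\<Sum>m\<in>{2..r}. blk \<rho> j m (t m))"
    by (rule sum.cong[OF refl]) (simp only: blk_eq)
  finally show ?thesis by (simp only: add_0)
qed

lemma zero_X_hom: "i \<in> I \<Longrightarrow> 0 \<in> X_hom k i"
  using Xs.subspace_0[OF X_sub] by (auto simp: hom_space_iff lin_on_zero[OF X_vs])

text \<open>A tensor product with the zero map is still given by a definite description, so it is
  shown to vanish on the pure tensors, while off the space T it is 0 by the convention for
  Hom.\<close>

lemma chi_tensor_0:
  assumes k: "k \<in> {2..r}"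
  shows "chi_tensor Q M \<chi> X k 1 (\<lambda>l. 0) = 0"
proof (intro ext)
  \<comment> \<open>Tensors are themselves functions of bilinear forms, hence the third
    argument.\<close>
  fix \<rho> s \<beta>
  have kI: "k \<in> I" and ne: "1 \<noteq> k" using k by auto
  have z: "\<And>l. l \<in> {1..n k 1} \<Longrightarrow> (0 :: 'w \<Rightarrow> 'w) \<in> X_hom k 1" by (rule zero_X_hom[OF I1])
  have "chi_tensor Q M \<chi> X k 1 (\<lambda>l. 0) \<rho> s = 0"
  proof (cases "\<rho> \<in> arcs Q")
    case \<rho>: True
    have hom: "chi_tensor Q M \<chi> X k 1 (\<lambda>l. 0) \<rho> \<in> hom_space tensor_scale tensor_scale (T k (tail Q \<rho>)) (T 1 (head Q \<rho>))"
      using z \<rho> by (rule chi_hom[OF I1 kI ne])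
    show ?thesis
    proof (cases "s \<in> T k (tail Q \<rho>)")
      case s: True
      have L: "lin_on tensor_scale tensor_scale (T k (tail Q \<rho>)) (chi_tensor Q M \<chi> X k 1 (\<lambda>l. 0) \<rho>)"
        using hom unfolding hom_space_iff by blast
      show ?thesis
      proof (rule T_ext[OF kI tail_in[OF \<rho>] L lin_on_zero(1)[OF vector_space_tensor_scale] _ s])
        fix v b assume v: "v \<in> spc (M k) (tail Q \<rho>)" and b: "b \<in> B k"
        have "chi_tensor Q M \<chi> X k 1 (\<lambda>l. 0) \<rho> (pt k v b) = (\<Sum>l=1..n k 1. pt 1 (\<chi> k 1 l \<rho> v) ((0 :: 'w \<Rightarrow> 'w) b))"
          using z \<rho> v B_in[OF kI b] by (rule chi_pt[OF I1 kI ne])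
        also have "\<dots> = 0"
          by (rule sum.neutral, rule ballI) (simp only: zero_fun_apply[of b] pt_0_right[OF I1 head_in[OF \<rho>]])
        finally show "chi_tensor Q M \<chi> X k 1 (\<lambda>l. 0) \<rho> (pt k v b) = 0" .
      qed
    next
      case False
      then show ?thesis using hom unfolding hom_space_iff by blast
    qed
  next
    case False
    then show ?thesis by (simp add: chi_tensor_def)
  qed
  then show "chi_tensor Q M \<chi> X k 1 (\<lambda>l. 0) \<rho> s \<beta> = 0 \<rho> s \<beta>" by simp
qed

lemma Theta_domD: "\<phi> \<in> Theta_dom Q r M X \<Longrightarrow> i \<in> {2..r} \<Longrightarrow> l \<in> {1..n i 1} \<Longrightarrow> \<phi> i l \<in> X_hom i 1"
  unfolding Theta_dom_def by (drule CollectD, drule spec[of _ i], drule spec[of _ l]) simp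

lemma Theta_in_cod:
  assumes "\<phi> \<in> Theta_dom Q r M X"
  shows "Theta Q r M \<chi> X \<phi> \<in> Theta_cod Q r M X"
  unfolding Theta_def Theta_cod_def restrict_PiE_iff
proof (rule ballI)
  fix i assume i: "i \<in> {2..r}"
  then have "i \<in> I" "1 \<noteq> i" by auto
  from chi_arc_maps[OF I1 this, of "\<phi> i"] Theta_domD[OF assms i]
  have "chi_tensor Q M \<chi> X i 1 (\<phi> i) \<in> arc_maps Q (N i) (N 1)" .
  then show "ext_class Q (N i) (N 1) (chi_tensor Q M \<chi> X i 1 (\<phi> i)) \<in> Ext_Q Q (N i) (N 1)"
    unfolding Ext_Q_def by (rule imageI)
qed

text \<open>The hypothesis says that f bounds the glued cocycle of \<open>\<phi>\<close>. The
  induced map is injective, so the Ext classes making up Theta of \<open>\<phi>\<close> are those of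
  0, and \<open>chi_inj\<close> turns the vanishing of the i-th class into the vanishing of its
  coefficients.\<close>

lemma glued_class_trivialD:
  assumes \<phi>: "\<phi> \<in> Theta_dom Q r M X" and f: "pre_hom Q F2 (N 1) f"
    and defect: "\<And>\<rho> t. \<rho> \<in> arcs Q \<Longrightarrow> t \<in> F2s (tail Q \<rho>) \<Longrightarrow>
      defect Q F2 (N 1) f \<rho> t = (\<Sum>i=2..r. chi_tensor Q M \<chi> X i 1 (\<phi> i) \<rho> (t i))"
    and i: "i \<in> {2..r}" and l: "l \<in> {1..n i 1}" and w: "w \<in> spc X i"
  shows "\<phi> i l w = 0"
proof -
  interpret P: rep_pair Q F2 "N 1" by (rule rep_pair.intro[OF wf X2.F_is_rep N_rep[OF I1]])
  let ?glue = "\<lambda>\<phi> \<rho> t. if t \<in> F2s (tail Q \<rho>) then \<Sum>i=2..r. chi_tensor Q M \<chi> X i 1 (\<phi> i) \<rho> (t i) else 0"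
  have no_arc: "chi_tensor Q M \<chi> X i 1 \<psi> \<rho> s = 0" if "\<rho> \<notin> arcs Q" for i \<psi> \<rho> s
    using that by (simp add: chi_tensor_def)
  have glue_eq: "?glue \<phi> \<rho> t = rep_diff Q F2 (N 1) (restr Q F2 f) \<rho> t" for \<rho> t
  proof (cases "\<rho> \<in> arcs Q")
    case True
    show ?thesis
    proof (cases "t \<in> F2s (tail Q \<rho>)")
      case t: True
      show ?thesis unfolding P.rep_diff_restr[OF f True] X2.F_simps(2) if_P[OF t] by (rule defect[OF True t, symmetric])
    next
      case t: False
      show ?thesis unfolding P.rep_diff_restr[OF f True] X2.F_simps(2) if_not_P[OF t] ..
    qed
  next
    case False
    have sum0: "(\<Sum>i=2..r. chi_tensor Q M \<chi> X i 1 (\<phi> i) \<rho> (t i)) = 0"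
      by (rule sum.neutral, rule ballI) (rule no_arc[OF False])
    show ?thesis
      unfolding sum0 rep_diff_def if_not_P[OF False] zero_fun_apply[of t] by (rule if_cancel)
  qed
  have "?glue \<phi> = rep_diff Q F2 (N 1) (restr Q F2 f)" by (rule ext, rule ext, rule glue_eq)
  then have glue_\<phi>: "glued_class Q r M \<chi> X \<phi> = ext_class Q F2 (N 1) 0"
    unfolding glued_class_def by (rule ssubst) (rule P.ext_class_eq_0[OF P.restr_vert_maps[OF f]])
  let ?z = "\<lambda>i l. 0 :: 'w \<Rightarrow> 'w"
  have z: "?z \<in> Theta_dom Q r M X"
    unfolding Theta_dom_def using zero_X_hom[OF I1] by simp
  have "?glue ?z \<rho> t = 0" for \<rho> t
  proof -
    have sum0: "(\<Sum>i=2..r. chi_tensor Q M \<chi> X i 1 (\<lambda>l. 0) \<rho> (t i)) = 0"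
    proof (rule sum.neutral, rule ballI)
      fix i assume "i \<in> {2..r}"
      from chi_tensor_0[OF this] show "chi_tensor Q M \<chi> X i 1 (\<lambda>l. 0) \<rho> (t i) = 0"
        by (simp only: zero_fun_apply[of \<rho>] zero_fun_apply[of "t i"])
    qed
    show ?thesis unfolding sum0 by (rule if_cancel)
  qed
  then have "?glue ?z = 0" by (intro ext) (simp only: zero_fun_apply)
  then have glue_0: "glued_class Q r M \<chi> X ?z = ext_class Q F2 (N 1) 0"
    unfolding glued_class_def by (rule arg_cong)
  obtain h where bij: "bij_betw h (Theta_cod Q r M X) (Ext_Q Q F2 (N 1))"
    and h: "\<forall>\<phi>\<in>Theta_dom Q r M X. h (Theta Q r M \<chi> X \<phi>) = glued_class Q r M \<chi> X \<phi>"
    using iso unfolding Theta_induces_iso_def Let_def by (elim exE conjE)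
  \<comment> \<open>Both glued classes are the class of 0, one because its cocycle is d of f, the
    other because its cocycle is 0.\<close>
  have "h (Theta Q r M \<chi> X \<phi>) = h (Theta Q r M \<chi> X ?z)"
    unfolding bspec[OF h \<phi>] bspec[OF h z] glue_\<phi> glue_0 ..
  then have "Theta Q r M \<chi> X \<phi> = Theta Q r M \<chi> X ?z"
    by (rule inj_onD[OF bij_betw_imp_inj_on[OF bij] _ Theta_in_cod[OF \<phi>] Theta_in_cod[OF z]])
  from fun_cong[OF this, of i]
  have eq: "ext_class Q (N i) (N 1) (chi_tensor Q M \<chi> X i 1 (\<phi> i)) = ext_class Q (N i) (N 1) 0"
    unfolding Theta_def restrict_apply'[OF i] chi_tensor_0[OF i] .
  have iI: "i \<in> I" and ne: "1 \<noteq> i" using i by auto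
  obtain f' where f': "f' \<in> vert_maps Q (N i) (N 1)" "chi_tensor Q M \<chi> X i 1 (\<phi> i) = 0 + rep_diff Q (N i) (N 1) f'"
    by (rule rep_pair.ext_class_eqD[OF N_pair[OF iI I1] eq])
  have pre: "pre_hom Q (N i) (N 1) f'"
    using f'(1) unfolding pre_hom_def vert_maps_def hom_space_iff by blast
  have "defect Q (N i) (N 1) f' \<rho> t = chi_tensor Q M \<chi> X i 1 (\<phi> i) \<rho> t" if "\<rho> \<in> arcs Q" for \<rho> t
    unfolding f'(2) defect_def rep_diff_def add_0 if_P[OF that] ..
  from chi_inj[OF I1 iI ne Theta_domD[OF \<phi> i] pre this l w] show ?thesis .
qed

section \<open>The first row and the induced endomorphism of X\<close>

context
  fixes e g
  assumes e: "rep_hom Q F F e"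
    and e11: "\<And>q s. q \<in> verts Q \<Longrightarrow> s \<in> T 1 q \<Longrightarrow> entry e 1 1 q s = 0"
    and g: "\<And>i. i \<in> {2..r} \<Longrightarrow> g i \<in> X_hom i i"
    and g_eq: "\<And>i q v w. i \<in> {2..r} \<Longrightarrow> q \<in> verts Q \<Longrightarrow> v \<in> spc (M i) q \<Longrightarrow> w \<in> spc X i \<Longrightarrow>
      entry e i i q (pt i v w) = pt i v (g i w)"
begin

text \<open>As e_11 = 0, the row sees only the structure maps of F_M X_2. As e_jk = 0 for distinct
  j, k > 1, the only other contribution is the block (1, k) after e_kk, which is the cocycle
  term.\<close>

lemma entry_first_row:
  assumes k: "k \<in> {2..r}" and \<rho>: "\<rho> \<in> arcs Q" and s: "s \<in> T k (tail Q \<rho>)"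
  shows "rmap (N 1) \<rho> (entry e 1 k (tail Q \<rho>) s) =
    (\<Sum>j\<in>{2..r}. entry e 1 j (head Q \<rho>) (blk \<rho> j k s)) - chi_tensor Q M \<chi> X k 1 (X_after g k 1) \<rho> s"
proof -
  note tl = tail_in[OF \<rho>] and hd = head_in[OF \<rho>]
  have kI: "k \<in> I" and ne: "1 \<noteq> k" using k by auto
  have "(\<Sum>j\<in>I - {1}. blk \<rho> 1 j (entry e j k (tail Q \<rho>) s))
      = (\<Sum>j\<in>I - {1}. if k = j then blk \<rho> 1 k (entry e k k (tail Q \<rho>) s) else 0)"
  proof (rule sum.cong[OF refl])
    fix j assume "j \<in> I - {1}"
    then have j: "j \<in> {2..r}" and jI: "j \<in> I" by auto
    show "blk \<rho> 1 j (entry e j k (tail Q \<rho>) s) = (if k = j then blk \<rho> 1 k (entry e k k (tail Q \<rho>) s) else 0)"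
    proof (cases "j = k")
      case False
      have "entry e j k (tail Q \<rho>) s = 0"
      proof (cases "k < j")
        case True
        then show ?thesis by (intro entry_lower[OF e] jI kI tl s)
      next
        case kj: False
        then have "j < k" using False by simp
        from entry_upper[OF e g g_eq j k this] show ?thesis using tl s by blast
      qed
      then have "blk \<rho> 1 j (entry e j k (tail Q \<rho>) s) = 0" using blk_0[OF I1 jI \<rho>] by (simp only:)
      then show ?thesis using False by simp
    qed simp
  qed
  also have "\<dots> = blk \<rho> 1 k (entry e k k (tail Q \<rho>) s)"
    by (subst sum.delta') (use kI ne in simp_all)
  also have "\<dots> = chi_tensor Q M \<chi> X k 1 (X_after g k 1) \<rho> s"
    by (rule blk_entry[OF e g g_eq I1 k ne \<rho> s])
  finally have S2: "(\<Sum>j\<in>I - {1}. blk \<rho> 1 j (entry e j k (tail Q \<rho>) s)) = chi_tensor Q M \<chi> X k 1 (X_after g k 1) \<rho> s" .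
  have "(\<Sum>j\<in>I. entry e 1 j (head Q \<rho>) (blk \<rho> j k s))
      = entry e 1 1 (head Q \<rho>) (blk \<rho> 1 k s) + (\<Sum>j\<in>{2..r}. entry e 1 j (head Q \<rho>) (blk \<rho> j k s))"
    unfolding I_insert by (rule sum.insert) simp_all
  also have "entry e 1 1 (head Q \<rho>) (blk \<rho> 1 k s) = 0" by (rule e11[OF hd blk_hom(2)[OF I1 kI \<rho> s]])
  finally have S1: "(\<Sum>j\<in>I. entry e 1 j (head Q \<rho>) (blk \<rho> j k s)) = (\<Sum>j\<in>{2..r}. entry e 1 j (head Q \<rho>) (blk \<rho> j k s))"
    by (simp only: add_0)
  \<comment> \<open>The diagonal term of N_k is put back into the sum, which completes the k-th
    column of F_M X_2.\<close>
  have "(\<Sum>j\<in>I. entry e 1 j (head Q \<rho>) (blk \<rho> j k s)) = entry e 1 k (head Q \<rho>) (rmap (N k) \<rho> s)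
      + (\<Sum>j\<in>I - {k}. entry e 1 j (head Q \<rho>) (blk \<rho> j k s))"
    using sum.remove[OF _ kI, of "\<lambda>j. entry e 1 j (head Q \<rho>) (blk \<rho> j k s)"] by (simp only: blk_diag finite_atLeastAtMost)
  with entry_defect_eq[OF e I1 kI \<rho> s] show ?thesis unfolding defect_def S1 S2 by (simp only: algebra_simps)
qed

text \<open>Summing \<open>entry_first_row\<close> over k shows that the first row of e, taken as
  one family of maps from F_M X_2 to N_1, bounds the glued cocycle with coefficients X_chi
  g_k.\<close>

lemma X_after_first:
  assumes k: "k \<in> {2..r}" and l: "l \<in> {1..n k 1}" and w: "w \<in> spc X k"
  shows "rmap X (k, 1, l) (g k w) = 0"
proof -
  \<comment> \<open>The negative sign makes d of f equal to the glued cocycle itself instead of its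
    negative.\<close>
  define f where "f q t = 0 - (\<Sum>k\<in>{2..r}. entry e 1 k q (t k))" for q and t :: "nat \<Rightarrow> ('k, 'v, 'w) tensor"
  \<comment> \<open>\<open>Theta_dom\<close> asks for the value 0 outside the index range, where
    \<open>X_after\<close> need not vanish.\<close>
  define \<phi> where "\<phi> i l = (if i \<in> {2..r} \<and> l \<in> {1..n i 1} then X_after g i 1 l else 0)" for i l
  have I: "i \<in> I" "1 \<noteq> i" if "i \<in> {2..r}" for i using that by auto
  have \<phi>: "\<phi> \<in> Theta_dom Q r M X"
    unfolding Theta_dom_def
  proof (rule CollectI, intro allI)
    fix i l
    show "if i \<in> {2..r} \<and> l \<in> {1..n i 1} then \<phi> i l \<in> X_hom i 1 else \<phi> i l = 0"
      using X_after_hom[of 1 i l g, OF I1 I] g unfolding \<phi>_def by simp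
  qed
  have f_pre: "pre_hom Q F2 (N 1) f"
    unfolding pre_hom_def X2.F_simps(1,2) N_simps(1,2)
  proof (intro conjI ballI subsetI)
    fix q assume q: "q \<in> verts Q"
    have "lin_on sclF tensor_scale (F2s q) (\<lambda>t. entry e 1 k q (t k))" if k: "k \<in> {2..r}" for k
      by (rule lin_on_comp[OF component_lin entry_lin[OF e I1 I(1)[OF k] q]]) (use F2s_D(1)[OF q _ k] in blast)
    from lin_on_diff[OF vector_space_tensor_scale lin_on_zero(1)[OF vector_space_tensor_scale]
        lin_on_sum[OF vector_space_tensor_scale this, of "{2..r}" "\<lambda>k. k"]]
    show "lin_on sclF tensor_scale (F2s q) (f q)" unfolding f_def by simp
    fix x assume "x \<in> f q ` F2s q"
    then obtain t where t: "x = f q t" "t \<in> F2s q" by (rule imageE)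
    have "(\<Sum>k\<in>{2..r}. entry e 1 k q (t k)) \<in> T 1 q"
    proof (rule tensor.subspace_sum[OF subspace_T[OF I1 q], of "{2..r}" "\<lambda>k. entry e 1 k q (t k)"])
      fix k assume k: "k \<in> {2..r}"
      show "entry e 1 k q (t k) \<in> T 1 q" by (rule entry_in[OF e I1 I(1)[OF k] q F2s_D(1)[OF q t(2) k]])
    qed
    then show "x \<in> T 1 q" unfolding t(1) f_def
      by (rule tensor.subspace_diff[OF subspace_T[OF I1 q] tensor.subspace_0[OF subspace_T[OF I1 q]]])
  qed
  have "defect Q F2 (N 1) f \<rho> t = (\<Sum>i=2..r. chi_tensor Q M \<chi> X i 1 (\<phi> i) \<rho> (t i))"
    if \<rho>: "\<rho> \<in> arcs Q" and t: "t \<in> F2s (tail Q \<rho>)" for \<rho> t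
  proof -
    note tl = tail_in[OF \<rho>] and hd = head_in[OF \<rho>]
    note tk = F2s_D(1)[OF tl t]
    have N1_lin: "lin_on tensor_scale tensor_scale (T 1 (tail Q \<rho>)) (rmap (N 1) \<rho>)"
      using N_rmap(1)[OF I1 \<rho>] unfolding hom_space_iff by blast
    have in1: "entry e 1 k (tail Q \<rho>) (t k) \<in> T 1 (tail Q \<rho>)" if "k \<in> {2..r}" for k
      by (rule entry_in[OF e I1 I(1)[OF that] tl tk[OF that]])
    have sum_in: "(\<Sum>k\<in>{2..r}. entry e 1 k (tail Q \<rho>) (t k)) \<in> T 1 (tail Q \<rho>)"
      by (rule tensor.subspace_sum[OF subspace_T[OF I1 tl], of "{2..r}" "\<lambda>k. entry e 1 k (tail Q \<rho>) (t k)"]) (rule in1)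
    have "rmap (N 1) \<rho> (f (tail Q \<rho>) t) = rmap (N 1) \<rho> 0 - rmap (N 1) \<rho> (\<Sum>k\<in>{2..r}. entry e 1 k (tail Q \<rho>) (t k))"
      unfolding f_def
      by (rule lin_on_diff_arg[OF subspace_T[OF I1 tl] vector_space_tensor_scale N1_lin
            tensor.subspace_0[OF subspace_T[OF I1 tl]] sum_in])
    also have "rmap (N 1) \<rho> 0 = 0" by (rule lin_on_0[OF subspace_T[OF I1 tl] vector_space_tensor_scale N1_lin])
    also have "rmap (N 1) \<rho> (\<Sum>k\<in>{2..r}. entry e 1 k (tail Q \<rho>) (t k))
        = (\<Sum>k\<in>{2..r}. rmap (N 1) \<rho> (entry e 1 k (tail Q \<rho>) (t k)))"
      by (rule lin_on_sum_arg[OF subspace_T[OF I1 tl] vector_space_tensor_scale N1_lin in1])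
    also have "\<dots> = (\<Sum>k\<in>{2..r}. (\<Sum>j\<in>{2..r}. entry e 1 j (head Q \<rho>) (blk \<rho> j k (t k)))
        - chi_tensor Q M \<chi> X k 1 (X_after g k 1) \<rho> (t k))"
      by (rule sum.cong[OF refl]) (rule entry_first_row[OF _ \<rho> tk])
    also have "\<dots> = (\<Sum>k\<in>{2..r}. \<Sum>j\<in>{2..r}. entry e 1 j (head Q \<rho>) (blk \<rho> j k (t k)))
        - (\<Sum>k\<in>{2..r}. chi_tensor Q M \<chi> X k 1 (X_after g k 1) \<rho> (t k))"
      by (rule sum_subtractf)
    \<comment> \<open>After the exchange the inner sum over k is e_1j applied to component j of the
      structure map of F_M X_2, so the whole is -f after that map.\<close>
    also have "(\<Sum>k\<in>{2..r}. \<Sum>j\<in>{2..r}. entry e 1 j (head Q \<rho>) (blk \<rho> j k (t k)))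
        = (\<Sum>j\<in>{2..r}. \<Sum>k\<in>{2..r}. entry e 1 j (head Q \<rho>) (blk \<rho> j k (t k)))"
      by (rule sum.swap)
    also have "\<dots> = (\<Sum>j\<in>{2..r}. entry e 1 j (head Q \<rho>) (rmap F2 \<rho> t j))"
    proof (rule sum.cong[OF refl])
      fix j assume j: "j \<in> {2..r}"
      show "(\<Sum>k\<in>{2..r}. entry e 1 j (head Q \<rho>) (blk \<rho> j k (t k))) = entry e 1 j (head Q \<rho>) (rmap F2 \<rho> t j)"
        unfolding F2_rmap[OF \<rho> t j]
        by (rule lin_on_sum_arg[OF subspace_T[OF I(1)[OF j] hd] vector_space_tensor_scale entry_lin[OF e I1 I(1)[OF j] hd], symmetric])
          (rule blk_hom(2)[OF I(1)[OF j] I(1) \<rho> tk])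
    qed
    finally have "rmap (N 1) \<rho> (f (tail Q \<rho>) t) = 0 - ((\<Sum>j\<in>{2..r}. entry e 1 j (head Q \<rho>) (rmap F2 \<rho> t j))
        - (\<Sum>k\<in>{2..r}. chi_tensor Q M \<chi> X k 1 (X_after g k 1) \<rho> (t k)))" .
    then have "defect Q F2 (N 1) f \<rho> t = (\<Sum>k\<in>{2..r}. chi_tensor Q M \<chi> X k 1 (X_after g k 1) \<rho> (t k))"
      unfolding defect_def f_def[of "head Q \<rho>"] by (simp only: algebra_simps) 
    also have "\<dots> = (\<Sum>k\<in>{2..r}. chi_tensor Q M \<chi> X k 1 (\<phi> k) \<rho> (t k))"
    proof (rule sum.cong[OF refl])
      fix k assume k: "k \<in> {2..r}"
      have "chi_tensor Q M \<chi> X k 1 (X_after g k 1) = chi_tensor Q M \<chi> X k 1 (\<phi> k)"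
      proof
        fix \<rho>
        have "X_after g k 1 l = \<phi> k l" if "l \<in> {1..n k 1}" for l
          unfolding \<phi>_def if_P[OF conjI[OF k that]] ..
        then show "chi_tensor Q M \<chi> X k 1 (X_after g k 1) \<rho> = chi_tensor Q M \<chi> X k 1 (\<phi> k) \<rho>"
          unfolding chi_tensor_def by (simp only: cong: sum.cong)
      qed
      then show "chi_tensor Q M \<chi> X k 1 (X_after g k 1) \<rho> (t k) = chi_tensor Q M \<chi> X k 1 (\<phi> k) \<rho> (t k)"
        by (simp only:)
    qed
    finally show ?thesis .
  qed
  from glued_class_trivialD[OF \<phi> f_pre this k l w] show ?thesis
    using k l w by (simp add: \<phi>_def X_after_def)
qed

text \<open>On arrows between vertices other than m_1 the commutation is part of
  \<open>entry_upper\<close>. On arrows into m_1 both sides are 0, one by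
  \<open>X_after_first\<close> and the other by the choice of 0 at m_1. No arrow leaves m_1.\<close>

lemma QM_endo:
  defines "G \<equiv> \<lambda>i. if i = 1 then (\<lambda>w. 0) else g i"
  shows "rep_hom (QM Q r M) X X G"
  unfolding rep_hom_def pre_hom_def
proof (intro conjI ballI)
  fix i assume "i \<in> verts (QM Q r M)"
  then have i: "i \<in> I" by (simp add: QM_def)
  then have i2: "i \<noteq> 1 \<Longrightarrow> i \<in> {2..r}" by auto
  show "lin_on (scl X) (scl X) (spc X i) (G i)" "G i ` spc X i \<subseteq> spc X i"
    using g[OF i2] Xs.subspace_0[OF X_sub[OF i]] unfolding G_def hom_space_iff
    by (auto simp: lin_on_zero[OF X_vs])
next
  fix \<rho> w assume \<rho>: "\<rho> \<in> arcs (QM Q r M)" and w: "w \<in> spc X (tail (QM Q r M) \<rho>)"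
  obtain i j l where ijl: "\<rho> = (i, j, l)" by (cases \<rho>)
  have i: "i \<in> I" and j: "j \<in> I" and ne: "i \<noteq> j" and l: "l \<in> {1..n i j}" and w: "w \<in> spc X i"
    using \<rho> w unfolding ijl by (auto simp: QM_def)
  have "\<not> i < j" using n_eq_0[OF j i] l by auto
  with ne i j have ji: "j < i" and i2: "i \<in> {2..r}" by auto
  have "rmap X (i, j, l) (G i w) = G j (rmap X (i, j, l) w)"
  proof (cases "j = 1")
    case True
    then show ?thesis using X_after_first[OF i2, of l w] l w i2 unfolding G_def by simp
  next
    case False
    then have "j \<in> {2..r}" using j by auto
    from entry_upper[OF e g g_eq this i2 ji] show ?thesis using l w False i2 unfolding G_def by simp
  qed
  then show "defect (QM Q r M) X X G \<rho> w = 0" unfolding defect_def ijl by (simp add: QM_def)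
qed

end

section \<open>Triviality of idempotents and the conclusion\<close>

lemma idempotent_eq_0:
  assumes e: "rep_hom Q F F e"
    and idem: "\<And>q t. q \<in> verts Q \<Longrightarrow> t \<in> Fs q \<Longrightarrow> e q (e q t) = e q t"
    and e11: "\<And>q s. q \<in> verts Q \<Longrightarrow> s \<in> T 1 q \<Longrightarrow> entry e 1 1 q s = 0"
    and q: "q \<in> verts Q" and t: "t \<in> Fs q"
  shows "e q t = 0"
proof -
  have I: "i \<in> I" "1 \<noteq> i" if "i \<in> {2..r}" for i using that by auto
  have "\<forall>i\<in>{2..r}. \<exists>g. g \<in> X_hom i i \<and> (\<forall>q\<in>verts Q. \<forall>v\<in>spc (M i) q. \<forall>w\<in>spc X i.
      entry e i i q (pt i v w) = pt i v (g w))"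
  proof
    fix i assume i: "i \<in> {2..r}"
    obtain g where "g \<in> X_hom i i"
      "\<And>q v w. q \<in> verts Q \<Longrightarrow> v \<in> spc (M i) q \<Longrightarrow> w \<in> spc X i \<Longrightarrow> entry e i i q (pt i v w) = pt i v (g w)"
      using N_end_scalar[OF I(1)[OF i] End_k[OF i] entry_diag[OF e I(1)[OF i]]] by metis
    then show "\<exists>g. g \<in> X_hom i i \<and> (\<forall>q\<in>verts Q. \<forall>v\<in>spc (M i) q. \<forall>w\<in>spc X i.
      entry e i i q (pt i v w) = pt i v (g w))" by blast
  qed
  from bchoice[OF this] obtain g where "\<forall>i\<in>{2..r}. g i \<in> X_hom i i \<and> (\<forall>q\<in>verts Q. \<forall>v\<in>spc (M i) q. \<forall>w\<in>spc X i.
      entry e i i q (pt i v w) = pt i v (g i w))" ..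
  then have g: "\<And>i. i \<in> {2..r} \<Longrightarrow> g i \<in> X_hom i i"
    and g_eq: "\<And>i q v w. i \<in> {2..r} \<Longrightarrow> q \<in> verts Q \<Longrightarrow> v \<in> spc (M i) q \<Longrightarrow> w \<in> spc X i \<Longrightarrow>
      entry e i i q (pt i v w) = pt i v (g i w)" by blast+
  have g_in: "g i w \<in> spc X i" if "i \<in> {2..r}" "w \<in> spc X i" for i w
    using g[OF that(1)] that(2) unfolding hom_space_iff by blast
  let ?G = "\<lambda>i. if i = 1 then (\<lambda>w. 0) else g i"
  have G: "rep_hom (QM Q r M) X X ?G" by (rule QM_endo[OF e e11 g g_eq])
  have g_idem: "g i (g i w) = g i w" if i: "i \<in> {2..r}" and w: "w \<in> spc X i" for i w
  proof -
    \<comment> \<open>M_i is nonzero, so some v cancels from v tensor (g_i g_i w - g_i w) = 0 and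
      idempotency passes from e_ii to g_i.\<close>
    obtain q v where q: "q \<in> verts Q" and v: "v \<in> spc (M i) q" "v \<noteq> 0" by (rule M_nonzero[OF I(1)[OF i]])
    have "pt i v (g i (g i w)) = pt i v (g i w)"
      using entry_diag_idem[OF e idem I(1)[OF i] q pt_in[OF I(1)[OF i] q v(1) w]]
      unfolding g_eq[OF i q v(1) w] g_eq[OF i q v(1) g_in[OF i w]] .
    then have "pt i v (g i (g i w) - g i w) = 0" unfolding pt_diff_right[OF I(1)[OF i] q] by (simp only: diff_self)
    moreover have "g i (g i w) - g i w \<in> spc X i"
      by (rule Xs.subspace_diff[OF X_sub[OF I(1)[OF i]] g_in[OF i g_in[OF i w]] g_in[OF i w]])
    ultimately have "g i (g i w) - g i w = 0" using pt_eq_0D[OF I(1)[OF i] q _ v] by metis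
    then show ?thesis by simp
  qed
  have "wf_digraph (QM Q r M)" by unfold_locales (auto simp: QM_def)
  from indecomposable_idempotent[OF X_indec this G]
  have "(\<forall>i\<in>I. \<forall>w\<in>spc X i. ?G i w = 0) \<or> (\<forall>i\<in>I. \<forall>w\<in>spc X i. ?G i w = w)"
    using g_idem by (auto simp: QM_def)
  \<comment> \<open>The family is 0 at m_1, where X has dimension 1.\<close>
  moreover have "\<not> (\<forall>i\<in>I. \<forall>w\<in>spc X i. ?G i w = w)"
  proof
    assume *: "\<forall>i\<in>I. \<forall>w\<in>spc X i. ?G i w = w"
    obtain b where b: "B 1 = {b}" by (rule B1)
    then have "b \<in> spc X 1" using B_in[OF I1] by simp
    with * I1 have "b = 0" by fastforce
    with b B(2)[OF I1] show False using Xs.dependent_zero[of "B 1"] by simp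
  qed
  ultimately have G0: "\<forall>i\<in>I. \<forall>w\<in>spc X i. ?G i w = 0" by blast
  have g0: "g i w = 0" if "i \<in> {2..r}" "w \<in> spc X i" for i w
    using bspec[OF bspec[OF G0 I(1)[OF that(1)]] that(2)] that(1) by simp
  have diag: "entry e i i q s = 0" if i: "i \<in> {2..r}" and s: "s \<in> T i q" for i s
  proof (rule T_ext[OF I(1)[OF i] q entry_lin[OF e I(1)[OF i] I(1)[OF i] q] lin_on_zero(1)[OF vector_space_tensor_scale] _ s])
    fix v b assume v: "v \<in> spc (M i) q" and b: "b \<in> B i"
    note bX = B_in[OF I(1)[OF i] b]
    show "entry e i i q (pt i v b) = 0"
      unfolding g_eq[OF i q v bX] g0[OF i bX] by (rule pt_0_right[OF I(1)[OF i] q])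
  qed
  have row: "entry e i j q s = 0" if i: "i \<in> {2..r}" and j: "j \<in> I" and s: "s \<in> T j q" for i j s
  proof (cases i j rule: linorder_cases)
    case less
    then have "j \<in> {2..r}" using i j by auto
    from entry_upper[OF e g g_eq i this less] show ?thesis using q s by blast
  next
    case equal
    then show ?thesis using diag[OF i] s by simp
  next
    case greater
    then show ?thesis by (intro entry_lower[OF e] I(1)[OF i] j q s)
  qed
  have e_row: "e q t i = 0" if i: "i \<in> {2..r}" for i
    unfolding e_entry[OF e q t] by (rule sum.neutral, rule ballI) (rule row[OF i _ Fs_D(1)[OF t]])
  \<comment> \<open>Now e t is supported in the first summand, where e acts through e_11 = 0 and the
    column below it, so a second application of e kills the component at 1; idempotency brings this
    back to e t.\<close>
  have "e q t 1 = e q (e q t) 1" unfolding idem[OF q t] ..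
  also have "\<dots> = (\<Sum>j\<in>I. entry e 1 j q (e q t j))" by (rule e_entry[OF e q e_in[OF e q t]])
  also have "\<dots> = 0"
  proof (rule sum.neutral, rule ballI)
    fix j assume j: "j \<in> I"
    show "entry e 1 j q (e q t j) = 0"
    proof (cases "j = 1")
      case True
      show ?thesis unfolding True by (rule e11[OF q Fs_D(1)[OF e_in[OF e q t] I1]])
    next
      case False
      then have j2: "j \<in> {2..r}" using j by auto
      show ?thesis unfolding e_row[OF j2] by (rule entry_0[OF e I1 j q])
    qed
  qed
  finally have e_1: "e q t 1 = 0" .
  show ?thesis
  proof
    fix i
    consider "i = 1" | "i \<in> {2..r}" | "i \<notin> I" by fastforce
    then have "e q t i = 0"
      by cases (use e_1 e_row Fs_D(2)[OF e_in[OF e q t]] in metis)+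
    then show "e q t i = 0 i" by (simp only: zero_fun_apply)
  qed
qed

theorem F_indecomposable: "indecomposable Q F"
proof (rule indecomposableI[OF wf F_is_rep])
  obtain b where b: "B 1 = {b}" by (rule B1)
  obtain q v where q: "q \<in> verts Q" and v: "v \<in> spc (M 1) q" "v \<noteq> 0" by (rule M_nonzero[OF I1])
  \<comment> \<open>The summand N_1 is nonzero at a vertex where M_1 is, since X_{m_1} has a basis
    vector.\<close>
  have "Fs q \<noteq> {0}" by (rule Fs_nonzero[OF I1 q]) (use v b in auto)
  with q show "\<exists>q\<in>verts Q. spc F q \<noteq> {0}" unfolding F_simps(2) by (rule bexI[rotated])
  fix e assume e: "rep_hom Q F F e" and hyp: "\<And>q x. q \<in> verts Q \<Longrightarrow> x \<in> spc F q \<Longrightarrow> e q (e q x) = e q x"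
  have idem: "\<And>q x. q \<in> verts Q \<Longrightarrow> x \<in> Fs q \<Longrightarrow> e q (e q x) = e q x" by (rule hyp[unfolded F_simps(2)])
  have "(\<forall>q\<in>verts Q. \<forall>s\<in>T 1 q. entry e 1 1 q s = 0) \<or> (\<forall>q\<in>verts Q. \<forall>s\<in>T 1 q. entry e 1 1 q s = s)"
    by (rule N_idempotent[OF I1 b M_indec[OF I1] entry_diag[OF e I1]]) (rule entry_diag_idem[OF e idem I1])
  then show "(\<forall>q\<in>verts Q. \<forall>x\<in>spc F q. e q x = 0) \<or> (\<forall>q\<in>verts Q. \<forall>x\<in>spc F q. e q x = x)"
    unfolding F_simps(2)
  proof
    assume "\<forall>q\<in>verts Q. \<forall>s\<in>T 1 q. entry e 1 1 q s = 0"
    then have "e q t = 0" if "q \<in> verts Q" "t \<in> Fs q" for q t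
      using idempotent_eq_0[OF e idem _ that] by blast
    then show "(\<forall>q\<in>verts Q. \<forall>x\<in>Fs q. e q x = 0) \<or> (\<forall>q\<in>verts Q. \<forall>x\<in>Fs q. e q x = x)" by blast
  next
    assume id: "\<forall>q\<in>verts Q. \<forall>s\<in>T 1 q. entry e 1 1 q s = s"
    \<comment> \<open>The complementary idempotent has (1, 1) block 0, so it vanishes and e is the
      identity.\<close>
    define e' where "e' q t = t - e q t" for q t
    have ein: "e q t \<in> Fs q" and elin: "lin_on sclF sclF (Fs q) (e q)" if "q \<in> verts Q" "t \<in> Fs q" for q t
      using e_in[OF e that] e_lin[OF e that(1)] .
    have diff: "e q (t - e q t) = e q t - e q (e q t)" if "q \<in> verts Q" "t \<in> Fs q" for q t
      by (rule lin_on_diff_arg[OF Fs_sub[OF that(1)] sclF_vs e_lin[OF e that(1)] that(2) ein[OF that]])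
    have e': "rep_hom Q F F e'"
      unfolding rep_hom_def pre_hom_def F_simps(1,2)
    proof (intro conjI ballI subsetI)
      fix q assume q: "q \<in> verts Q"
      show "lin_on sclF sclF (Fs q) (e' q)"
        unfolding e'_def by (rule lin_on_diff[OF sclF_vs lin_on_id e_lin[OF e q]])
      fix x assume "x \<in> e' q ` Fs q"
      then obtain t where "x = e' q t" "t \<in> Fs q" by (rule imageE)
      then show "x \<in> Fs q" unfolding e'_def using Fv.subspace_diff[OF Fs_sub[OF q] _ ein[OF q]] by metis
    next
      fix \<rho> t assume \<rho>: "\<rho> \<in> arcs Q" and t: "t \<in> Fs (tail Q \<rho>)"
      have "rmap F \<rho> (t - e (tail Q \<rho>) t) = rmap F \<rho> t - rmap F \<rho> (e (tail Q \<rho>) t)"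
        by (rule lin_on_diff_arg[OF Fs_sub[OF tail_in[OF \<rho>]] sclF_vs F_rmap_hom(1)[OF \<rho>] t ein[OF tail_in[OF \<rho>] t]])
      moreover have "rmap F \<rho> (e (tail Q \<rho>) t) = e (head Q \<rho>) (rmap F \<rho> t)"
        using rep_homD(2)[OF e \<rho>] t unfolding F_simps(2) by blast
      ultimately show "defect Q F F e' \<rho> t = 0" unfolding defect_def e'_def by (simp only: diff_self)
    qed
    have idem': "e' q (e' q t) = e' q t" if "q \<in> verts Q" "t \<in> Fs q" for q t
      unfolding e'_def diff[OF that] idem[OF that] by (simp only: diff_self diff_0_right)
    have e'11: "entry e' 1 1 q s = 0" if "q \<in> verts Q" "s \<in> T 1 q" for q s
    proof -
      have "entry e' 1 1 q s = single 1 s 1 - entry e 1 1 q s"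
        unfolding entry_def e'_def by (rule fun_diff_def[THEN fun_cong])
      then show ?thesis using id that by (simp only: single_def simp_thms if_True diff_self)
    qed
    have "e q t = t" if "q \<in> verts Q" "t \<in> Fs q" for q t
      using idempotent_eq_0[OF e' idem' e'11 that] unfolding e'_def by (simp only: right_minus_eq)
    then show "(\<forall>q\<in>verts Q. \<forall>x\<in>Fs q. e q x = 0) \<or> (\<forall>q\<in>verts Q. \<forall>x\<in>Fs q. e q x = x)" by blast
  qed
qed

end

theorem theorem3p8:
  fixes Q :: "('q, 'a) pre_digraph"
    and r :: nat
    and M :: "nat \<Rightarrow> ('q, 'a, 'k::alg_closed_field, 'v::ab_group_add) quiver_rep"
    and \<chi> :: "nat \<Rightarrow> nat \<Rightarrow> nat \<Rightarrow> 'a \<Rightarrow> 'v \<Rightarrow> 'v"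
    and X :: "(nat, nat \<times> nat \<times> nat, 'k, 'w::ab_group_add) quiver_rep"
  assumes quiver: "wf_digraph Q"
    and no_oriented_cycles: "\<not> (\<exists>p. pre_digraph.cycle Q p)"
    and r_pos: "1 \<le> r"
    and M_indec: "\<And>i. i \<in> {1..r} \<Longrightarrow> indecomposable Q (M i)"
    and End_k: "\<And>j. j \<in> {2..r} \<Longrightarrow> Hom_Q Q (M j) (M j) = range (scalar_endo Q (M j))"
    and Hom_zero: "\<And>i j. i \<in> {1..r} \<Longrightarrow> j \<in> {1..r} \<Longrightarrow> i < j \<Longrightarrow> Hom_Q Q (M i) (M j) = {0}"
    and Ext_zero: "\<And>i j. i \<in> {1..r} \<Longrightarrow> j \<in> {1..r} \<Longrightarrow> i < j \<Longrightarrow>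
          Ext_Q Q (M i) (M j) = {ext_class Q (M i) (M j) 0}"
    and Hom_back_zero: "\<And>i j. i \<in> {1..r} \<Longrightarrow> j \<in> {1..r} \<Longrightarrow> i < j \<Longrightarrow> i \<noteq> 1 \<Longrightarrow> j \<noteq> 1 \<Longrightarrow>
          Hom_Q Q (M j) (M i) = {0}"
    and chi_basis: "\<And>i j. i \<in> {1..r} \<Longrightarrow> j \<in> {1..r} \<Longrightarrow> i \<noteq> j \<Longrightarrow>
          ext_basis Q (M i) (M j) (ext_dim Q (M i) (M j)) (\<chi> i j)"
    and X_rep: "is_rep (QM Q r M) X"
    and dim_X_m1: "vector_space.dim (scl X) (spc X 1) = 1"
    and iso: "Theta_induces_iso Q r M \<chi> X"
    and X_indec: "indecomposable (QM Q r M) X"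
  shows "indecomposable Q (F_rep Q r M \<chi> X)"
proof -
  have M_rep: "\<And>i. i \<in> {1..r} \<Longrightarrow> is_rep Q (M i)" using M_indec unfolding indecomposable_def by blast
  interpret theorem_setting Q r M \<chi> X
    by (intro theorem_setting.intro tensor_setting.intro theorem_setting_axioms.intro)
      (fact quiver M_rep chi_basis X_rep r_pos M_indec End_k Hom_zero Ext_zero Hom_back_zero dim_X_m1 iso X_indec)+
  show ?thesis by (rule F_indecomposable)
qed

end
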